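(* Let $d\ge2$, $0<\nu\le1/2$, $\tau\in(0,1]$, and let $F_s(s_1,s_2)$ be a real $C^2$ function with $|\partial^\alpha_{s_1,s_2,s}F_s(s_1,s_2)|\le C_1^\#(s,s_1,s_2)$ for $|\alpha|\le2$. Put $s_3=s_1+s_2-s$, $\omega^{12}_{3s}=|s_1|^2+|s_2|^2-|s_3|^2-|s|^2$ and $$I^0_s=\int_{\mathbb R^{2d}}ds_1ds_2\int_0^\tau\!\!\int_0^\tau d\theta_1d\theta_2\,F_s(s_1,s_2)e^{-\gamma_s(2\tau-\theta_1-\theta_2)+i\nu^{-1}\omega^{12}_{3s}(\theta_1-\theta_2)}.$$ Then for every $s\in\mathbb R^d$, $$\Big|I^0_s-\frac{1-e^{-2\gamma_s\tau}}{2\gamma_s}\nu\pi\int_{{}^s\Sigma_*}\frac{F_s(s_1,s_2)}{|(s-s_1,s-s_2)|}ds_1ds_2|_{{}^s\Sigma_*}\Big|\le C^\#(s;\aleph_d)\nu^{2-\aleph_d}.$$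
   Context: $\gamma_s=\gamma^0(|s|^2)$ with $\gamma^0$ smooth increasing, $\gamma^0\ge1$, all derivatives of polynomial growth, $c(1+y)^{r_*}\le\gamma^0(y)$, $|\partial^k\gamma^0(y)|\le C(1+y)^{r_*-k}$ for $0\le k\le3$, $y\ge0$ ($r_*\ge0$). ${}^s\Sigma_*=\{(s_1,s_2):(s_1-s)\cdot(s_2-s)=0\}\setminus\{(s,s)\}$ with Euclidean induced volume element. $\aleph_d=0$ for $d\ge3$ and an arbitrary positive number for $d=2$. $C^\#(\cdot)$ denotes nonnegative continuous functions decaying faster than any power of $\langle\cdot\rangle$; the one in the conclusion is independent of $\nu,\tau$. *)

theory Defs
  imports "HOL-Analysis.Analysis"
begin

definition rapid_decay :: "('a::real_normed_vector \<Rightarrow> real) \<Rightarrow> bool" where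
  "rapid_decay f \<longleftrightarrow> (\<forall>x. 0 \<le> f x) \<and> continuous_on UNIV f \<and>
     (\<forall>N::nat. \<exists>C. \<forall>x. f x * (sqrt (1 + (norm x)\<^sup>2)) ^ N \<le> C)"

text \<open>k-dimensional Hausdorff measure on a Euclidean space, normalised so that
  it agrees with k-dimensional Lebesgue measure on k-dimensional affine planes
  (hence it is the Euclidean induced volume on smooth k-dimensional submanifolds).\<close>
definition hausdorff_pre :: "nat \<Rightarrow> real \<Rightarrow> 'a::euclidean_space set \<Rightarrow> ennreal" where
  "hausdorff_pre k \<delta> A = (INF C \<in> {C :: nat \<Rightarrow> 'a set. A \<subseteq> (\<Union>i. C i) \<and>
        (\<forall>i. bounded (C i) \<and> diameter (C i) \<le> \<delta>)}.
      (\<Sum>i. ennreal (unit_ball_vol (real k) * (diameter (C i) / 2) ^ k)))"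

definition hausdorff_outer :: "nat \<Rightarrow> 'a::euclidean_space set \<Rightarrow> ennreal" where
  "hausdorff_outer k A = (SUP \<delta> \<in> {0<..}. hausdorff_pre k \<delta> A)"

definition hausdorff_measure :: "nat \<Rightarrow> 'a::euclidean_space measure" where
  "hausdorff_measure k = measure_of UNIV (sets borel) (hausdorff_outer k)"

definition smooth_real :: "(real \<Rightarrow> real) \<Rightarrow> bool" where
  "smooth_real g \<longleftrightarrow> (\<forall>k y. ((deriv ^^ k) g has_real_derivative (deriv ^^ Suc k) g y) (at y))"

definition C2_bounded_by :: "('a::euclidean_space \<Rightarrow> real) \<Rightarrow> ('a \<Rightarrow> real) \<Rightarrow> bool" where
  "C2_bounded_by F B \<longleftrightarrow> (\<exists>D1 D2.
     (\<forall>x. (F has_derivative D1 x) (at x)) \<and>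
     (\<forall>x v. ((\<lambda>y. D1 y v) has_derivative D2 x v) (at x)) \<and>
     (\<forall>v w. continuous_on UNIV (\<lambda>x. D2 x v w)) \<and>
     (\<forall>x. \<bar>F x\<bar> \<le> B x) \<and>
     (\<forall>x. \<forall>b\<in>Basis. \<bar>D1 x b\<bar> \<le> B x) \<and>
     (\<forall>x. \<forall>b\<in>Basis. \<forall>b'\<in>Basis. \<bar>D2 x b b'\<bar> \<le> B x))"

definition Sigma_star :: "(real^'n) \<Rightarrow> ((real^'n) \<times> (real^'n)) set" where
  "Sigma_star s = {(s1, s2). (s1 - s) \<bullet> (s2 - s) = 0} - {(s, s)}"

end

theory Submission
  imports Defs "HOL-Complex_Analysis.Complex_Analysis"
begin

text \<open>
  Put \<open>x = s1 - s\<close> and \<open>y = s2 - s\<close>. Then \<open>\<omega> = - 2 (x \<bullet> y)\<close>, and the time integral is an explicit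
  nonnegative even kernel \<open>K(x \<bullet> y)\<close> with \<open>K(t) \<le> 4 \<nu>\<^sup>2 / (\<nu>\<^sup>2 + 4 t\<^sup>2)\<close> and
  \<open>\<integral> K = \<nu> \<pi> (1 - exp (- 2 \<gamma> \<tau>)) / (2 \<gamma>)\<close>.
  Where \<open>\<bar>x\<^sub>i\<bar>\<close> is the largest coordinate of \<open>x\<close>, the hypersurface \<open>x \<bullet> y = 0\<close> is a graph of
  \<open>y\<^sub>i\<close> over the other \<open>2d - 1\<close> coordinates with area element \<open>\<bar>(x, y)\<bar> / \<bar>x\<^sub>i\<bar>\<close>, and using
  \<open>t = x \<bullet> y\<close> instead of \<open>y\<^sub>i\<close> as a coordinate turns the volume integral into
  \<open>\<integral> dz \<bar>x\<^sub>i\<bar>\<inverse> \<integral> dt K(t) F(p\<^sub>z + (t / x\<^sub>i) e\<^sub>i)\<close>, where \<open>p\<^sub>z\<close> runs through the hypersurface.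
  As \<open>K\<close> is even, the error only involves second differences of \<open>F\<close>, which are
  \<open>O(min(1, (t / x\<^sub>i)\<^sup>2))\<close>; with \<open>K(t) \<le> 4 \<nu> powr (2 - \<epsilon>) \<bar>t\<bar> powr (\<epsilon> - 2)\<close> it is bounded by
  \<open>\<nu> powr (2 - \<epsilon>)\<close> times the integral of \<open>\<bar>x\<^sub>i\<bar> powr (\<epsilon> - 2)\<close> against a rapidly decreasing weight,
  which is finite precisely if \<open>2 - \<epsilon> < d\<close>.

  The Hausdorff measure of a graph is found by comparing it locally with its tangent planes, on which
  Hausdorff and Lebesgue measure agree by the isodiametric inequality (Steiner symmetrization) and
  Vitali's covering theorem.
\<close>

subsection \<open>Hausdorff measure is a Borel measure\<close>

text \<open>The constant of the conclusion is chosen before \<open>F\<close>, \<nu> and \<tau>, so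
  every estimate must separate these from fixed integrals: \<open>1 \<le> \<gamma>\<close> bounds
  the kernel uniformly, and \<open>F\<close> enters only through a function of \<open>s\<close> that
  dominates \<open>C1\<close> times a polynomial weight in (x, y). The charts degenerate near x = 0.
  Solving always for the same y_1 would leave |x_1| powr (\<epsilon> - 2), which for \<epsilon> < 1
  is not integrable across the hyperplane x_1 = 0. Where |x_i| is the largest coordinate, the factor
  is comparable to |x| powr (\<epsilon> - 2) and singular only at the origin of R^d. This is why d =
  2 costs an arbitrarily small power of \<nu> and d \<ge> 3 costs none. On the part x = 0 of the
  cone no y_i can be solved for. That part has dimension d < 2d - 1; charts solved for x_j show that
  it is null. The density 1/|(s - s1, s - s2)| is forced: dividing the area element by |(x, y)|
  leaves 1/|x_i|, which is also the Jacobian of passing from y_i to t.\<close>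

lemma metric_outer_measure_closed:
  fixes f :: "'a::metric_space set \<Rightarrow> ennreal"
  assumes oms: "outer_measure_space UNIV f"
    and met: "\<And>A B \<rho>. 0 < \<rho> \<Longrightarrow> (\<And>a b. a \<in> A \<Longrightarrow> b \<in> B \<Longrightarrow> \<rho> \<le> dist a b) \<Longrightarrow> f A + f B \<le> f (A \<union> B)"
    and C: "closed C"
  shows "C \<in> lambda_system UNIV UNIV f"
proof (cases "C = {}")
  case True
  interpret algebra "UNIV::'a set" UNIV using algebra_Pow[of "UNIV::'a set"] by simp
  show ?thesis using oms True lambda_system_empty[of f] by (simp add: outer_measure_space_def)
next
  case False
  from oms have pos: "f {} = 0" and mono: "\<And>A B. A \<subseteq> B \<Longrightarrow> f A \<le> f B"
    and subd: "\<And>A::nat \<Rightarrow> 'a set. disjoint_family A \<Longrightarrow> f (\<Union>i. A i) \<le> (\<Sum>i. f (A i))"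
    unfolding outer_measure_space_def positive_def increasing_def countably_subadditive_def
    by (auto)
  have sub: "f (\<Union>i. A i) \<le> (\<Sum>i. f (A i))" for A :: "nat \<Rightarrow> 'a set"
  proof -
    have "f (\<Union>i. A i) \<le> (\<Sum>i. f (disjointed A i))"
      using subd[OF disjoint_family_disjointed[of A]] by (simp add: UN_disjointed_eq)
    also have "\<dots> \<le> (\<Sum>i. f (A i))" by (intro suminf_le allI mono disjointed_subset) auto
    finally show ?thesis .
  qed
  have sub2: "f (A \<union> B) \<le> f A + f B" for A B
  proof -
    have "f (\<Union>i. binaryset A B i) \<le> (\<Sum>i. f (binaryset A B i))" by (rule sub)
    also have "\<dots> = f A + f B"
      using sums_unique[OF binaryset_sums[of f A B]] pos by simp
    finally show ?thesis by (simp add: UN_binaryset_eq)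
  qed
  \<comment> \<open>Caratheodory's argument. \<open>R n\<close> is the shell of points of
    \<open>A\<close> whose distance to \<open>C\<close> lies between 1/(n+2) and 1/(n+1). Shells of
    equal parity are a positive distance apart, so \<open>met\<close> makes \<open>f\<close>
    superadditive on them. Both parities together show that the masses of the shells are summable,
    and up to a small tail only \<open>S n\<close> remains, which stays away from
    \<open>C\<close>.\<close>
  have main: "f (A \<inter> C) + f (A - C) \<le> f A" if fin: "f A < top" for A
  proof -
    define S where "S n = {x \<in> A. infdist x C \<ge> 1 / (real n + 1)}" for n
    define R where "R n = S (Suc n) - S n" for n
    have iR: "1 / (real n + 2) \<le> infdist x C \<and> infdist x C < 1 / (real n + 1) \<and> x \<in> A" if "x \<in> R n" for x n
      using that by (auto simp: R_def S_def algebra_simps)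
    have lip: "infdist x C - infdist y C \<le> dist x y" for x y
      using infdist_triangle[of x C y] by simp
    have par: "(\<Sum>j<N. f (R (2 * j + e))) \<le> f (\<Union>j<N. R (2 * j + e))" for N e
    proof (induction N)
      case (Suc N)
      have "f (\<Union>j<N. R (2 * j + e)) + f (R (2 * N + e)) \<le> f ((\<Union>j<N. R (2 * j + e)) \<union> R (2 * N + e))"
      proof (rule met)
        let ?m = "2 * N + e"
        \<comment> \<open>With m = 2N + e, the shells collected so far have distance at least 1/m
          from \<open>C\<close> and the new one less than 1/(m+1). For N = 0 the union is empty and
          any positive gap will do; the case is separated because m may then be 0.\<close>
        show "0 < (if N = 0 then 1 else 1 / real ?m - 1 / (real ?m + 1))"
          by (auto intro!: divide_strict_left_mono)
        fix a b assume a: "a \<in> (\<Union>j<N. R (2 * j + e))" and b: "b \<in> R ?m"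
        then obtain j where j: "j < N" "a \<in> R (2 * j + e)" by auto
        have "1 / real ?m \<le> 1 / (real (2 * j + e) + 2)" using j by (intro divide_left_mono) auto
        also have "\<dots> \<le> infdist a C" using iR[OF j(2)] by simp
        finally have "1 / real ?m \<le> infdist a C" .
        moreover have "infdist b C < 1 / (real ?m + 1)" using iR[OF b] by simp
        ultimately show "(if N = 0 then 1 else 1 / real ?m - 1 / (real ?m + 1)) \<le> dist a b"
          using lip[of a b] j by auto
      qed
      then have "(\<Sum>j<N. f (R (2 * j + e))) + f (R (2 * N + e)) \<le> f ((\<Union>j<N. R (2 * j + e)) \<union> R (2 * N + e))"
        using add_right_mono[OF Suc, of "f (R (2 * N + e))"] by (rule order_trans[rotated])
      then show ?case by (simp add: lessThan_Suc Un_commute add.commute)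
    qed (simp add: pos)
    have par': "(\<Sum>j. f (R (2 * j + e))) \<le> f A" for e
    proof -
      have "(\<Sum>j<N. f (R (2 * j + e))) \<le> f A" for N
        by (rule order_trans[OF par mono]) (use iR in auto)
      then show ?thesis by (simp add: suminf_eq_SUP SUP_le_iff)
    qed
    have bound: "(\<Sum>n<N. f (R n)) \<le> f A + f A" for N
    proof -
      have "(\<Sum>n<N. f (R n)) \<le> (\<Sum>n<2*N. f (R n))" by (rule sum_mono2) auto
      also have "\<dots> = (\<Sum>j<N. f (R (2*j+0))) + (\<Sum>j<N. f (R (2*j+1)))"
        by (induction N) (auto simp: algebra_simps)
      also have "\<dots> \<le> (\<Sum>j. f (R (2 * j + 0))) + (\<Sum>j. f (R (2 * j + 1)))"
        by (intro add_mono sum_le_suminf) auto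
      also have "\<dots> \<le> f A + f A" by (intro add_mono par')
      finally show ?thesis .
    qed
    have finR: "f (R n) < top" for n
      using mono[of "R n" A] iR[of _ n] fin by (meson order_le_less_trans subsetI)
    define r where "r n = enn2real (f (R n))" for n
    have fr: "f (R n) = ennreal (r n)" for n using finR[of n] by (simp add: r_def)
    have r0: "0 \<le> r n" for n by (simp add: r_def)
    have "summable r"
    proof (rule summableI_nonneg_bounded[OF r0])
      fix N
      have "ennreal (\<Sum>n<N. r n) \<le> f A + f A" using bound[of N] r0 by (simp add: fr)
      then show "(\<Sum>n<N. r n) \<le> enn2real (f A + f A)"
        using fin r0 by (metis enn2real_ennreal enn2real_mono ennreal_add_less_top sum_nonneg)
    qed
    show ?thesis
    proof (rule ennreal_le_epsilon)
      fix e :: real assume e: "0 < e"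
      obtain n where "norm (\<Sum>i. r (i + n)) < e"
        using suminf_exist_split[OF e \<open>summable r\<close>] by auto
      then have tail: "(\<Sum>i. f (R (i + n))) \<le> ennreal e"
        unfolding fr using r0 \<open>summable r\<close>
        by (subst suminf_ennreal2) (auto simp: summable_iff_shift intro!: ennreal_leI)
      have "A - C \<subseteq> S n \<union> (\<Union>i. R (i + n))"
      proof
        fix x assume x: "x \<in> A - C"
        then have "infdist x C \<noteq> 0" using C False by (simp add: in_closed_iff_infdist_zero)
        then have "0 < infdist x C" using infdist_nonneg[of x C] by linarith
        then obtain m where m: "1 / (real m + 1) < infdist x C"
          using nat_approx_posE by (metis Suc_eq_plus1 of_nat_Suc add.commute)
        have ex: "\<exists>m. x \<in> S m" using m x by (auto simp: S_def intro: less_imp_le)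
        show "x \<in> S n \<union> (\<Union>i. R (i + n))"
        proof (cases "x \<in> S n")
          case nS: False
          define k where "k = (LEAST m. x \<in> S m)"
          have k: "x \<in> S k" unfolding k_def using ex by (rule LeastI_ex)
          have least: "x \<notin> S l" if "l < k" for l using that not_less_Least unfolding k_def by blast
          have "n < k"
          proof (rule ccontr)
            assume "\<not> n < k"
            then have "1 / (real n + 1) \<le> 1 / (real k + 1)" by (intro divide_left_mono) auto
            then have "x \<in> S n" using k by (auto simp: S_def)
            then show False using nS by simp
          qed
          then obtain k' where k': "k = Suc k'" "n \<le> k'" by (metis Suc_le_mono Suc_leI less_imp_Suc_add le_add1)
          then have "x \<in> R ((k' - n) + n)" using k least[of k'] by (simp add: R_def)
          then show ?thesis by blast
        qed simp
      qed
      then have "f (A - C) \<le> f (S n \<union> (\<Union>i. R (i + n)))" by (rule mono)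
      also have "\<dots> \<le> f (S n) + f (\<Union>i. R (i + n))" by (rule sub2)
      also have "\<dots> \<le> f (S n) + ennreal e" using sub[of "\<lambda>i. R (i + n)"] tail by (meson add_left_mono order_trans)
      finally have "f (A \<inter> C) + f (A - C) \<le> f (A \<inter> C) + f (S n) + ennreal e"
        by (metis add.assoc add_left_mono)
      also have "f (A \<inter> C) + f (S n) \<le> f ((A \<inter> C) \<union> S n)"
      proof (rule met[of "1 / (real n + 1)"])
        fix a b assume "a \<in> A \<inter> C" "b \<in> S n"
        then show "1 / (real n + 1) \<le> dist a b"
          using infdist_le[of a C b] by (auto simp: S_def dist_commute)
      qed simp
      also have "\<dots> \<le> f A" by (rule mono) (auto simp: S_def)
      finally show "f (A \<inter> C) + f (A - C) \<le> f A + ennreal e" by simp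
    qed
  qed
  show ?thesis
    unfolding lambda_system_def
  proof (clarsimp)
    fix A
    have "f (A \<inter> C) + f (A - C) \<le> f A" using main[of A] by (cases "f A < top") (auto simp: not_less top_unique)
    moreover have "f A \<le> f (A \<inter> C) + f (A - C)" using sub2[of "A \<inter> C" "A - C"] by (simp add: Int_Diff_Un)
    ultimately show "f (C \<inter> A) + f ((UNIV - C) \<inter> A) = f A"
      by (metis Diff_eq Int_commute Compl_eq_Diff_UNIV antisym)
  qed
qed

text \<open>The volume of a k-ball with the diameter of \<open>S\<close>. In dimension k the
  isodiametric inequality says that no set of that diameter has larger Lebesgue measure.\<close>

definition diam_vol :: "nat \<Rightarrow> 'a::euclidean_space set \<Rightarrow> ennreal" where
  "diam_vol k S = ennreal (unit_ball_vol (real k) * (diameter S / 2) ^ k)"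

definition hcover :: "real \<Rightarrow> 'a::euclidean_space set \<Rightarrow> (nat \<Rightarrow> 'a set) \<Rightarrow> bool" where
  "hcover \<delta> A C \<longleftrightarrow> A \<subseteq> (\<Union>i. C i) \<and> (\<forall>i. bounded (C i) \<and> diameter (C i) \<le> \<delta>)"

lemma hausdorff_pre_eq: "hausdorff_pre k \<delta> A = (INF C \<in> {C. hcover \<delta> A C}. \<Sum>i. diam_vol k (C i))"
  by (simp add: hausdorff_pre_def hcover_def diam_vol_def)

lemma hausdorff_pre_le: "hcover \<delta> A C \<Longrightarrow> hausdorff_pre k \<delta> A \<le> (\<Sum>i. diam_vol k (C i))"
  unfolding hausdorff_pre_eq by (rule INF_lower) simp

lemma hausdorff_pre_close:
  "hausdorff_pre k \<delta> A < e \<Longrightarrow> \<exists>C. hcover \<delta> A C \<and> (\<Sum>i. diam_vol k (C i)) < e"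
  unfolding hausdorff_pre_eq INF_less_iff by auto

lemma hausdorff_pre_greatest:
  "(\<And>C. hcover \<delta> A C \<Longrightarrow> x \<le> (\<Sum>i. diam_vol k (C i))) \<Longrightarrow> x \<le> hausdorff_pre k \<delta> A"
  unfolding hausdorff_pre_eq by (rule INF_greatest) simp

lemma hausdorff_pre_antimono: "\<delta> \<le> \<delta>' \<Longrightarrow> A \<subseteq> B \<Longrightarrow> hausdorff_pre k \<delta>' A \<le> hausdorff_pre k \<delta> B"
  by (rule hausdorff_pre_greatest, rule hausdorff_pre_le) (meson hcover_def order_trans)

lemma hausdorff_pre_le_outer: "0 < \<delta> \<Longrightarrow> hausdorff_pre k \<delta> A \<le> hausdorff_outer k A"
  unfolding hausdorff_outer_def by (rule SUP_upper) simp

lemma hausdorff_outer_least: "(\<And>\<delta>. 0 < \<delta> \<Longrightarrow> hausdorff_pre k \<delta> A \<le> x) \<Longrightarrow> hausdorff_outer k A \<le> x"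
  unfolding hausdorff_outer_def by (rule SUP_least) simp

lemma hausdorff_outer_mono: "A \<subseteq> B \<Longrightarrow> hausdorff_outer k A \<le> hausdorff_outer k B"
  by (rule hausdorff_outer_least, rule order_trans[OF hausdorff_pre_antimono[OF order_refl] hausdorff_pre_le_outer])

text \<open>The assumption \<open>0 < k\<close> recurs from here on because \<open>0 ^ 0 = 1\<close>
  would give the empty set, and with it every padding member of a cover, weight 1.\<close>

lemma diam_vol_empty: "0 < k \<Longrightarrow> diam_vol k {} = 0"
  by (simp add: diam_vol_def)

lemma hausdorff_pre_empty: "0 < k \<Longrightarrow> 0 < \<delta> \<Longrightarrow> hausdorff_pre k \<delta> {} = 0"
  using hausdorff_pre_le[of \<delta> "{}" "\<lambda>_. {}" k] by (simp add: hcover_def diam_vol_empty)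

lemma hausdorff_pre_UN:
  "hausdorff_pre k \<delta> (\<Union>i. A i) \<le> (\<Sum>i. hausdorff_pre k \<delta> (A i))"
proof (rule ennreal_le_epsilon)
  let ?O = "hausdorff_pre k \<delta>"
  fix e :: real assume "0 < e" "(\<Sum>n. ?O (A n)) < top"
  then have *: "\<And>n. ?O (A n) < ?O (A n) + e * (1/2)^Suc n"
    by (auto simp add: less_top dest!: ennreal_suminf_lessD)
  obtain B where B: "\<And>n. hcover \<delta> (A n) (B n)"
    and Ble: "\<And>n. (\<Sum>i. diam_vol k (B n i)) \<le> ?O (A n) + e * (1/2)^(Suc n)"
    using hausdorff_pre_close[OF *] by (metis less_imp_le)
  define C where "C = case_prod B o prod_decode"
  have "hcover \<delta> (\<Union>i. A i) C"
    unfolding hcover_def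
  proof (intro conjI allI)
    show "(\<Union>i. A i) \<subseteq> (\<Union>i. C i)"
    proof
      fix x assume "x \<in> (\<Union>i. A i)"
      then obtain n i where "x \<in> B n i" using B unfolding hcover_def by blast
      then have "x \<in> C (prod_encode (n, i))" by (simp add: C_def)
      then show "x \<in> (\<Union>i. C i)" by blast
    qed
  qed (use B in \<open>auto simp: C_def hcover_def split: prod.split\<close>)
  then have "?O (\<Union>i. A i) \<le> (\<Sum>i. diam_vol k (C i))" by (rule hausdorff_pre_le)
  also have "\<dots> = (\<Sum>n. \<Sum>i. diam_vol k (B n i))"
    using suminf_ennreal_2dimen[of "\<lambda>n. \<Sum>i. diam_vol k (B n i)" "\<lambda>(n,i). diam_vol k (B n i)"]
    by (simp add: C_def case_prod_beta)
  also have "\<dots> \<le> (\<Sum>n. ?O (A n) + e * (1/2) ^ Suc n)"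
    by (intro suminf_le allI Ble) auto
  also have "... = (\<Sum>n. ?O (A n)) + (\<Sum>n. ennreal e * ennreal ((1/2) ^ Suc n))"
    using \<open>0 < e\<close> by (subst suminf_add[symmetric])
                     (auto simp del: ennreal_suminf_cmult simp add: ennreal_mult[symmetric])
  also have "\<dots> = (\<Sum>n. ?O (A n)) + e"
    unfolding ennreal_suminf_cmult
    by (subst suminf_ennreal_eq[OF zero_le_power power_half_series]) auto
  finally show "?O (\<Union>i. A i) \<le> (\<Sum>n. ?O (A n)) + e" .
qed

lemma outer_measure_space_hausdorff:
  assumes "0 < k"
  shows "outer_measure_space UNIV (hausdorff_outer k :: 'a::euclidean_space set \<Rightarrow> ennreal)"
  unfolding outer_measure_space_def
proof (intro conjI)
  show "positive UNIV (hausdorff_outer k :: 'a set \<Rightarrow> ennreal)"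
    unfolding positive_def hausdorff_outer_def by (simp add: hausdorff_pre_empty[OF assms] SUP_constant)
  show "increasing UNIV (hausdorff_outer k :: 'a set \<Rightarrow> ennreal)" by (auto simp: increasing_def intro: hausdorff_outer_mono)
  show "countably_subadditive UNIV (hausdorff_outer k :: 'a set \<Rightarrow> ennreal)"
    unfolding countably_subadditive_def
  proof (clarsimp, rule hausdorff_outer_least)
    fix A :: "nat \<Rightarrow> 'a set" and \<delta> :: real assume \<delta>: "0 < \<delta>"
    have "hausdorff_pre k \<delta> (\<Union>i. A i) \<le> (\<Sum>i. hausdorff_pre k \<delta> (A i))" by (rule hausdorff_pre_UN)
    also have "\<dots> \<le> (\<Sum>i. hausdorff_outer k (A i))"
      by (intro suminf_le allI hausdorff_pre_le_outer \<delta>) auto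
    finally show "hausdorff_pre k \<delta> (\<Union>i. A i) \<le> (\<Sum>i. hausdorff_outer k (A i))" .
  qed
qed

text \<open>A member of a cover at scale \<delta> < \<rho> cannot meet both sets, so every cover of
  the union splits into a cover of \<open>A\<close> and a cover of \<open>B\<close> without sharing
  members.\<close>

lemma hausdorff_pre_separated:
  assumes k: "0 < k" and d: "\<delta> < \<rho>" and sep: "\<And>a b. a \<in> A \<Longrightarrow> b \<in> B \<Longrightarrow> \<rho> \<le> dist a b" and \<delta>: "0 < \<delta>"
  shows "hausdorff_pre k \<delta> A + hausdorff_pre k \<delta> B \<le> hausdorff_pre k \<delta> (A \<union> B)"
proof (rule hausdorff_pre_greatest)
  fix C assume C: "hcover \<delta> (A \<union> B) C"
  define P where "P X i = (if C i \<inter> X = {} then {} else C i)" for X i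
  have cov: "hcover \<delta> X (P X)" if sub: "X \<subseteq> A \<union> B" for X
    unfolding hcover_def
  proof (intro conjI allI)
    show "X \<subseteq> (\<Union>i. P X i)"
    proof
      fix x assume x: "x \<in> X"
      then obtain i where "x \<in> C i" using C sub unfolding hcover_def by blast
      then have "x \<in> P X i" using x by (auto simp: P_def)
      then show "x \<in> (\<Union>i. P X i)" by blast
    qed
  qed (use C \<delta> in \<open>auto simp: P_def hcover_def\<close>)
  have "diam_vol k (P A i) + diam_vol k (P B i) \<le> diam_vol k (C i)" for i
  proof (cases "C i \<inter> A = {} \<or> C i \<inter> B = {}")
    case True then show ?thesis using k by (auto simp: P_def diam_vol_empty)
  next
    case False
    then obtain a b where "a \<in> C i" "b \<in> C i" "a \<in> A" "b \<in> B" by blast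
    then have "\<rho> \<le> diameter (C i)"
      using sep[of a b] diameter_bounded_bound[of "C i" a b] C by (force simp: hcover_def)
    then show ?thesis using C d unfolding hcover_def by (meson not_le order_trans)
  qed
  then have "(\<Sum>i. diam_vol k (P A i) + diam_vol k (P B i)) \<le> (\<Sum>i. diam_vol k (C i))"
    by (intro suminf_le) auto
  moreover have "(\<Sum>i. diam_vol k (P A i) + diam_vol k (P B i)) = (\<Sum>i. diam_vol k (P A i)) + (\<Sum>i. diam_vol k (P B i))"
    by (rule suminf_add[symmetric]) auto
  moreover have "hausdorff_pre k \<delta> A + hausdorff_pre k \<delta> B \<le> (\<Sum>i. diam_vol k (P A i)) + (\<Sum>i. diam_vol k (P B i))"
    by (intro add_mono hausdorff_pre_le cov) auto
  ultimately show "hausdorff_pre k \<delta> A + hausdorff_pre k \<delta> B \<le> (\<Sum>i. diam_vol k (C i))" by simp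
qed

text \<open>The two suprema on the left run over independent scales. Both are lowered to one common
  scale below \<rho>, which only increases \<open>hausdorff_pre\<close>.\<close>

lemma hausdorff_outer_separated:
  assumes k: "0 < k" and \<rho>: "0 < \<rho>" and sep: "\<And>a b. a \<in> A \<Longrightarrow> b \<in> B \<Longrightarrow> \<rho> \<le> dist a b"
  shows "hausdorff_outer k A + hausdorff_outer k B \<le> hausdorff_outer k (A \<union> B)"
proof -
  have *: "hausdorff_pre k \<delta> A + hausdorff_pre k \<delta>' B \<le> hausdorff_outer k (A \<union> B)" if "0 < \<delta>" "0 < \<delta>'" for \<delta> \<delta>'
  proof -
    define \<eta> where "\<eta> = min (min \<delta> \<delta>') (\<rho> / 2)"
    have "hausdorff_pre k \<delta> A + hausdorff_pre k \<delta>' B \<le> hausdorff_pre k \<eta> A + hausdorff_pre k \<eta> B"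
      by (intro add_mono hausdorff_pre_antimono) (auto simp: \<eta>_def)
    also have "\<dots> \<le> hausdorff_pre k \<eta> (A \<union> B)"
      by (rule hausdorff_pre_separated[OF k _ sep]) (use that \<rho> in \<open>auto simp: \<eta>_def\<close>)
    also have "\<dots> \<le> hausdorff_outer k (A \<union> B)" by (rule hausdorff_pre_le_outer) (use that \<rho> in \<open>auto simp: \<eta>_def\<close>)
    finally show ?thesis .
  qed
  have ne: "{0::real<..} \<noteq> {}" by auto
  show ?thesis
    unfolding hausdorff_outer_def[of k A] hausdorff_outer_def[of k B]
    by (subst ennreal_SUP_add_left[OF ne, symmetric], rule SUP_least, subst ennreal_SUP_add_right[OF ne], rule SUP_least)
      (use * in auto)
qed

text \<open>\<open>measure_of\<close> returns the zero measure for a set function that is not a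
  measure on the given sets, so this must be known before \<open>hausdorff_measure\<close> can be
  evaluated at all.\<close>

lemma measure_space_hausdorff:
  assumes "0 < k"
  shows "measure_space UNIV (sets borel) (hausdorff_outer k :: 'a::euclidean_space set \<Rightarrow> ennreal)"
proof -
  interpret sigma_algebra "UNIV::'a set" UNIV using sigma_algebra_Pow[of "UNIV::'a set"] by simp
  let ?L = "lambda_system UNIV UNIV (hausdorff_outer k :: 'a set \<Rightarrow> ennreal)"
  have L: "measure_space UNIV ?L (hausdorff_outer k)"
    by (rule caratheodory_lemma[OF outer_measure_space_hausdorff[OF assms]])
  then have sa: "sigma_algebra UNIV ?L" by (simp add: measure_space_def)
  have "sigma_sets UNIV (Collect closed) \<subseteq> ?L"
    by (rule sigma_algebra.sigma_sets_subset[OF sa])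
      (auto intro!: metric_outer_measure_closed outer_measure_space_hausdorff assms hausdorff_outer_separated)
  then have "sets borel \<subseteq> ?L" by (simp add: borel_eq_closed)
  moreover have "sigma_algebra UNIV (sets (borel :: 'a measure))" using sets.sigma_algebra_axioms[of borel] by simp
  ultimately show ?thesis using measure_down[OF L] by blast
qed

lemma sets_hausdorff [simp, measurable_cong]: "sets (hausdorff_measure k) = sets borel"
  unfolding hausdorff_measure_def space_borel[symmetric] by (rule sets.sets_measure_of_eq)

lemma space_hausdorff [simp]: "space (hausdorff_measure k) = UNIV"
  unfolding hausdorff_measure_def by (rule space_measure_of) simp

lemma emeasure_hausdorff:
  fixes A :: "'a::euclidean_space set"
  assumes "0 < k" "A \<in> sets borel"
  shows "emeasure (hausdorff_measure k) A = hausdorff_outer k A"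
proof -
  have "sigma_algebra UNIV (sets (borel::'a measure))" "positive (sets borel) (hausdorff_outer k::'a set \<Rightarrow> _)"
    "countably_additive (sets borel) (hausdorff_outer k::'a set \<Rightarrow> _)"
    using measure_space_hausdorff[OF assms(1), where 'a='a] unfolding measure_space_def by blast+
  then show ?thesis
    unfolding hausdorff_measure_def by (rule emeasure_measure_of_sigma) (rule assms(2))
qed

text \<open>A cover of \<open>A\<close> at scale \<delta>/L is pushed forward to a cover of the
  image at scale \<delta>. Its members are cut down to \<open>A\<close> beforehand, since the
  Lipschitz bound holds only there.\<close>

lemma hausdorff_outer_Lipschitz:
  fixes f :: "'a::euclidean_space \<Rightarrow> 'b::euclidean_space"
  assumes k: "0 < k" and L: "0 < L" and lip: "\<And>x y. x \<in> A \<Longrightarrow> y \<in> A \<Longrightarrow> dist (f x) (f y) \<le> L * dist x y"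
  shows "hausdorff_outer k (f ` A) \<le> ennreal (L ^ k) * hausdorff_outer k A"
proof (rule hausdorff_outer_least)
  fix \<delta> :: real assume \<delta>: "0 < \<delta>"
  have "hausdorff_pre k \<delta> (f ` A) \<le> (\<Sum>i. ennreal (L ^ k) * diam_vol k (C i))" if C: "hcover (\<delta> / L) A C" for C
  proof -
    have b: "bounded (C i)" and dC: "diameter (C i) \<le> \<delta> / L" for i using C by (auto simp: hcover_def)
    have dist: "dist (f x) (f y) \<le> L * diameter (C i)" if "x \<in> A \<inter> C i" "y \<in> A \<inter> C i" for x y i
      using lip[of x y] diameter_bounded_bound[OF b, of x i y] that L by (meson IntD1 IntD2 mult_left_mono order_less_imp_le order_trans)
    have bD: "bounded (f ` (A \<inter> C i))" for i
    proof (cases "A \<inter> C i = {}")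
      case False
      then obtain x where "x \<in> A \<inter> C i" by blast
      then show ?thesis using dist[of x i] by (auto simp: bounded_def)
    qed simp
    have dD: "diameter (f ` (A \<inter> C i)) \<le> L * diameter (C i)" for i
      using dist[of _ i] L diameter_ge_0[OF b, of i] by (intro diameter_le) (auto simp: dist_norm)
    have cov: "hcover \<delta> (f ` A) (\<lambda>i. f ` (A \<inter> C i))"
      unfolding hcover_def
    proof (intro conjI allI bD)
      show "f ` A \<subseteq> (\<Union>i. f ` (A \<inter> C i))" using C unfolding hcover_def by blast
      fix i show "diameter (f ` (A \<inter> C i)) \<le> \<delta>"
        using dD[of i] dC[of i] L by (simp add: field_simps)
    qed
    have "diam_vol k (f ` (A \<inter> C i)) \<le> ennreal (L ^ k) * diam_vol k (C i)" for i
    proof -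
      have "(diameter (f ` (A \<inter> C i)) / 2) ^ k \<le> (L * (diameter (C i) / 2)) ^ k"
        using dD[of i] diameter_ge_0[OF bD, of i] by (intro power_mono) auto
      then have "unit_ball_vol (real k) * (diameter (f ` (A \<inter> C i)) / 2) ^ k \<le> L ^ k * (unit_ball_vol (real k) * (diameter (C i) / 2) ^ k)"
        unfolding power_mult_distrib using mult_left_mono[of _ _ "unit_ball_vol (real k)"]
        by (fastforce simp: algebra_simps power_divide)
      then show ?thesis
        unfolding diam_vol_def using L by (subst ennreal_mult'[symmetric]) (auto intro!: ennreal_leI)
    qed
    then have "(\<Sum>i. diam_vol k (f ` (A \<inter> C i))) \<le> (\<Sum>i. ennreal (L ^ k) * diam_vol k (C i))" by (intro suminf_le) auto
    with hausdorff_pre_le[OF cov, of k] show ?thesis by (rule order_trans)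
  qed
  then have "hausdorff_pre k \<delta> (f ` A) / ennreal (L ^ k) \<le> hausdorff_pre k (\<delta> / L) A"
    using L by (intro hausdorff_pre_greatest) (simp add: divide_le_posI_ennreal mult.commute)
  then have "hausdorff_pre k \<delta> (f ` A) \<le> ennreal (L ^ k) * hausdorff_pre k (\<delta> / L) A"
    using mult_left_mono[of "hausdorff_pre k \<delta> (f ` A) / ennreal (L ^ k)" _ "ennreal (L ^ k)"] L
    by (simp add: ennreal_times_divide mult_divide_eq_ennreal mult.commute[of "ennreal _"])
  also have "\<dots> \<le> ennreal (L ^ k) * hausdorff_outer k A"
    using L \<delta> by (intro mult_left_mono hausdorff_pre_le_outer) auto
  finally show "hausdorff_pre k \<delta> (f ` A) \<le> ennreal (L ^ k) * hausdorff_outer k A" .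
qed

subsection \<open>The isodiametric inequality\<close>

text \<open>One-dimensional core of the symmetrization: \<open>Sup S - Inf T\<close> and
  \<open>Sup T - Inf S\<close> are both at most \<open>d\<close>, and they add up to the total
  length of the two enclosing intervals. Only these intervals have to be measurable.\<close>

lemma emeasure_real_sets_within:
  fixes S T :: "real set"
  assumes ne: "S \<noteq> {}" "T \<noteq> {}" and d: "\<And>u v. u \<in> S \<Longrightarrow> v \<in> T \<Longrightarrow> \<bar>u - v\<bar> \<le> d"
  shows "emeasure lborel S + emeasure lborel T \<le> ennreal (2 * d)"
proof -
  obtain u0 v0 where uv: "u0 \<in> S" "v0 \<in> T" using ne by auto
  have bS: "v0 - d \<le> u" "u \<le> v0 + d" if "u \<in> S" for u using d[OF that uv(2)] by auto
  have bT: "u0 - d \<le> v" "v \<le> u0 + d" if "v \<in> T" for v using d[OF uv(1) that] by auto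
  have bdd: "bdd_above S" "bdd_below S" "bdd_above T" "bdd_below T"
    using bS bT by (auto intro!: bdd_aboveI bdd_belowI)
  have S: "S \<subseteq> {Inf S..Sup S}" and T: "T \<subseteq> {Inf T..Sup T}"
    using bdd by (auto intro: cInf_lower cSup_upper)
  have leS: "Inf S \<le> Sup S" and leT: "Inf T \<le> Sup T" using S T ne by force+
  have "Sup S \<le> v + d" if "v \<in> T" for v
    using d[OF _ that] by (intro cSup_least ne) force
  then have "Sup S - d \<le> Inf T" by (intro cInf_greatest ne) force
  moreover have "Sup T \<le> u + d" if "u \<in> S" for u
    using d[OF that] by (intro cSup_least ne) force
  then have "Sup T - d \<le> Inf S" by (intro cInf_greatest ne) force
  ultimately have *: "(Sup S - Inf S) + (Sup T - Inf T) \<le> 2 * d" by linarith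
  have "emeasure lborel S + emeasure lborel T \<le> emeasure lborel {Inf S..Sup S} + emeasure lborel {Inf T..Sup T}"
    using S T by (intro add_mono emeasure_mono) auto
  also have "\<dots> = ennreal ((Sup S - Inf S) + (Sup T - Inf T))" using leS leT by simp
  also have "\<dots> \<le> ennreal (2 * d)" using * by (rule ennreal_leI)
  finally show ?thesis .
qed

text \<open>Replace every fibre in direction \<open>i\<close> by the centred open interval of the same length; squared diameters do not increase.\<close>

lemma steiner_symmetrization:
  fixes A :: "'i set" and E :: "('i \<Rightarrow> real) set"
  defines "M \<equiv> Pi\<^sub>M A (\<lambda>_. lborel :: real measure)"
  assumes A: "finite A" "i \<in> A" and E: "E \<in> sets M"
    and bd: "\<And>f g. f \<in> E \<Longrightarrow> g \<in> E \<Longrightarrow> (\<Sum>j\<in>A. (f j - g j)\<^sup>2) \<le> D"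
  shows "\<exists>E'\<in>sets M. emeasure M E' = emeasure M E \<and>
    (\<forall>f\<in>E'. \<forall>g\<in>E'. (\<Sum>j\<in>A. (f j - g j)\<^sup>2) \<le> D) \<and>
    (\<forall>f\<in>E'. f(i := - f i) \<in> E') \<and>
    (\<forall>j\<in>A. j \<noteq> i \<longrightarrow> (\<forall>f\<in>E. f(j := - f j) \<in> E) \<longrightarrow> (\<forall>f\<in>E'. f(j := - f j) \<in> E'))"
proof -
  interpret product_sigma_finite "\<lambda>_::'i. lborel :: real measure" by standard
  define I where "I = A - {i}"
  have I: "finite I" "i \<notin> I" "A = insert i I" using A by (auto simp: I_def)
  have spM: "f(j := u) \<in> space M" if "f \<in> space M" "j \<in> A" for f u j
    using that by (auto simp: M_def space_PiM PiE_iff extensional_def)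
  have spI: "f(i := u) \<in> space M" if "f \<in> space (Pi\<^sub>M I (\<lambda>_. lborel))" for f and u :: real
    using that by (auto simp: M_def I(3) space_PiM PiE_iff extensional_def)
  have upd: "(\<lambda>p. (fst p)(i := snd p)) \<in> M \<Otimes>\<^sub>M lborel \<rightarrow>\<^sub>M M"
    unfolding M_def by (rule measurable_fun_upd[where I=A]) (use A in auto)
  define sl where "sl f = {u. f(i := u) \<in> E}" for f
  define m where "m f = emeasure lborel (sl f)" for f
  have sl[measurable]: "sl f \<in> sets borel" if "f \<in> space M" for f
  proof -
    have "(\<lambda>u. f(i := u)) \<in> lborel \<rightarrow>\<^sub>M M"
      using measurable_compose[OF measurable_Pair1'[OF that] upd] by (simp add: comp_def)
    from measurable_sets[OF this E] show ?thesis by (simp add: sl_def vimage_def)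
  qed
  have m_eq: "m f = (\<integral>\<^sup>+u. indicator E (f(i := u)) \<partial>lborel)" if "f \<in> space M" for f
  proof -
    have "(\<integral>\<^sup>+u. indicator E (f(i := u)) \<partial>lborel) = (\<integral>\<^sup>+u. indicator (sl f) u \<partial>lborel)"
      by (intro nn_integral_cong) (simp add: sl_def indicator_def)
    then show ?thesis using sl[OF that] by (simp add: m_def)
  qed
  have "(\<lambda>f. \<integral>\<^sup>+u. indicator E ((fst (f,u))(i := snd (f,u))) \<partial>lborel) \<in> borel_measurable M"
    by (intro lborel.borel_measurable_nn_integral) (use measurable_compose[OF upd borel_measurable_indicator[OF E]] in \<open>simp add: case_prod_unfold\<close>)
  then have mm[measurable]: "m \<in> borel_measurable M" by (subst measurable_cong[where g="\<lambda>f. \<integral>\<^sup>+u. indicator E (f(i := u)) \<partial>lborel"]) (auto simp: m_eq)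
  have ci[measurable]: "(\<lambda>f. f i) \<in> borel_measurable M"
    unfolding M_def using measurable_component_singleton[OF A(2), of "\<lambda>_. lborel :: real measure"] by simp
  \<comment> \<open>\<open>sl f\<close> is the fibre of \<open>E\<close> through \<open>f\<close>,
    and \<open>m f\<close> its length, possibly infinite. The strict inequality makes the new fibre
    empty when \<open>m f = 0\<close>; hence every point of \<open>E'\<close> has a nonempty old
    fibre, which the diameter bound relies on.\<close>
  define E' where "E' = {f \<in> space M. ennreal (2 * \<bar>f i\<bar>) < m f}"
  have E': "E' \<in> sets M" unfolding E'_def by measurable
  have mi: "m (f(i := u)) = m f" for f u by (simp add: m_def sl_def)
  have len: "(\<integral>\<^sup>+u. indicator E' (f(i := u)) \<partial>lborel) = m f" if f: "f \<in> space (Pi\<^sub>M I (\<lambda>_. lborel))" for f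
  proof -
    have "(\<integral>\<^sup>+u. indicator E' (f(i := u)) \<partial>lborel) = (\<integral>\<^sup>+u. indicator {u. ennreal (2 * \<bar>u\<bar>) < m f} u \<partial>lborel)"
      by (intro nn_integral_cong) (simp add: E'_def mi spI[OF f] indicator_def)
    also have "\<dots> = emeasure lborel {u. ennreal (2 * \<bar>u\<bar>) < m f}"
      by (rule nn_integral_indicator) simp
    also have "\<dots> = m f"
    proof (cases "m f" rule: ennreal_cases)
      case (real r)
      then have "{u. ennreal (2 * \<bar>u\<bar>) < m f} = {- r / 2<..<r / 2}" by (auto simp: ennreal_less_iff)
      then show ?thesis using real by simp
    next
      case top then show ?thesis by simp
    qed
    finally show ?thesis .
  qed
  have "emeasure M E' = (\<integral>\<^sup>+f. indicator E' f \<partial>M)" using E' by simp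
  also have "\<dots> = (\<integral>\<^sup>+f. (\<integral>\<^sup>+u. indicator E' (f(i := u)) \<partial>lborel) \<partial>(Pi\<^sub>M I (\<lambda>_. lborel)))"
    unfolding M_def I(3) using E' by (intro product_nn_integral_insert) (auto simp: I M_def)
  also have "\<dots> = (\<integral>\<^sup>+f. (\<integral>\<^sup>+u. indicator E (f(i := u)) \<partial>lborel) \<partial>(Pi\<^sub>M I (\<lambda>_. lborel)))"
  proof (rule nn_integral_cong)
    fix f assume f: "f \<in> space (Pi\<^sub>M I (\<lambda>_. lborel :: real measure))"
    show "(\<integral>\<^sup>+u. indicator E' (f(i := u)) \<partial>lborel) = (\<integral>\<^sup>+u. indicator E (f(i := u)) \<partial>lborel)"
      using len[OF f] m_eq[OF spI[OF f, of 0]] by (simp add: mi)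
  qed
  also have "\<dots> = (\<integral>\<^sup>+f. indicator E f \<partial>M)"
    unfolding M_def I(3) using E by (intro product_nn_integral_insert[symmetric]) (auto simp: I M_def)
  also have "\<dots> = emeasure M E" using E by simp
  finally have em: "emeasure M E' = emeasure M E" .
  have bd': "(\<Sum>j\<in>A. (f j - g j)\<^sup>2) \<le> D" if f: "f \<in> E'" and g: "g \<in> E'" for f g
  proof -
    define \<rho> where "\<rho> = (\<Sum>j\<in>I. (f j - g j)\<^sup>2)"
    have nef: "sl f \<noteq> {}" "sl g \<noteq> {}" using f g by (auto simp: E'_def m_def)
    have uv: "\<rho> + (u - v)\<^sup>2 \<le> D" if "u \<in> sl f" "v \<in> sl g" for u v
    proof -
      have "(\<Sum>j\<in>A. ((f(i := u)) j - (g(i := v)) j)\<^sup>2) = (u - v)\<^sup>2 + \<rho>"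
        using I unfolding I(3) \<rho>_def by (subst sum.insert) (auto intro!: sum.cong)
      with bd[of "f(i := u)" "g(i := v)"] that show ?thesis by (simp add: sl_def)
    qed
    have D\<rho>: "0 \<le> D - \<rho>"
    proof -
      obtain u v where "u \<in> sl f" "v \<in> sl g" using nef by blast
      from uv[OF this] zero_le_power2[of "u - v"] show ?thesis by linarith
    qed
    have "m f + m g \<le> ennreal (2 * sqrt (D - \<rho>))"
      unfolding m_def
    proof (rule emeasure_real_sets_within[OF nef])
      fix u v assume "u \<in> sl f" "v \<in> sl g"
      from uv[OF this] have "(u - v)\<^sup>2 \<le> D - \<rho>" by simp
      then show "\<bar>u - v\<bar> \<le> sqrt (D - \<rho>)" using real_le_rsqrt[of "\<bar>u - v\<bar>" "D - \<rho>"] by simp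
    qed
    moreover have "ennreal (2 * \<bar>f i\<bar>) + ennreal (2 * \<bar>g i\<bar>) \<le> m f + m g"
      using f g by (intro add_mono) (auto simp: E'_def)
    ultimately have "ennreal (2 * \<bar>f i\<bar> + 2 * \<bar>g i\<bar>) \<le> ennreal (2 * sqrt (D - \<rho>))"
      by (simp add: ennreal_plus)
    then have "2 * \<bar>f i\<bar> + 2 * \<bar>g i\<bar> \<le> 2 * sqrt (D - \<rho>)" using D\<rho> by (subst (asm) ennreal_le_iff) auto
    then have "\<bar>f i - g i\<bar> \<le> sqrt (D - \<rho>)" by linarith
    then have "(f i - g i)\<^sup>2 \<le> D - \<rho>" using D\<rho> by (metis abs_ge_zero power2_abs power_mono real_sqrt_pow2)
    then show ?thesis using I unfolding I(3) \<rho>_def by (subst sum.insert) auto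
  qed
  \<comment> \<open>Reflection in another coordinate carries each fibre to one of equal length, so
    symmetries gained in earlier rounds survive this one.\<close>
  have sym: "f(j := - f j) \<in> E'" if j: "j \<in> A" "j \<noteq> i" and Ej: "\<forall>f\<in>E. f(j := - f j) \<in> E" and f: "f \<in> E'" for f j
  proof -
    have tw: "f(i := u, j := - f j) = (f(j := - f j))(i := u)" for u using j by (simp add: fun_upd_twist)
    have "sl (f(j := - f j)) = sl f"
    proof (intro set_eqI iffI)
      fix u assume "u \<in> sl f"
      then have "f(i := u) \<in> E" by (simp add: sl_def)
      with Ej have "(f(i := u))(j := - (f(i := u)) j) \<in> E" by blast
      then show "u \<in> sl (f(j := - f j))" using j tw[of u] by (simp add: sl_def)
    next
      fix u assume "u \<in> sl (f(j := - f j))"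
      then have "(f(j := - f j))(i := u) \<in> E" by (simp add: sl_def)
      with Ej have "((f(j := - f j))(i := u))(j := - ((f(j := - f j))(i := u)) j) \<in> E" by blast
      moreover have "((f(j := - f j))(i := u))(j := - ((f(j := - f j))(i := u)) j) = f(i := u)" using j by auto
      ultimately show "u \<in> sl f" by (simp add: sl_def)
    qed
    then show ?thesis using f j spM[of f j] by (simp add: E'_def m_def)
  qed
  have symi: "f(i := - f i) \<in> E'" if "f \<in> E'" for f
    using that A(2) spM[of f i] by (simp add: E'_def mi)
  show ?thesis using E' em bd' sym symi by (intro bexI[of _ E']) auto
qed

text \<open>After symmetrization in every coordinate the set contains -f along with f. Their
  distance 2|f| is at most \<open>D\<close>, so the set lies in the centred ball of radius D/2,
  while its volume is still that of \<open>K\<close>.\<close>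

lemma isodiametric_inequality:
  fixes K :: "'a::euclidean_space set"
  assumes K: "K \<in> sets borel" and D: "0 \<le> D" and bd: "\<And>x y. x \<in> K \<Longrightarrow> y \<in> K \<Longrightarrow> dist x y \<le> D"
  shows "emeasure lborel K \<le> ennreal (unit_ball_vol (real DIM('a)) * (D / 2) ^ DIM('a))"
proof -
  let ?M = "Pi\<^sub>M (Basis :: 'a set) (\<lambda>_. lborel :: real measure)"
  define T where "T f = (\<Sum>b\<in>Basis. f b *\<^sub>R b)" for f :: "'a \<Rightarrow> real"
  have T[measurable]: "T \<in> ?M \<rightarrow>\<^sub>M borel" unfolding T_def by measurable
  have lb: "lborel = distr ?M borel T" unfolding T_def by (rule lborel_eq)
  have dT: "(norm (T f - T g))\<^sup>2 = (\<Sum>b\<in>Basis. (f b - g b)\<^sup>2)" for f g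
  proof -
    have "T f - T g = (\<Sum>b\<in>Basis. (f b - g b) *\<^sub>R b)"
      by (simp add: T_def sum_subtractf scaleR_diff_left)
    then show ?thesis
      by (simp add: power2_norm_eq_inner inner_sum_left inner_sum_right inner_Basis if_distrib cong: if_cong)
       (simp add: power2_eq_square)
  qed
  define E0 where "E0 = T -` K \<inter> space ?M"
  have E0: "E0 \<in> sets ?M" unfolding E0_def using K by measurable
  have e0: "emeasure ?M E0 = emeasure lborel K" unfolding lb E0_def using K by (subst emeasure_distr) auto
  have bd0: "(\<Sum>j\<in>Basis. (f j - g j)\<^sup>2) \<le> D\<^sup>2" if "f \<in> E0" "g \<in> E0" for f g
    using bd[of "T f" "T g"] that unfolding dT[symmetric] E0_def
    by (auto simp: dist_norm intro: power_mono)
  have stp: "\<exists>E\<in>sets ?M. emeasure ?M E = emeasure lborel K \<and>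
    (\<forall>f\<in>E. \<forall>g\<in>E. (\<Sum>j\<in>Basis. (f j - g j)\<^sup>2) \<le> D\<^sup>2) \<and> (\<forall>j\<in>B. \<forall>f\<in>E. f(j := - f j) \<in> E)" if "B \<subseteq> Basis" for B
    using finite_subset[OF that finite_Basis] that
  proof (induction B rule: finite_induct)
    case empty then show ?case using E0 e0 bd0 by auto
  next
    case (insert i B)
    then obtain E where E: "E \<in> sets ?M" "emeasure ?M E = emeasure lborel K"
      "\<And>f g. f \<in> E \<Longrightarrow> g \<in> E \<Longrightarrow> (\<Sum>j\<in>Basis. (f j - g j)\<^sup>2) \<le> D\<^sup>2" "\<forall>j\<in>B. \<forall>f\<in>E. f(j := - f j) \<in> E"
      using insert.IH insert.prems by blast
    have i: "i \<in> Basis" using insert by auto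
    obtain E' where E': "E' \<in> sets ?M" "emeasure ?M E' = emeasure ?M E"
      "\<forall>f\<in>E'. \<forall>g\<in>E'. (\<Sum>j\<in>Basis. (f j - g j)\<^sup>2) \<le> D\<^sup>2" "\<forall>f\<in>E'. f(i := - f i) \<in> E'"
      "\<forall>j\<in>Basis. j \<noteq> i \<longrightarrow> (\<forall>f\<in>E. f(j := - f j) \<in> E) \<longrightarrow> (\<forall>f\<in>E'. f(j := - f j) \<in> E')"
      using steiner_symmetrization[OF finite_Basis i E(1) E(3)] by blast
    have "\<forall>j\<in>insert i B. \<forall>f\<in>E'. f(j := - f j) \<in> E'"
    proof
      fix j assume "j \<in> insert i B"
      then show "\<forall>f\<in>E'. f(j := - f j) \<in> E'" using E'(4,5) E(4) insert.prems by (cases "j = i") auto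
    qed
    moreover have "emeasure ?M E' = emeasure lborel K" using E'(2) E(2) by simp
    ultimately show ?case using E'(1,3) by blast
  qed
  from stp[OF order_refl] obtain E where E: "E \<in> sets ?M" "emeasure ?M E = emeasure lborel K"
    "\<And>f g. f \<in> E \<Longrightarrow> g \<in> E \<Longrightarrow> (\<Sum>j\<in>Basis. (f j - g j)\<^sup>2) \<le> D\<^sup>2"
    "\<And>j f. j \<in> Basis \<Longrightarrow> f \<in> E \<Longrightarrow> f(j := - f j) \<in> E"
    by blast
  have neg: "(\<lambda>j. if j \<in> C then - f j else f j) \<in> E" if "f \<in> E" "C \<subseteq> Basis" for f C
    using finite_subset[OF that(2) finite_Basis] that(2)
  proof (induction C rule: finite_induct)
    case (insert i C)
    have "(\<lambda>j. if j \<in> insert i C then - f j else f j) = (\<lambda>j. if j \<in> C then - f j else f j)(i := - (if i \<in> C then - f i else f i))"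
      using insert by auto
    then show ?case using insert E(4)[of i "\<lambda>j. if j \<in> C then - f j else f j"] by simp
  qed (use that in simp)
  have "E \<subseteq> T -` cball 0 (D / 2) \<inter> space ?M"
  proof
    fix f assume f: "f \<in> E"
    have "(\<Sum>j\<in>Basis. (f j - (if j \<in> Basis then - f j else f j))\<^sup>2) \<le> D\<^sup>2"
      using E(3)[OF f neg[OF f order_refl]] .
    also have "(\<Sum>j\<in>Basis. (f j - (if j \<in> Basis then - f j else f j))\<^sup>2) = (\<Sum>j\<in>Basis. 4 * (f j - 0)\<^sup>2)"
      by (intro sum.cong) (auto simp: power2_eq_square)
    also have "\<dots> = 4 * (norm (T f - T (\<lambda>_. 0)))\<^sup>2" by (simp add: dT sum_distrib_left)
    finally have "(2 * norm (T f))\<^sup>2 \<le> D\<^sup>2" by (simp add: T_def power_mult_distrib)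
    then have "2 * norm (T f) \<le> D" using D by (rule power2_le_imp_le)
    then show "f \<in> T -` cball 0 (D / 2) \<inter> space ?M" using sets.sets_into_space[OF E(1)] f by auto
  qed
  then have "emeasure ?M E \<le> emeasure ?M (T -` cball 0 (D / 2) \<inter> space ?M)"
    by (intro emeasure_mono) measurable
  also have "\<dots> = emeasure lborel (cball (0::'a) (D / 2))" unfolding lb by (subst emeasure_distr) auto
  also have "\<dots> = ennreal (unit_ball_vol (real DIM('a)) * (D / 2) ^ DIM('a))"
    using D by (intro emeasure_cball) simp
  finally show ?thesis by (simp add: E(2))
qed

section \<open>Hausdorff and Lebesgue measure agree in full dimension\<close>

lemma lborel_le_hausdorff:
  fixes A :: "'a::euclidean_space set"
  assumes "A \<in> sets borel"
  shows "emeasure lborel A \<le> hausdorff_outer DIM('a) A"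
proof -
  have "emeasure lborel A \<le> hausdorff_pre DIM('a) 1 A"
  proof (rule hausdorff_pre_greatest)
    fix C assume C: "hcover 1 A C"
    then have b: "bounded (C i)" for i by (simp add: hcover_def)
    \<comment> \<open>The members of a cover are arbitrary sets. Their closures are Borel and have
      the same diameters, so the isodiametric inequality applies to each of them.\<close>
    have "A \<subseteq> (\<Union>i. closure (C i))" using C closure_subset unfolding hcover_def by blast
    then have "emeasure lborel A \<le> emeasure lborel (\<Union>i. closure (C i))" by (intro emeasure_mono) auto
    also have "\<dots> \<le> (\<Sum>i. emeasure lborel (closure (C i)))" by (intro emeasure_subadditive_countably) auto
    also have "\<dots> \<le> (\<Sum>i. diam_vol DIM('a) (C i))"
    proof (intro suminf_le allI)
      fix i
      show "emeasure lborel (closure (C i)) \<le> diam_vol DIM('a) (C i)"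
        unfolding diam_vol_def diameter_closure[OF b, of i, symmetric]
        using b[of i] by (intro isodiametric_inequality diameter_ge_0 bounded_closure diameter_bounded_bound) auto
    qed auto
    finally show "emeasure lborel A \<le> (\<Sum>i. diam_vol DIM('a) (C i))" .
  qed
  also have "\<dots> \<le> hausdorff_outer DIM('a) A" by (rule hausdorff_pre_le_outer) simp
  finally show ?thesis .
qed

text \<open>Evaluates a Vitali family: the \<open>B i\<close> cover, the \<open>V i\<close> are
  disjoint inside \<open>W\<close>, and \<open>c\<close> compares the two. It is applied with
  fivefold enlarged balls and with \<open>B = V\<close>. The countable index set may be finite, so
  the cover is padded with empty sets to a sequence.\<close>

lemma hausdorff_pre_le_disjoint:
  fixes B V :: "'i \<Rightarrow> 'a::euclidean_space set"
  assumes k: "0 < k" and \<delta>: "0 < \<delta>" and I: "countable I" and A: "A \<subseteq> (\<Union>i\<in>I. B i)"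
    and B: "\<And>i. i \<in> I \<Longrightarrow> bounded (B i) \<and> diameter (B i) \<le> \<delta>"
    and V: "\<And>i. i \<in> I \<Longrightarrow> V i \<in> sets borel \<and> V i \<subseteq> W" and W: "W \<in> sets borel"
    and disj: "pairwise (\<lambda>i j. disjnt (V i) (V j)) I"
    and le: "\<And>i. i \<in> I \<Longrightarrow> diam_vol k (B i) \<le> c * emeasure lborel (V i)"
  shows "hausdorff_pre k \<delta> A \<le> c * emeasure lborel W"
proof -
  define N where "N = to_nat_on I ` I"
  define B' where "B' n = (if n \<in> N then B (from_nat_into I n) else {})" for n
  define V' where "V' n = (if n \<in> N then V (from_nat_into I n) else {})" for n
  have fI: "from_nat_into I n \<in> I" if "n \<in> N" for n
    using that I by (auto simp: N_def)
  have "hcover \<delta> A B'"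
    unfolding hcover_def
  proof (intro conjI allI)
    show "A \<subseteq> (\<Union>n. B' n)"
    proof
      fix x assume "x \<in> A"
      then obtain i where i: "i \<in> I" "x \<in> B i" using A by blast
      then have "x \<in> B' (to_nat_on I i)" using I by (simp add: B'_def N_def)
      then show "x \<in> (\<Union>n. B' n)" by blast
    qed
  qed (use B fI \<delta> in \<open>auto simp: B'_def\<close>)
  then have "hausdorff_pre k \<delta> A \<le> (\<Sum>n. diam_vol k (B' n))" by (rule hausdorff_pre_le)
  also have "\<dots> \<le> (\<Sum>n. c * emeasure lborel (V' n))"
    using le fI by (intro suminf_le) (auto simp: B'_def V'_def diam_vol_empty[OF k])
  also have "\<dots> = c * (\<Sum>n. emeasure lborel (V' n))" by simp
  also have "(\<Sum>n. emeasure lborel (V' n)) = emeasure lborel (\<Union>n. V' n)"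
  proof (rule suminf_emeasure)
    show "range V' \<subseteq> sets lborel" using V fI by (auto simp: V'_def)
    show "disjoint_family V'"
      unfolding disjoint_family_on_def
    proof (intro ballI impI)
      fix m n :: nat assume "m \<noteq> n"
      show "V' m \<inter> V' n = {}"
      proof (cases "m \<in> N \<and> n \<in> N")
        case True
        then have "from_nat_into I m \<noteq> from_nat_into I n"
          using \<open>m \<noteq> n\<close> I unfolding N_def by (metis to_nat_on_from_nat_into)
        then show ?thesis using disj fI True by (auto simp: V'_def pairwise_def disjnt_def)
      qed (auto simp: V'_def)
    qed
  qed
  also have "c * emeasure lborel (\<Union>n. V' n) \<le> c * emeasure lborel W"
    using V fI W by (intro mult_left_mono emeasure_mono) (auto simp: V'_def split: if_splits)
  finally show ?thesis .
qed

lemma hausdorff_pre_Un: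
  fixes A B :: "'a::euclidean_space set"
  assumes "0 < k" "0 < \<delta>"
  shows "hausdorff_pre k \<delta> (A \<union> B) \<le> hausdorff_pre k \<delta> A + hausdorff_pre k \<delta> B"
proof -
  have "hausdorff_pre k \<delta> (\<Union>i. binaryset A B i) \<le> (\<Sum>i. hausdorff_pre k \<delta> (binaryset A B i))" by (rule hausdorff_pre_UN)
  also have "\<dots> = hausdorff_pre k \<delta> A + hausdorff_pre k \<delta> B"
    using sums_unique[OF binaryset_sums[of "hausdorff_pre k \<delta>" A B]] hausdorff_pre_empty[OF assms, where 'a='a] by simp
  finally show ?thesis by (simp add: UN_binaryset_eq)
qed

lemma diameter_cball_le:
  fixes x :: "'a::euclidean_space"
  assumes "0 \<le> r"
  shows "diameter (cball x r) \<le> 2 * r"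
proof (rule diameter_le)
  fix u v assume "u \<in> cball x r" "v \<in> cball x r"
  then show "norm (u - v) \<le> 2 * r"
    using dist_triangle[of u v x] by (simp add: dist_norm[symmetric] dist_commute)
qed (use assms in auto)

lemma diam_vol_cball_le:
  fixes x y :: "'a::euclidean_space"
  assumes "0 \<le> r" "0 \<le> c"
  shows "diam_vol DIM('a) (cball x (c * r)) \<le> ennreal (c ^ DIM('a)) * emeasure lborel (cball y r)"
proof -
  have "(diameter (cball x (c * r)) / 2) ^ DIM('a) \<le> (c * r) ^ DIM('a)"
    using diameter_cball_le[of "c * r" x] assms diameter_ge_0[OF bounded_cball, of x "c * r"]
    by (intro power_mono) auto
  then have "diam_vol DIM('a) (cball x (c * r)) \<le> ennreal (unit_ball_vol (real DIM('a)) * (c * r) ^ DIM('a))"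
    unfolding diam_vol_def by (intro ennreal_leI mult_left_mono) auto
  also have "\<dots> = ennreal (c ^ DIM('a)) * emeasure lborel (cball y r)"
    using assms by (simp add: emeasure_cball power_mult_distrib ennreal_mult'[symmetric] mult_ac)
  finally show ?thesis .
qed

text \<open>The lossy factor is harmless: the bound only serves to show that Lebesgue null sets,
  such as the part missed by the sharp covering below, are null for
  \<open>hausdorff_pre\<close>.\<close>

lemma hausdorff_pre_open_le:
  fixes U :: "'a::euclidean_space set"
  assumes U: "open U" and \<delta>: "0 < \<delta>"
  shows "hausdorff_pre DIM('a) \<delta> U \<le> ennreal (5 ^ DIM('a)) * emeasure lborel U"
proof -
  \<comment> \<open>With radii at most \<delta>/10, the fivefold enlargements of Vitali's lemma
    still have diameter at most \<delta>.\<close>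
  define K where "K = {(x, r). 0 < r \<and> r \<le> \<delta> / 10 \<and> cball x r \<subseteq> U}"
  have cov: "U \<subseteq> (\<Union>p\<in>K. cball (fst p) (snd p))"
  proof
    fix x assume "x \<in> U"
    then obtain e where e: "e > 0" "cball x e \<subseteq> U" using U open_contains_cball by blast
    then have "(x, min e (\<delta> / 10)) \<in> K" using \<delta> by (auto simp: K_def)
    moreover have "x \<in> cball (fst (x, min e (\<delta> / 10))) (snd (x, min e (\<delta> / 10)))" using e \<delta> by simp
    ultimately show "x \<in> (\<Union>p\<in>K. cball (fst p) (snd p))" by blast
  qed
  have Kr: "0 < snd i \<and> snd i \<le> \<delta> / 10" if "i \<in> K" for i using that by (auto simp: K_def)
  obtain C where C: "countable C" "C \<subseteq> K" "pairwise (\<lambda>i j. disjnt (cball (fst i) (snd i)) (cball (fst j) (snd j))) C"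
    "U \<subseteq> (\<Union>i\<in>C. cball (fst i) (5 * snd i))"
    by (rule Vitali_covering_lemma_cballs[OF cov Kr]) (assumption | rule that)+
  show ?thesis
  proof (rule hausdorff_pre_le_disjoint[OF DIM_positive \<delta> C(1) C(4) _ _ _ C(3)])
    fix i assume "i \<in> C"
    then have i: "0 < snd i" "snd i \<le> \<delta> / 10" "cball (fst i) (snd i) \<subseteq> U"
      using subsetD[OF C(2)] by (auto simp: K_def case_prod_unfold)
    show "bounded (cball (fst i) (5 * snd i)) \<and> diameter (cball (fst i) (5 * snd i)) \<le> \<delta>"
      using i diameter_cball_le[of "5 * snd i" "fst i"] by auto
    show "cball (fst i) (snd i) \<in> sets borel \<and> cball (fst i) (snd i) \<subseteq> U" using i by auto
    show "diam_vol DIM('a) (cball (fst i) (5 * snd i)) \<le> ennreal (5 ^ DIM('a)) * emeasure lborel (cball (fst i) (snd i))"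
      using i by (intro diam_vol_cball_le) auto
  qed (use U in auto)
qed

lemma hausdorff_pre_negligible:
  fixes N :: "'a::euclidean_space set"
  assumes N: "negligible N" and \<delta>: "0 < \<delta>"
  shows "hausdorff_pre DIM('a) \<delta> N = 0"
proof -
  have "hausdorff_pre DIM('a) \<delta> N \<le> 0"
  proof (rule ennreal_le_epsilon)
    fix e :: real assume e: "0 < e"
    have "N \<in> null_sets lebesgue" using N by (simp add: negligible_iff_null_sets)
    then obtain N' where N': "N' \<in> null_sets lborel" "N \<subseteq> N'" by (auto simp: null_sets_completion_iff2)
    then have "N' \<in> sets borel" by auto
    then obtain T where T: "open T" "N' \<subseteq> T" "emeasure lborel (T - N') < ennreal (e / 5 ^ DIM('a))"
      using outer_regular_lborel[of N' "e / 5 ^ DIM('a)"] e by auto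
    have eT: "emeasure lborel T \<le> ennreal (e / 5 ^ DIM('a))"
      using T emeasure_Diff_null_set[OF N'(1), of T] by (simp add: less_imp_le)
    have "hausdorff_pre DIM('a) \<delta> N \<le> hausdorff_pre DIM('a) \<delta> T" by (rule hausdorff_pre_antimono) (use T N' in auto)
    also have "\<dots> \<le> ennreal (5 ^ DIM('a)) * emeasure lborel T" by (rule hausdorff_pre_open_le[OF T(1) \<delta>])
    also have "\<dots> \<le> ennreal (5 ^ DIM('a)) * ennreal (e / 5 ^ DIM('a))"
      by (intro mult_left_mono eT) auto
    also have "\<dots> = ennreal e" using e by (subst ennreal_mult'[symmetric]) auto
    finally show "hausdorff_pre DIM('a) \<delta> N \<le> 0 + ennreal e" by simp
  qed
  then show ?thesis by simp
qed

text \<open>Vitali's theorem fills \<open>U\<close> up to a null set with disjoint small balls, and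
  for a ball \<open>diam_vol\<close> is at most its volume. No enlargement is involved, so the
  constant is 1.\<close>

lemma hausdorff_open_le_lborel:
  fixes U :: "'a::euclidean_space set"
  assumes U: "open U"
  shows "hausdorff_outer DIM('a) U \<le> emeasure lborel U"
proof (rule hausdorff_outer_least)
  fix \<delta> :: real assume \<delta>: "0 < \<delta>"
  define K where "K = {(x, r). 0 < r \<and> 2 * r \<le> \<delta> \<and> cball x r \<subseteq> U}"
  have cov: "\<exists>i. i \<in> K \<and> x \<in> cball (fst i) (snd i) \<and> snd i < d" if x: "x \<in> U" and d: "0 < d" for x d
  proof -
    obtain e where e: "e > 0" "cball x e \<subseteq> U" using U x open_contains_cball by blast
    define r where "r = min (d / 2) (min e (\<delta> / 2))"
    have r: "0 < r" "r < d" "2 * r \<le> \<delta>" "r \<le> e" using e d \<delta> by (auto simp: r_def)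
    then have "cball x r \<subseteq> U" using e(2) by (meson order_trans subset_cball)
    then show ?thesis using r by (intro exI[of _ "(x, r)"]) (simp add: K_def)
  qed
  have Kr: "0 < snd i" if "i \<in> K" for i using that by (auto simp: K_def)
  obtain C where C: "countable C" "C \<subseteq> K" "pairwise (\<lambda>i j. disjnt (cball (fst i) (snd i)) (cball (fst j) (snd j))) C"
    "negligible (U - (\<Union>i\<in>C. cball (fst i) (snd i)))"
    by (rule Vitali_covering_theorem_cballs[of K snd U fst, OF Kr cov]) (assumption | rule that)+
  let ?W = "\<Union>i\<in>C. cball (fst i) (snd i)"
  have "hausdorff_pre DIM('a) \<delta> ?W \<le> 1 * emeasure lborel U"
  proof (rule hausdorff_pre_le_disjoint[OF DIM_positive \<delta> C(1) order_refl _ _ _ C(3)])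
    fix i assume "i \<in> C"
    then have i: "0 < snd i" "2 * snd i \<le> \<delta>" "cball (fst i) (snd i) \<subseteq> U"
      using subsetD[OF C(2)] by (auto simp: K_def case_prod_unfold)
    show "bounded (cball (fst i) (snd i)) \<and> diameter (cball (fst i) (snd i)) \<le> \<delta>"
      using i diameter_cball_le[of "snd i" "fst i"] by auto
    show "cball (fst i) (snd i) \<in> sets borel \<and> cball (fst i) (snd i) \<subseteq> U" using i by auto
    show "diam_vol DIM('a) (cball (fst i) (snd i)) \<le> 1 * emeasure lborel (cball (fst i) (snd i))"
      using i diam_vol_cball_le[of "snd i" 1 "fst i" "fst i"] by simp
  qed (use U in auto)
  then have W: "hausdorff_pre DIM('a) \<delta> ?W \<le> emeasure lborel U" by simp
  have "hausdorff_pre DIM('a) \<delta> (?W \<union> (U - ?W)) \<le> hausdorff_pre DIM('a) \<delta> ?W + hausdorff_pre DIM('a) \<delta> (U - ?W)"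
    by (rule hausdorff_pre_Un[OF DIM_positive \<delta>])
  also have "\<dots> \<le> emeasure lborel U + 0"
    by (intro add_mono W) (simp add: hausdorff_pre_negligible[OF C(4) \<delta>])
  finally have "hausdorff_pre DIM('a) \<delta> (?W \<union> (U - ?W)) \<le> emeasure lborel U" by simp
  moreover have "hausdorff_pre DIM('a) \<delta> U \<le> hausdorff_pre DIM('a) \<delta> (?W \<union> (U - ?W))"
    by (rule hausdorff_pre_antimono) auto
  ultimately show "hausdorff_pre DIM('a) \<delta> U \<le> emeasure lborel U" by simp
qed

theorem hausdorff_outer_eq_lborel:
  fixes A :: "'a::euclidean_space set"
  assumes A: "A \<in> sets borel"
  shows "hausdorff_outer DIM('a) A = emeasure lborel A"
proof (rule antisym[OF _ lborel_le_hausdorff[OF A]])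
  show "hausdorff_outer DIM('a) A \<le> emeasure lborel A"
  proof (rule ennreal_le_epsilon)
    fix e :: real assume "0 < e"
    then obtain U where U: "open U" "A \<subseteq> U" "emeasure lborel (U - A) < e" using outer_regular_lborel[OF A] by blast
    have "hausdorff_outer DIM('a) A \<le> hausdorff_outer DIM('a) U" by (rule hausdorff_outer_mono[OF U(2)])
    also have "\<dots> \<le> emeasure lborel U" by (rule hausdorff_open_le_lborel[OF U(1)])
    also have "\<dots> = emeasure lborel (A \<union> (U - A))" using U(2) by (simp add: Un_absorb1)
    also have "\<dots> \<le> emeasure lborel A + emeasure lborel (U - A)" using A U(1) by (intro emeasure_subadditive) auto
    also have "\<dots> \<le> emeasure lborel A + ennreal e" using U(3) by (intro add_left_mono) auto
    finally show "hausdorff_outer DIM('a) A \<le> emeasure lborel A + ennreal e" .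
  qed
qed

subsection \<open>Area of graphs\<close>

lemma hausdorff_outer_expanding:
  fixes f :: "'a::euclidean_space \<Rightarrow> 'b::euclidean_space"
  assumes k: "0 < k" and L: "0 < L" and ex: "\<And>x y. x \<in> A \<Longrightarrow> y \<in> A \<Longrightarrow> dist x y \<le> L * dist (f x) (f y)"
  shows "hausdorff_outer k A \<le> ennreal (L ^ k) * hausdorff_outer k (f ` A)"
proof -
  have inj: "inj_on f A"
  proof (rule inj_onI)
    fix x y assume "x \<in> A" "y \<in> A" "f x = f y"
    then show "x = y" using ex[of x y] by simp
  qed
  have "inv_into A f ` f ` A = A" using inj by (simp add: image_image)
  moreover have "hausdorff_outer k (inv_into A f ` f ` A) \<le> ennreal (L ^ k) * hausdorff_outer k (f ` A)"
    by (rule hausdorff_outer_Lipschitz[OF k L]) (use ex inj in auto)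
  ultimately show ?thesis by simp
qed

lemma hausdorff_outer_isometry:
  fixes f :: "'a::euclidean_space \<Rightarrow> 'b::euclidean_space"
  assumes k: "0 < k" and iso: "\<And>x y. x \<in> A \<Longrightarrow> y \<in> A \<Longrightarrow> dist (f x) (f y) = dist x y"
  shows "hausdorff_outer k (f ` A) = hausdorff_outer k A"
  using hausdorff_outer_Lipschitz[OF k, of 1 A f] hausdorff_outer_expanding[OF k, of 1 A f] iso
  by (simp add: antisym)

lemma borel_measurable_linear:
  fixes f :: "'a::euclidean_space \<Rightarrow> 'b::euclidean_space"
  assumes "linear f"
  shows "f \<in> borel_measurable borel"
  using assms by (intro borel_measurable_continuous_onI linear_continuous_on) (simp add: linear_conv_bounded_linear)

lemma hausdorff_outer_empty: "0 < k \<Longrightarrow> hausdorff_outer k ({} :: 'a::euclidean_space set) = 0"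
  using outer_measure_space_hausdorff[of k, where 'a='a] by (simp add: outer_measure_space_def positive_def)

lemma borel_image_linear_bij:
  fixes T :: "'a::euclidean_space \<Rightarrow> 'b::euclidean_space"
  assumes T: "linear T" "inj T" and dim: "DIM('a) = DIM('b)"
  obtains T' where "linear T'" "\<And>x. T' (T x) = x" "\<And>x. T (T' x) = x" "\<And>S. T ` S = T' -` S"
    "\<And>S. S \<in> sets borel \<Longrightarrow> T ` S \<in> sets borel"
proof -
  obtain T' where T': "linear T'" "\<forall>x. T' (T x) = x" "\<forall>x. T (T' x) = x"
    using linear_injective_isomorphism[OF T] dim by auto
  have im: "T ` S = T' -` S" for S
  proof (intro set_eqI iffI)
    fix x assume "x \<in> T' -` S"
    then have "T' x \<in> S" "x = T (T' x)" using T' by auto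
    then show "x \<in> T ` S" by blast
  qed (use T' in auto)
  note [measurable] = borel_measurable_linear[OF T'(1)]
  have "T ` S \<in> sets borel" if "S \<in> sets borel" for S
    unfolding im using measurable_sets[of T' borel borel S] that by simp
  then show ?thesis using that[of T'] T' im by auto
qed

text \<open>Both Lebesgue measures are Hausdorff measures, which see nothing but distances; hence
  the invariance holds even between different types of equal dimension.\<close>

lemma distr_lborel_linear_isometry:
  fixes \<Phi> :: "'a::euclidean_space \<Rightarrow> 'b::euclidean_space"
  assumes lin: "linear \<Phi>" and iso: "\<And>x. norm (\<Phi> x) = norm x" and dim: "DIM('a) = DIM('b)"
  shows "distr lborel borel \<Phi> = lborel"
proof (rule measure_eqI)
  note [measurable] = borel_measurable_linear[OF lin]
  have inj: "inj \<Phi>" using lin iso linear_injective_0 by (metis norm_eq_zero)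
  obtain \<Psi> where \<Psi>: "\<And>x. \<Psi> (\<Phi> x) = x" "\<And>x. \<Phi> (\<Psi> x) = x" using borel_image_linear_bij[OF lin inj dim] by metis
  fix A assume "A \<in> sets (distr lborel borel \<Phi>)"
  then have A[measurable]: "A \<in> sets borel" by simp
  have pre: "\<Phi> -` A \<in> sets borel" using measurable_sets[of \<Phi> borel borel A] by simp
  have "\<Phi> ` (\<Phi> -` A) = A" using \<Psi>(2) by (intro surj_image_vimage_eq surjI)
  moreover have "hausdorff_outer DIM('b) (\<Phi> ` (\<Phi> -` A)) = hausdorff_outer DIM('b) (\<Phi> -` A)"
    by (rule hausdorff_outer_isometry) (simp_all add: dist_norm linear_diff[OF lin, symmetric] iso)
  ultimately show "emeasure (distr lborel borel \<Phi>) A = emeasure lborel A"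
    using hausdorff_outer_eq_lborel[OF A] hausdorff_outer_eq_lborel[OF pre] dim by (simp add: emeasure_distr)
qed simp

text \<open>\<open>T\<close> has the metric of the tangent map of a graph with gradient \<open>w\<close>: rotate \<open>w\<close> to a coordinate axis and stretch that axis.\<close>

lemma hausdorff_stretch:
  fixes w :: "real^'m"
  obtains T :: "real^'m \<Rightarrow> real^'m" where "linear T" "inj T" "\<And>v. (norm (T v))\<^sup>2 = (norm v)\<^sup>2 + (w \<bullet> v)\<^sup>2"
    "\<And>S. S \<in> sets borel \<Longrightarrow> hausdorff_outer CARD('m) (T ` S) = ennreal (sqrt (1 + (norm w)\<^sup>2)) * emeasure lborel S"
proof -
  obtain e :: "real^'m" where e: "e \<in> Basis" using nonempty_Basis by blast
  obtain R where R: "orthogonal_transformation R" "R w = norm w *\<^sub>R e"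
    using orthogonal_transformation_exists[of w "norm w *\<^sub>R e"] e by auto
  define q where "q = sqrt (1 + (norm w)\<^sup>2)"
  have q: "q > 0" "q\<^sup>2 = 1 + (norm w)\<^sup>2" unfolding q_def by (auto intro: add_pos_nonneg)
  define c where "c j = (if j = e then q else 1)" for j
  define D where "D x = (\<Sum>j\<in>Basis. (c j * (x \<bullet> j)) *\<^sub>R j)" for x :: "real^'m"
  have linD: "linear D" unfolding D_def
    by (auto simp: linear_iff inner_add_left algebra_simps sum.distrib scaleR_sum_right)
  have Db: "D x \<bullet> j = c j * (x \<bullet> j)" if "j \<in> Basis" for x j
    unfolding D_def using that by simp
  have nD: "(norm (D x))\<^sup>2 = (norm x)\<^sup>2 + (norm w)\<^sup>2 * (x \<bullet> e)\<^sup>2" for x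
  proof -
    have "(norm (D x))\<^sup>2 = (\<Sum>j\<in>Basis. (c j * (x \<bullet> j))\<^sup>2)"
      unfolding power2_norm_eq_inner by (subst euclidean_inner) (simp add: Db power2_eq_square)
    also have "\<dots> = (\<Sum>j\<in>Basis. (x \<bullet> j)\<^sup>2 + (if j = e then (norm w)\<^sup>2 * (x \<bullet> e)\<^sup>2 else 0))"
      by (intro sum.cong) (auto simp: c_def power_mult_distrib q algebra_simps)
    also have "\<dots> = (\<Sum>j\<in>Basis. (x \<bullet> j)\<^sup>2) + (norm w)\<^sup>2 * (x \<bullet> e)\<^sup>2" using e by (simp add: sum.distrib)
    also have "(\<Sum>j\<in>Basis. (x \<bullet> j)\<^sup>2) = (norm x)\<^sup>2"
      unfolding power2_norm_eq_inner by (subst (2) euclidean_inner) (simp add: power2_eq_square)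
    finally show ?thesis .
  qed
  have injD: "inj D"
  proof (subst linear_injective_0[OF linD], intro allI impI)
    fix x assume "D x = 0"
    then have "(norm x)\<^sup>2 + (norm w)\<^sup>2 * (x \<bullet> e)\<^sup>2 = 0" using nD[of x] by simp
    moreover have "0 \<le> (norm w)\<^sup>2 * (x \<bullet> e)\<^sup>2" by simp
    ultimately have "(norm x)\<^sup>2 \<le> 0" by linarith
    then show "x = 0" by simp
  qed
  note [measurable] = borel_measurable_linear[OF linD]
  have vol: "emeasure lborel (D ` X) = ennreal q * emeasure lborel X" if X: "X \<in> sets borel" for X
  proof -
    obtain D' where DX: "D ` X \<in> sets borel" using borel_image_linear_bij[OF linD injD] X by metis
    have pr: "(\<Prod>j\<in>Basis. \<bar>c j\<bar>) = q"
      unfolding c_def using e q by (simp add: if_distrib prod.If_cases Collect_conv_if)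
    have "lborel = density (distr lborel borel (\<lambda>x. 0 + D x)) (\<lambda>x. ennreal (\<Prod>j\<in>Basis. \<bar>c j\<bar>))"
      unfolding D_def by (rule lborel_affine_euclidean) (use q in \<open>auto simp: c_def\<close>)
    then have "lborel = density (distr lborel borel D) (\<lambda>x. ennreal q)" unfolding pr by simp
    then have "emeasure lborel (D ` X) = emeasure (density (distr lborel borel D) (\<lambda>x. ennreal q)) (D ` X)" by simp
    also have "\<dots> = ennreal q * emeasure lborel (D -` (D ` X))"
      using DX by (subst emeasure_density) (auto simp: nn_integral_cmult emeasure_distr)
    also have "D -` (D ` X) = X" using injD by (simp add: inj_vimage_image_eq)
    finally show ?thesis .
  qed
  have linR: "linear R" and nR: "norm (R v) = norm v" for v
    using R(1) by (auto simp: orthogonal_transformation)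
  have injR: "inj R" using linR nR linear_injective_0 by (metis norm_eq_zero)
  show ?thesis
  proof (rule that[of "D \<circ> R"])
    show "linear (D \<circ> R)" using linear_compose[OF linR linD] .
    show "inj (D \<circ> R)" using inj_compose[OF injD injR] .
    fix v
    have "(norm w * (R v \<bullet> e)) = R v \<bullet> R w" using R(2) by simp
    also have "\<dots> = w \<bullet> v" using R(1) by (simp add: orthogonal_transformation_def inner_commute)
    finally have "(norm w)\<^sup>2 * (R v \<bullet> e)\<^sup>2 = (w \<bullet> v)\<^sup>2" by (metis power_mult_distrib)
    then show "(norm ((D \<circ> R) v))\<^sup>2 = (norm v)\<^sup>2 + (w \<bullet> v)\<^sup>2" by (simp add: nD nR)
  next
    fix S :: "(real^'m) set" assume S: "S \<in> sets borel"
    have RS: "R ` S \<in> sets borel" using borel_image_linear_bij[OF linR injR] S by metis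
    have "hausdorff_outer DIM(real^'m) (R ` S) = hausdorff_outer DIM(real^'m) S"
      by (rule hausdorff_outer_isometry) (simp_all add: dist_norm linear_diff[OF linR, symmetric] nR)
    then have eR: "emeasure lborel (R ` S) = emeasure lborel S"
      using hausdorff_outer_eq_lborel[OF RS] hausdorff_outer_eq_lborel[OF S] by simp
    have DRS: "D ` (R ` S) \<in> sets borel" using borel_image_linear_bij[OF linD injD] RS by metis
    show "hausdorff_outer CARD('m) ((D \<circ> R) ` S) = ennreal (sqrt (1 + (norm w)\<^sup>2)) * emeasure lborel S"
      using hausdorff_outer_eq_lborel[OF DRS] vol[OF RS] eR by (simp add: image_comp q_def)
  qed
qed

text \<open>Removes the distortion factor of a local comparison once it can be taken arbitrarily
  close to 1.\<close>

lemma ennreal_le_mult_gt_1: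
  assumes "\<And>\<eta>::real. 1 < \<eta> \<Longrightarrow> x \<le> ennreal \<eta> * y"
  shows "x \<le> (y::ennreal)"
proof (rule ennreal_le_epsilon)
  fix e :: real assume y: "y < top" and e: "0 < e"
  then obtain r where r: "0 \<le> r" "y = ennreal r" by (auto simp: less_top_ennreal)
  show "x \<le> y + ennreal e"
  proof (cases "r = 0")
    case True then show ?thesis using assms[of 2] r by simp
  next
    case False
    then have "x \<le> ennreal (1 + e / r) * ennreal r" using assms[of "1 + e / r"] r e by simp
    also have "\<dots> = ennreal ((1 + e / r) * r)" using r e by (intro ennreal_mult'[symmetric]) auto
    also have "(1 + e / r) * r = r + e" using False by (simp add: field_simps)
    finally show ?thesis using r e by simp
  qed
qed

lemma linear_isometry_inner:
  fixes f :: "'a::euclidean_space \<Rightarrow> 'b::euclidean_space"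
  assumes lin: "linear f" and iso: "\<And>z. norm (f z) = norm z"
  shows "f x \<bullet> f y = x \<bullet> y"
proof -
  have "(norm (f x + f y))\<^sup>2 = (norm (x + y))\<^sup>2" using lin iso by (metis linear_add)
  then have "f x \<bullet> f x + 2 * (f x \<bullet> f y) + f y \<bullet> f y = x \<bullet> x + 2 * (x \<bullet> y) + y \<bullet> y"
    unfolding power2_norm_eq_inner by (simp add: inner_add_left inner_add_right inner_commute)
  moreover have "f x \<bullet> f x = x \<bullet> x" "f y \<bullet> f y = y \<bullet> y" using iso by (simp_all add: dot_square_norm)
  ultimately show ?thesis by simp
qed

text \<open>The graph of \<open>g\<close> in direction \<open>b\<close> over the hyperplane through
  \<open>c0\<close> that \<open>\<iota>\<close> parametrizes isometrically; \<open>w\<close> is the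
  gradient. Differentiability is confined to \<open>U\<close> because the function describing the
  cone has poles, while measurability is global so that integrals can run over the whole space with
  an indicator.\<close>

locale hypersurface_graph =
  fixes \<iota> :: "real^'m \<Rightarrow> 'c::euclidean_space" and b c0 :: 'c and U :: "(real^'m) set"
    and g :: "real^'m \<Rightarrow> real" and w :: "real^'m \<Rightarrow> real^'m"
  assumes lin: "linear \<iota>" and iso: "\<And>z. norm (\<iota> z) = norm z"
    and nb: "norm b = 1" and ortho: "\<And>z. \<iota> z \<bullet> b = 0"
    and opU: "open U" and g[measurable]: "g \<in> borel_measurable borel"
    and der: "\<And>z. z \<in> U \<Longrightarrow> (g has_derivative (\<lambda>v. w z \<bullet> v)) (at z)"
    and contw: "continuous_on U w" and w[measurable]: "w \<in> borel_measurable borel"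
begin

definition "\<phi> z = c0 + \<iota> z + g z *\<^sub>R b"
definition "J z = sqrt (1 + (norm (w z))\<^sup>2)"

lemma J_pos: "0 < J z" unfolding J_def by (auto intro: add_pos_nonneg)

lemma J_measurable[measurable]: "J \<in> borel_measurable borel"
  unfolding J_def by measurable

lemma iota_measurable[measurable]: "\<iota> \<in> borel_measurable borel"
  by (rule borel_measurable_linear[OF lin])

lemma phi_measurable[measurable]: "\<phi> \<in> borel_measurable borel"
  unfolding \<phi>_def by measurable

lemma norm_iota_b: "(norm (\<iota> v + t *\<^sub>R b))\<^sup>2 = (norm v)\<^sup>2 + t\<^sup>2"
proof -
  have "(norm (\<iota> v + t *\<^sub>R b))\<^sup>2 = (norm (\<iota> v))\<^sup>2 + t\<^sup>2 * (norm b)\<^sup>2"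
    using ortho[of v] inner_commute[of b "\<iota> v"]
    unfolding power2_norm_eq_inner by (simp add: inner_add_left inner_add_right power2_eq_square)
  then show ?thesis by (simp add: iso nb)
qed

definition "\<psi> q = adjoint \<iota> (q - c0)"

lemma psi_phi: "\<psi> (\<phi> z) = z"
proof -
  have "x \<bullet> \<psi> (\<phi> z) = x \<bullet> z" for x
    unfolding \<psi>_def \<phi>_def adjoint_works[OF lin] by (simp add: inner_add_right linear_isometry_inner[OF lin iso] ortho)
  then show ?thesis by (metis vector_eq_rdot inner_commute)
qed

lemma psi_measurable[measurable]: "\<psi> \<in> borel_measurable borel"
proof -
  have [measurable]: "adjoint \<iota> \<in> borel_measurable borel"
    by (rule borel_measurable_linear[OF adjoint_linear[OF lin]])
  show ?thesis unfolding \<psi>_def by measurable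
qed

lemma inj_phi: "inj \<phi>" by (rule inj_on_inverseI[where g=\<psi>]) (rule psi_phi)

text \<open>Describes the image by Borel conditions on the measurable left inverse
  \<open>\<psi>\<close>, an orthogonal projection read in coordinates; images of Borel sets are
  therefore Borel.\<close>

lemma phi_image: "\<phi> ` E = {q. \<psi> q \<in> E \<and> \<phi> (\<psi> q) = q}"
proof (intro set_eqI iffI)
  fix q assume "q \<in> {q. \<psi> q \<in> E \<and> \<phi> (\<psi> q) = q}"
  then have "\<psi> q \<in> E" "q = \<phi> (\<psi> q)" by auto
  then show "q \<in> \<phi> ` E" by blast
qed (auto simp: psi_phi)

lemma phi_image_borel[measurable]: "E \<in> sets borel \<Longrightarrow> \<phi> ` E \<in> sets borel"
proof -
  assume [measurable]: "E \<in> sets borel"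
  have "{q. \<psi> q \<in> E \<and> \<phi> (\<psi> q) = q} \<in> sets borel" by measurable
  then show ?thesis by (simp only: phi_image)
qed

text \<open>Near \<open>p\<close> the graph map differs from its tangent map by at most \<epsilon>|x
  - y|, by the mean value inequality for \<open>g\<close> minus its linear part. \<open>T\<close> is
  arbitrary because only the lengths |T v|, which are those of the tangent map, matter.\<close>

lemma local_bilipschitz:
  assumes p: "p \<in> U" and \<epsilon>: "0 < \<epsilon>" "\<epsilon> < 1"
  obtains \<delta> where "0 < \<delta>" "ball p \<delta> \<subseteq> U"
    "\<And>x y T. x \<in> ball p \<delta> \<Longrightarrow> y \<in> ball p \<delta> \<Longrightarrow> (\<And>v. (norm (T v :: real^'m))\<^sup>2 = (norm v)\<^sup>2 + (w p \<bullet> v)\<^sup>2) \<Longrightarrow>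
       dist (\<phi> x) (\<phi> y) \<le> (1 + \<epsilon>) * norm (T (x - y)) \<and> (1 - \<epsilon>) * norm (T (x - y)) \<le> dist (\<phi> x) (\<phi> y)"
    "\<And>x. x \<in> ball p \<delta> \<Longrightarrow> (1 - \<epsilon>) * J p \<le> J x \<and> J x \<le> (1 + \<epsilon>) * J p"
proof -
  have cw: "isCont w p" using contw opU p by (simp add: continuous_on_eq_continuous_at)
  have cJ: "isCont J p" unfolding J_def using cw by (intro continuous_intros)
  obtain d1 where d1: "0 < d1" "ball p d1 \<subseteq> U" using opU p openE by blast
  obtain d2 where d2: "0 < d2" "\<And>x. dist x p < d2 \<Longrightarrow> dist (w x) (w p) < \<epsilon>"
    using cw \<epsilon>(1) unfolding continuous_at_eps_delta by (metis dist_commute)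
  obtain d3 where d3: "0 < d3" "\<And>x. dist x p < d3 \<Longrightarrow> dist (J x) (J p) < \<epsilon> * J p"
    using cJ \<epsilon>(1) J_pos[of p] unfolding continuous_at_eps_delta by (metis dist_commute mult_pos_pos)
  define \<delta> where "\<delta> = min d1 (min d2 d3)"
  have \<delta>: "0 < \<delta>" "ball p \<delta> \<subseteq> U" using d1 d2 d3 by (auto simp: \<delta>_def)
  show ?thesis
  proof (rule that[OF \<delta>])
    fix x assume x: "x \<in> ball p \<delta>"
    then have "dist (J x) (J p) < \<epsilon> * J p" using d3(2)[of x] by (simp add: \<delta>_def dist_commute)
    then show "(1 - \<epsilon>) * J p \<le> J x \<and> J x \<le> (1 + \<epsilon>) * J p" by (auto simp: dist_real_def algebra_simps abs_less_iff)
    fix y and T :: "real^'m \<Rightarrow> real^'m" assume y: "y \<in> ball p \<delta>" and T: "\<And>v. (norm (T v))\<^sup>2 = (norm v)\<^sup>2 + (w p \<bullet> v)\<^sup>2"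
    have "norm (g x - g y - w p \<bullet> (x - y)) \<le> norm (x - y) * \<epsilon>"
    proof (rule differentiable_bound_linearization[where S = "ball p \<delta>" and f' = "\<lambda>z v. w z \<bullet> v"])
      fix t :: real assume t: "t \<in> {0..1}"
      then have "(1 - t) *\<^sub>R y + t *\<^sub>R x \<in> ball p \<delta>"
        using convex_ball[of p \<delta>] x y unfolding convex_alt by auto
      then show "y + t *\<^sub>R (x - y) \<in> ball p \<delta>" by (simp add: algebra_simps)
    next
      fix z assume z: "z \<in> ball p \<delta>"
      then show "(g has_derivative (\<lambda>v. w z \<bullet> v)) (at z within ball p \<delta>)"
        using der \<delta>(2) by (blast intro: has_derivative_at_withinI)
      show "onorm ((\<lambda>v. w z \<bullet> v) - (\<lambda>v. w p \<bullet> v)) \<le> \<epsilon>"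
      proof (rule onorm_bound)
        fix v :: "real^'m"
        have "norm (w z - w p) \<le> \<epsilon>" using d2(2)[of z] z by (simp add: \<delta>_def dist_commute dist_norm[symmetric])
        then have "norm (w z - w p) * norm v \<le> \<epsilon> * norm v" by (rule mult_right_mono) simp
        moreover have "norm (((\<lambda>v. w z \<bullet> v) - (\<lambda>v. w p \<bullet> v)) v) \<le> norm (w z - w p) * norm v"
          using Cauchy_Schwarz_ineq2[of "w z - w p" v] by (simp add: inner_diff_left)
        ultimately show "norm (((\<lambda>v. w z \<bullet> v) - (\<lambda>v. w p \<bullet> v)) v) \<le> \<epsilon> * norm v" by simp
      qed (use \<epsilon> in simp)
    qed (use \<delta> in simp)
    then have lin_err: "\<bar>g x - g y - w p \<bullet> (x - y)\<bar> \<le> \<epsilon> * norm (x - y)" by (simp add: mult.commute)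
    have nT: "norm (\<iota> (x - y) + (w p \<bullet> (x - y)) *\<^sub>R b) = norm (T (x - y))"
      by (rule power2_eq_imp_eq) (simp_all only: norm_iota_b T norm_ge_zero)
    \<comment> \<open>\<open>T\<close> does not shrink lengths, which turns the additive error into
      a relative one.\<close>
    have "(norm (x - y))\<^sup>2 \<le> (norm (T (x - y)))\<^sup>2" using T[of "x - y"] by simp
    then have nv: "norm (x - y) \<le> norm (T (x - y))" by (rule power2_le_imp_le) simp
    have eq: "\<phi> x - \<phi> y = (\<iota> (x - y) + (w p \<bullet> (x - y)) *\<^sub>R b) + (g x - g y - w p \<bullet> (x - y)) *\<^sub>R b"
      by (simp add: \<phi>_def linear_diff[OF lin] algebra_simps)
    have "\<bar>norm (\<phi> x - \<phi> y) - norm (\<iota> (x - y) + (w p \<bullet> (x - y)) *\<^sub>R b)\<bar> \<le> norm ((g x - g y - w p \<bullet> (x - y)) *\<^sub>R b)"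
      unfolding eq using norm_triangle_ineq3 by (metis add_diff_cancel_left')
    also have "\<dots> \<le> \<epsilon> * norm (x - y)" using lin_err by (simp add: nb)
    also have "\<dots> \<le> \<epsilon> * norm (T (x - y))" using nv \<epsilon> by simp
    finally show "dist (\<phi> x) (\<phi> y) \<le> (1 + \<epsilon>) * norm (T (x - y)) \<and> (1 - \<epsilon>) * norm (T (x - y)) \<le> dist (\<phi> x) (\<phi> y)"
      unfolding nT dist_norm by (auto simp: algebra_simps abs_le_iff)
  qed
qed

definition "area E = (\<integral>\<^sup>+z\<in>E. ennreal (J z) \<partial>lborel)"

text \<open>Up to factors near 1 both quantities equal \<open>J p\<close> times the Lebesgue measure
  of \<open>E\<close>: the Hausdorff measure by comparing \<open>\<phi>\<close> with the linear map
  \<open>T\<close>, the integral by continuity of \<open>J\<close>.\<close>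

lemma local_area:
  assumes p: "p \<in> U" and \<eta>: "1 < \<eta>"
  obtains \<delta> where "0 < \<delta>" "ball p \<delta> \<subseteq> U"
    "\<And>E. E \<in> sets borel \<Longrightarrow> E \<subseteq> ball p \<delta> \<Longrightarrow> hausdorff_outer CARD('m) (\<phi> ` E) \<le> ennreal \<eta> * area E"
    "\<And>E. E \<in> sets borel \<Longrightarrow> E \<subseteq> ball p \<delta> \<Longrightarrow> area E \<le> ennreal \<eta> * hausdorff_outer CARD('m) (\<phi> ` E)"
proof -
  let ?k = "CARD('m)"
  \<comment> \<open>\<open>t1\<close> and \<open>t2\<close> treat the total distortions of the two
    inequalities below: a k-th power from the Lipschitz comparison and one factor from the variation
    of \<open>J\<close>. Both tend to 1 with \<epsilon>.\<close>
  have t1: "((\<lambda>\<epsilon>::real. (1 + \<epsilon>) ^ ?k / (1 - \<epsilon>)) \<longlongrightarrow> (1 + 0) ^ ?k / (1 - 0)) (at_right 0)"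
    by (intro tendsto_intros) auto
  have t2: "((\<lambda>\<epsilon>::real. (1 + \<epsilon>) * (1 / (1 - \<epsilon>)) ^ ?k) \<longlongrightarrow> (1 + 0) * (1 / (1 - 0)) ^ ?k) (at_right 0)"
    by (intro tendsto_intros) auto
  have "\<forall>\<^sub>F \<epsilon> in at_right 0. (1 + \<epsilon>) ^ ?k / (1 - \<epsilon>) < \<eta> \<and> (1 + \<epsilon>) * (1 / (1 - \<epsilon>)) ^ ?k < \<eta> \<and> \<epsilon> < 1 \<and> 0 < \<epsilon>"
    using \<eta> by (intro eventually_conj order_tendstoD(2)[OF t1] order_tendstoD(2)[OF t2])
      (auto simp: eventually_at_right_less intro: order_tendstoD(2)[OF tendsto_ident_at])
  then obtain \<epsilon> where \<epsilon>: "(1 + \<epsilon>) ^ ?k / (1 - \<epsilon>) < \<eta>" "(1 + \<epsilon>) * (1 / (1 - \<epsilon>)) ^ ?k < \<eta>" "\<epsilon> < 1" "0 < \<epsilon>"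
    using eventually_happens'[OF trivial_limit_at_right_real] by blast
  obtain \<delta> where \<delta>: "0 < \<delta>" "ball p \<delta> \<subseteq> U"
    and bil: "\<And>x y T. x \<in> ball p \<delta> \<Longrightarrow> y \<in> ball p \<delta> \<Longrightarrow> (\<And>v. (norm (T v))\<^sup>2 = (norm v)\<^sup>2 + (w p \<bullet> v)\<^sup>2) \<Longrightarrow>
       dist (\<phi> x) (\<phi> y) \<le> (1 + \<epsilon>) * norm (T (x - y :: real^'m) :: real^'m) \<and> (1 - \<epsilon>) * norm (T (x - y)) \<le> dist (\<phi> x) (\<phi> y)"
    and Jb: "\<And>x. x \<in> ball p \<delta> \<Longrightarrow> (1 - \<epsilon>) * J p \<le> J x \<and> J x \<le> (1 + \<epsilon>) * J p"
    using local_bilipschitz[OF p \<epsilon>(4,3)] by metis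
  obtain T :: "real^'m \<Rightarrow> real^'m" where T: "linear T" "inj T" "\<And>v. (norm (T v))\<^sup>2 = (norm v)\<^sup>2 + (w p \<bullet> v)\<^sup>2"
    and vT0: "\<And>S. S \<in> sets borel \<Longrightarrow> hausdorff_outer ?k (T ` S) = ennreal (sqrt (1 + (norm (w p))\<^sup>2)) * emeasure lborel S"
    by (rule hausdorff_stretch[of "w p"]) (assumption | rule that)+
  note vT = vT0[folded J_def]
  obtain T' where T': "\<And>x. T' (T x) = x" "\<And>x. T (T' x) = x" using borel_image_linear_bij[OF T(1,2)] by metis
  have k: "0 < ?k" by simp
  have ar_le: "area E \<le> ennreal ((1 + \<epsilon>) * J p) * emeasure lborel E"
    and ar_ge: "ennreal ((1 - \<epsilon>) * J p) * emeasure lborel E \<le> area E"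
    if E: "E \<in> sets borel" "E \<subseteq> ball p \<delta>" for E
  proof -
    have "area E \<le> (\<integral>\<^sup>+z. ennreal ((1 + \<epsilon>) * J p) * indicator E z \<partial>lborel)"
      unfolding area_def using Jb E by (intro nn_integral_mono) (auto simp: indicator_def intro!: ennreal_leI)
    then show "area E \<le> ennreal ((1 + \<epsilon>) * J p) * emeasure lborel E" using E by (simp add: nn_integral_cmult_indicator)
    have "(\<integral>\<^sup>+z. ennreal ((1 - \<epsilon>) * J p) * indicator E z \<partial>lborel) \<le> area E"
      unfolding area_def using Jb E by (intro nn_integral_mono) (auto simp: indicator_def intro!: ennreal_leI)
    then show "ennreal ((1 - \<epsilon>) * J p) * emeasure lborel E \<le> area E" using E by (simp add: nn_integral_cmult_indicator)
  qed
  have im: "(\<lambda>x. \<phi> (T' x)) ` T ` E = \<phi> ` E" for E by (simp add: image_image T')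
  show ?thesis
  proof (rule that[OF \<delta>])
    fix E assume E: "E \<in> sets borel" "E \<subseteq> ball p \<delta>"
    have dT: "norm (T (T' x - T' y)) = dist x y" for x y by (simp add: linear_diff[OF T(1)] T' dist_norm)
    have up: "hausdorff_outer ?k (\<phi> ` E) \<le> ennreal ((1 + \<epsilon>) ^ ?k) * hausdorff_outer ?k (T ` E)"
      unfolding im[of E, symmetric]
    proof (rule hausdorff_outer_Lipschitz[OF k])
      fix x y assume "x \<in> T ` E" "y \<in> T ` E"
      then have "T' x \<in> ball p \<delta>" "T' y \<in> ball p \<delta>" using E T' by auto
      from bil[OF this T(3)] show "dist (\<phi> (T' x)) (\<phi> (T' y)) \<le> (1 + \<epsilon>) * dist x y" by (simp add: dT)
    qed (use \<epsilon> in simp)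
    have lo: "hausdorff_outer ?k (T ` E) \<le> ennreal ((1 / (1 - \<epsilon>)) ^ ?k) * hausdorff_outer ?k (\<phi> ` E)"
      unfolding im[of E, symmetric]
    proof (rule hausdorff_outer_expanding[OF k])
      fix x y assume "x \<in> T ` E" "y \<in> T ` E"
      then have "T' x \<in> ball p \<delta>" "T' y \<in> ball p \<delta>" using E T' by auto
      from bil[OF this T(3)] show "dist x y \<le> 1 / (1 - \<epsilon>) * dist (\<phi> (T' x)) (\<phi> (T' y))"
        using \<epsilon> by (simp add: dT field_simps)
    qed (use \<epsilon> in simp)
    have e1: "0 < 1 - \<epsilon>" using \<epsilon> by simp
    have "hausdorff_outer ?k (\<phi> ` E) \<le> ennreal ((1 + \<epsilon>) ^ ?k) * (ennreal (J p) * emeasure lborel E)"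
      using up vT[OF E(1)] by simp
    also have "\<dots> = ennreal ((1 + \<epsilon>) ^ ?k / (1 - \<epsilon>)) * (ennreal ((1 - \<epsilon>) * J p) * emeasure lborel E)"
      using J_pos[of p] \<epsilon> e1 by (simp add: mult.assoc[symmetric] ennreal_mult'[symmetric])
    also have "\<dots> \<le> ennreal \<eta> * area E" using \<epsilon> ar_ge[OF E] by (intro mult_mono ennreal_leI) auto
    finally show "hausdorff_outer ?k (\<phi> ` E) \<le> ennreal \<eta> * area E" .
    have "area E \<le> ennreal (1 + \<epsilon>) * (ennreal (J p) * emeasure lborel E)"
      using ar_le[OF E] J_pos[of p] \<epsilon> by (simp add: mult.assoc[symmetric] ennreal_mult'[symmetric] del: ennreal_plus)
    also have "\<dots> \<le> ennreal (1 + \<epsilon>) * (ennreal ((1 / (1 - \<epsilon>)) ^ ?k) * hausdorff_outer ?k (\<phi> ` E))"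
      using lo vT[OF E(1)] by (intro mult_left_mono) auto
    also have "\<dots> = ennreal ((1 + \<epsilon>) * (1 / (1 - \<epsilon>)) ^ ?k) * hausdorff_outer ?k (\<phi> ` E)"
      using \<epsilon> by (simp add: mult.assoc[symmetric] ennreal_mult'[symmetric] del: ennreal_plus)
    also have "\<dots> \<le> ennreal \<eta> * hausdorff_outer ?k (\<phi> ` E)" using \<epsilon> by (intro mult_right_mono ennreal_leI) auto
    finally show "area E \<le> ennreal \<eta> * hausdorff_outer ?k (\<phi> ` E)" .
  qed
qed

text \<open>Countably many balls on which the local comparison holds cover \<open>U\<close> by
  Lindelof. Both sides are countably additive over the disjointed cover, so the comparison becomes
  global with the same \<eta>, which is then sent to 1.\<close>

theorem hausdorff_graph:
  assumes E: "E \<in> sets borel" "E \<subseteq> U"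
  shows "emeasure (hausdorff_measure CARD('m)) (\<phi> ` E) = area E"
proof -
  let ?k = "CARD('m)" and ?H = "hausdorff_measure CARD('m) :: 'c measure"
  have k: "0 < ?k" by simp
  have main: "emeasure ?H (\<phi> ` E) \<le> ennreal \<eta> * area E \<and> area E \<le> ennreal \<eta> * emeasure ?H (\<phi> ` E)" if \<eta>: "1 < \<eta>" for \<eta>
  proof -
    define good where "good B \<longleftrightarrow> (\<forall>E\<in>sets borel. E \<subseteq> B \<longrightarrow> hausdorff_outer ?k (\<phi> ` E) \<le> ennreal \<eta> * area E \<and>
      area E \<le> ennreal \<eta> * hausdorff_outer ?k (\<phi> ` E))" for B
    define \<F> where "\<F> = {B. open B \<and> good B}"
    have cov: "U \<subseteq> \<Union>\<F>"
    proof
      fix p assume "p \<in> U"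
      from local_area[OF this \<eta>] obtain \<delta> where "0 < \<delta>" "good (ball p \<delta>)" unfolding good_def by metis
      then show "p \<in> \<Union>\<F>" by (auto simp: \<F>_def intro!: exI[of _ "ball p \<delta>"])
    qed
    obtain \<F>' where F': "\<F>' \<subseteq> \<F>" "countable \<F>'" "\<Union>\<F>' = \<Union>\<F>" by (rule Lindelof[of \<F>]) (auto simp: \<F>_def)
    \<comment> \<open>Inserting the empty set keeps the enumeration \<open>B\<close> meaningful when
      the countable subcover is empty.\<close>
    have "{} \<in> \<F>" by (auto simp: \<F>_def good_def area_def hausdorff_outer_empty)
    define B where "B = from_nat_into (insert {} \<F>')"
    have rB: "range B = insert {} \<F>'" unfolding B_def using F'(2) by (intro range_from_nat_into) auto
    have goodB: "good (B n)" and openB: "open (B n)" for n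
      using rB F'(1) \<open>{} \<in> \<F>\<close> by (metis (mono_tags, lifting) \<F>_def insertE mem_Collect_eq rangeI subsetD)+
    have covB: "U \<subseteq> (\<Union>n. B n)" using cov F'(3) rB by auto
    define En where "En n = E \<inter> disjointed B n" for n
    have dB: "disjointed B n \<in> sets borel" for n
      unfolding disjointed_def using openB by (intro sets.Diff sets.finite_UN) auto
    have En: "En n \<in> sets borel" "En n \<subseteq> B n" for n
      using E dB disjointed_subset[of B n] by (auto simp: En_def)
    have disj: "disjoint_family En"
      using disjoint_family_disjointed[of B] by (auto simp: disjoint_family_on_def En_def)
    have Eun: "(\<Union>n. En n) = E"
      using covB E(2) UN_disjointed_eq[of B] unfolding En_def by blast
    have H: "emeasure ?H (\<phi> ` E) = (\<Sum>n. hausdorff_outer ?k (\<phi> ` En n))"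
    proof -
      have "(\<Sum>n. emeasure ?H (\<phi> ` En n)) = emeasure ?H (\<Union>n. \<phi> ` En n)"
        using disj inj_phi by (intro suminf_emeasure)
          (auto simp: disjoint_family_on_def En(1) phi_image_borel image_Int[symmetric] inj_image_eq_iff)
      moreover have "(\<Union>n. \<phi> ` En n) = \<phi> ` E" using Eun by blast
      ultimately show ?thesis by (simp add: emeasure_hausdorff En(1) phi_image_borel)
    qed
    have A: "area E = (\<Sum>n. area (En n))"
    proof -
      have "area X = emeasure (density lborel (\<lambda>z. ennreal (J z))) X" if "X \<in> sets borel" for X
        unfolding area_def using that by (subst emeasure_density) auto
      then show ?thesis using E(1) En(1) suminf_emeasure[OF _ disj, of "density lborel (\<lambda>z. ennreal (J z))"]
        by (simp add: Eun image_subset_iff)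
    qed
    have gE: "hausdorff_outer ?k (\<phi> ` En n) \<le> ennreal \<eta> * area (En n)"
      "area (En n) \<le> ennreal \<eta> * hausdorff_outer ?k (\<phi> ` En n)" for n
      using goodB[of n] En[of n] unfolding good_def by blast+
    have "(\<Sum>n. hausdorff_outer ?k (\<phi> ` En n)) \<le> (\<Sum>n. ennreal \<eta> * area (En n))"
      by (intro suminf_le gE) auto
    moreover have "(\<Sum>n. area (En n)) \<le> (\<Sum>n. ennreal \<eta> * hausdorff_outer ?k (\<phi> ` En n))"
      by (intro suminf_le gE) auto
    ultimately show ?thesis unfolding H A by simp
  qed
  show ?thesis
    by (rule antisym; rule ennreal_le_mult_gt_1) (simp_all only: main)
qed

text \<open>As an identity of measures, the area formula transfers integrals and integrability of
  real functions together.\<close>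

lemma distr_graph:
  assumes E: "E \<in> sets borel" "E \<subseteq> U"
  shows "distr (density lborel (\<lambda>z. ennreal (indicator E z * J z))) borel \<phi> =
    density (hausdorff_measure CARD('m)) (\<lambda>q. ennreal (indicator (\<phi> ` E) q))"
proof (rule measure_eqI)
  note [measurable] = E(1)
  fix A assume "A \<in> sets (distr (density lborel (\<lambda>z. ennreal (indicator E z * J z))) borel \<phi>)"
  then have A[measurable]: "A \<in> sets borel" by simp
  have pre: "\<phi> -` A \<in> sets borel" using measurable_sets[of \<phi> borel borel A] by simp
  have "emeasure (distr (density lborel (\<lambda>z. ennreal (indicator E z * J z))) borel \<phi>) A =
    (\<integral>\<^sup>+z. ennreal (indicator E z * J z) * indicator (\<phi> -` A) z \<partial>lborel)"
    using pre by (simp add: emeasure_distr emeasure_density)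
  also have "\<dots> = area (E \<inter> \<phi> -` A)"
    unfolding area_def by (intro nn_integral_cong) (auto simp: indicator_def)
  also have "\<dots> = emeasure (hausdorff_measure CARD('m)) (\<phi> ` (E \<inter> \<phi> -` A))"
    using E pre by (intro hausdorff_graph[symmetric]) auto
  also have "\<phi> ` (E \<inter> \<phi> -` A) = \<phi> ` E \<inter> A" by auto
  also have "emeasure (hausdorff_measure CARD('m)) (\<phi> ` E \<inter> A) =
    (\<integral>\<^sup>+q. indicator (\<phi> ` E \<inter> A) q \<partial>hausdorff_measure CARD('m))"
    by (rule nn_integral_indicator[symmetric]) (simp add: E(1))
  also have "\<dots> = (\<integral>\<^sup>+q. ennreal (indicator (\<phi> ` E) q) * indicator A q \<partial>hausdorff_measure CARD('m))"
    by (intro nn_integral_cong) (auto split: split_indicator)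
  also have "\<dots> = emeasure (density (hausdorff_measure CARD('m)) (\<lambda>q. ennreal (indicator (\<phi> ` E) q))) A"
    using phi_image_borel[OF E(1)] by (intro emeasure_density[symmetric]) auto
  finally show "emeasure (distr (density lborel (\<lambda>z. ennreal (indicator E z * J z))) borel \<phi>) A =
    emeasure (density (hausdorff_measure CARD('m)) (\<lambda>q. ennreal (indicator (\<phi> ` E) q))) A" .
qed simp

theorem integral_graph:
  fixes f :: "'c \<Rightarrow> real"
  assumes E: "E \<in> sets borel" "E \<subseteq> U" and f[measurable]: "f \<in> borel_measurable borel"
  shows "set_lebesgue_integral (hausdorff_measure CARD('m)) (\<phi> ` E) f = (\<integral>z. indicator E z * J z * f (\<phi> z) \<partial>lborel)"
    and "set_integrable (hausdorff_measure CARD('m)) (\<phi> ` E) f \<longleftrightarrow> integrable lborel (\<lambda>z. indicator E z * J z * f (\<phi> z))"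
proof -
  note [measurable] = E(1)
  have nn: "AE z in lborel. 0 \<le> indicator E z * J z" using J_pos by (auto intro!: AE_I2 simp: indicator_def less_imp_le)
  have E'[measurable]: "indicator (\<phi> ` E) \<in> borel_measurable (hausdorff_measure CARD('m) :: 'c measure)"
    by (rule borel_measurable_indicator) (simp add: E(1))
  have [measurable]: "f \<in> borel_measurable (hausdorff_measure CARD('m))" by simp
  let ?D = "density lborel (\<lambda>z. ennreal (indicator E z * J z))"
  let ?H = "density (hausdorff_measure CARD('m)) (\<lambda>q. ennreal (indicator (\<phi> ` E) q)) :: 'c measure"
  have \<phi>D: "\<phi> \<in> ?D \<rightarrow>\<^sub>M borel" by simp
  have f\<phi>: "(\<lambda>z. f (\<phi> z)) \<in> borel_measurable lborel" by simp
  have JE: "(\<lambda>z. indicator E z * J z) \<in> borel_measurable lborel" by simp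
  have nn': "AE q in hausdorff_measure CARD('m). 0 \<le> (indicator (\<phi> ` E) q :: real)" by simp
  have "integral\<^sup>L ?H f = (\<integral>q. indicator (\<phi> ` E) q *\<^sub>R f q \<partial>hausdorff_measure CARD('m))"
    by (rule integral_density[OF _ E' nn']) simp
  moreover have "integral\<^sup>L (distr ?D borel \<phi>) f = (\<integral>z. (indicator E z * J z) *\<^sub>R f (\<phi> z) \<partial>lborel)"
    using integral_distr[OF \<phi>D f] integral_density[OF f\<phi> JE nn] by simp
  ultimately show "set_lebesgue_integral (hausdorff_measure CARD('m)) (\<phi> ` E) f = (\<integral>z. indicator E z * J z * f (\<phi> z) \<partial>lborel)"
    unfolding set_lebesgue_integral_def distr_graph[OF E] by simp
  have "integrable ?H f \<longleftrightarrow> integrable (hausdorff_measure CARD('m)) (\<lambda>q. indicator (\<phi> ` E) q *\<^sub>R f q)"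
    by (rule integrable_density[OF _ E' nn']) simp
  moreover have "integrable (distr ?D borel \<phi>) f \<longleftrightarrow> integrable lborel (\<lambda>z. (indicator E z * J z) *\<^sub>R f (\<phi> z))"
    using integrable_distr_eq[OF \<phi>D f] integrable_density[OF f\<phi> JE nn] by simp
  ultimately show "set_integrable (hausdorff_measure CARD('m)) (\<phi> ` E) f \<longleftrightarrow> integrable lborel (\<lambda>z. indicator E z * J z * f (\<phi> z))"
    unfolding set_integrable_def distr_graph[OF E] by simp
qed

end

subsection \<open>Charts of the quadratic cone\<close>

text \<open>An index type with \<open>2d - 1\<close> elements, so that \<open>real^'n hidx\<close> parametrizes hyperplanes of \<open>real^'n \<times> real^'n\<close>.\<close>

typedef 'n hidx = "{i :: 'n + 'n. i \<noteq> Inl undefined}"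
  by (rule exI[of _ "Inr undefined"]) simp

instance hidx :: (finite) finite
proof
  have "(UNIV :: 'a hidx set) = Abs_hidx ` {i. i \<noteq> Inl undefined}"
    by (rule type_definition.univ[OF type_definition_hidx])
  then show "finite (UNIV :: 'a hidx set)" by (metis finite finite_imageI)
qed

lemma card_hidx: "CARD('n::finite hidx) = 2 * CARD('n) - 1"
proof -
  have "CARD('n hidx) = card {i :: 'n + 'n. i \<noteq> Inl undefined}"
    by (rule type_definition.card[OF type_definition_hidx])
  also have "{i :: 'n + 'n. i \<noteq> Inl undefined} = UNIV - {Inl undefined}" by auto
  finally show ?thesis by (simp add: card_Diff_singleton)
qed

text \<open>Deleting a coordinate would be one such isometry when \<open>b\<close> is a unit
  coordinate vector. An arbitrary choice serves equally well, since only linearity, preservation of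
  norms and the range are used.\<close>

definition chart :: "'c::euclidean_space \<Rightarrow> real^'m \<Rightarrow> 'c" where
  "chart b = (SOME \<iota>. linear \<iota> \<and> (\<forall>z. norm (\<iota> z) = norm z) \<and> range \<iota> = {w. w \<bullet> b = 0})"

lemma chart:
  fixes b :: "'c::euclidean_space"
  assumes b: "b \<noteq> 0" and dim: "DIM('c) = Suc CARD('m)"
  shows "linear (chart b :: real^'m \<Rightarrow> 'c)" "norm (chart b (z :: real^'m)) = norm z"
    "range (chart b :: real^'m \<Rightarrow> 'c) = {w. w \<bullet> b = 0}"
proof -
  have d: "dim (UNIV :: (real^'m) set) = dim {w. b \<bullet> w = 0}"
    using dim_hyperplane[OF b] dim by simp
  obtain f :: "real^'m \<Rightarrow> 'c" where "linear f" "f ` UNIV = {w. b \<bullet> w = 0}" "\<And>x. norm (f x) = norm x"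
    by (rule isometry_subspaces[OF subspace_UNIV subspace_hyperplane d]) auto
  then have "\<exists>\<iota>::real^'m \<Rightarrow> 'c. linear \<iota> \<and> (\<forall>z. norm (\<iota> z) = norm z) \<and> range \<iota> = {w. w \<bullet> b = 0}"
    by (intro exI[of _ f]) (auto simp: inner_commute)
  from someI_ex[OF this] show "linear (chart b :: real^'m \<Rightarrow> 'c)" "norm (chart b (z :: real^'m)) = norm z"
    "range (chart b :: real^'m \<Rightarrow> 'c) = {w. w \<bullet> b = 0}"
    unfolding chart_def[symmetric] by auto
qed

text \<open>\<open>swp p\<close> is the gradient at \<open>p\<close> of the quadratic form
  \<open>pairing\<close>, whose zero set is the cone. Thus \<open>p \<bullet> swp b\<close> is the
  derivative of \<open>pairing\<close> at \<open>p\<close> in direction \<open>b\<close>.\<close>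

definition swp :: "'a \<times> 'a \<Rightarrow> 'a \<times> 'a" where "swp p = (snd p, fst p)"
definition pairing :: "'a::real_inner \<times> 'a \<Rightarrow> real" where "pairing p = fst p \<bullet> snd p"

lemma swp_simps: "linear (swp :: 'a::euclidean_space \<times> 'a \<Rightarrow> _)" "norm (swp p) = norm (p :: 'a \<times> 'a)" "swp (swp p) = p"
  "swp p \<bullet> q = p \<bullet> swp q"
  by (auto simp: swp_def linear_iff norm_prod_def add.commute inner_prod_def)

lemma pairing_add: "pairing (p + u *\<^sub>R q) = pairing p + u * (p \<bullet> swp q) + u\<^sup>2 * pairing q"
  by (simp add: pairing_def swp_def inner_prod_def inner_add_left inner_add_right power2_eq_square algebra_simps inner_commute)

lemma pairing_measurable[measurable]: "(pairing :: 'a::euclidean_space \<times> 'a \<Rightarrow> real) \<in> borel_measurable borel"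
  unfolding pairing_def[abs_def] by (intro borel_measurable_continuous_onI continuous_intros)

lemma pairing_has_derivative:
  assumes "linear f"
  shows "((\<lambda>z::'b::euclidean_space. pairing (f z :: 'a::euclidean_space \<times> 'a)) has_derivative (\<lambda>v. f v \<bullet> swp (f z))) (at z)"
proof -
  have f: "(f has_derivative f) (at z)" using assms linear_imp_has_derivative by blast
  have "((\<lambda>z. fst (f z) \<bullet> snd (f z)) has_derivative (\<lambda>v. fst (f z) \<bullet> snd (f v) + fst (f v) \<bullet> snd (f z))) (at z)"
    by (intro has_derivative_inner has_derivative_fst has_derivative_snd f)
  then show ?thesis by (simp add: pairing_def swp_def inner_prod_def inner_commute add.commute)
qed

text \<open>Since \<open>pairing b = 0\<close>, the quadratic form is affine along each line in
  direction \<open>b\<close>, with constant slope \<open>X\<close>. A line of nonzero slope meets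
  the cone exactly once, which makes the cone a graph over \<open>U\<close>.\<close>

locale cone_chart =
  fixes b c0 :: "(real^'n) \<times> (real^'n)" and \<iota> :: "real^'m \<Rightarrow> (real^'n) \<times> (real^'n)"
  assumes lin: "linear \<iota>" and iso: "\<And>z. norm (\<iota> z) = norm z" and rng: "range \<iota> = {w. w \<bullet> b = 0}"
    and nb: "norm b = 1" and bQ: "pairing b = 0" and bs: "b \<bullet> swp b = 0"
begin

definition "X z = \<iota> z \<bullet> swp b"
definition "g z = - pairing (\<iota> z) / X z"
definition "U = {z. X z \<noteq> 0}"
definition "pt z = \<iota> z + g z *\<^sub>R b"
text \<open>Implicit differentiation of \<open>pairing (pt z) = 0\<close>: the gradient
  \<open>swp (pt z)\<close>, projected to the hyperplane and divided by minus its component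
  \<open>X z\<close> along \<open>b\<close>.\<close>

definition "w z = (- 1 / X z) *\<^sub>R adjoint \<iota> (swp (pt z))"

lemma ortho: "\<iota> z \<bullet> b = 0" using rng by auto

lemma cont_iota: "continuous_on S \<iota>"
  using lin by (simp add: linear_continuous_on linear_conv_bounded_linear)

lemma cont_X: "continuous_on S X" unfolding X_def by (intro continuous_intros cont_iota)

lemma measurable_iota[measurable]: "\<iota> \<in> borel_measurable borel"
  by (rule borel_measurable_linear[OF lin])

lemma measurable_X[measurable]: "X \<in> borel_measurable borel" unfolding X_def by measurable

lemma measurable_g[measurable]: "g \<in> borel_measurable borel"
  unfolding g_def by measurable

lemma measurable_pt[measurable]: "pt \<in> borel_measurable borel" unfolding pt_def by measurable

lemma iota_surj: "q \<bullet> b = 0 \<Longrightarrow> \<exists>z. q = \<iota> z"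
  using rng by blast

lemma adj: "adjoint \<iota> (\<iota> y) = y" "adjoint \<iota> b = 0"
proof -
  have "x \<bullet> adjoint \<iota> (\<iota> y) = x \<bullet> y" for x unfolding adjoint_works[OF lin] using linear_isometry_inner[OF lin iso] .
  then show "adjoint \<iota> (\<iota> y) = y" by (metis vector_eq_rdot inner_commute)
  have "x \<bullet> adjoint \<iota> b = x \<bullet> 0" for x unfolding adjoint_works[OF lin] by (simp add: ortho)
  then show "adjoint \<iota> b = 0" by (metis vector_eq_rdot inner_commute)
qed

lemma decomp: obtains z where "q = \<iota> z + (q \<bullet> b) *\<^sub>R b"
proof -
  have bb: "b \<bullet> b = 1" using nb by (simp add: dot_square_norm)
  have "(q - (q \<bullet> b) *\<^sub>R b) \<bullet> b = 0" by (simp add: inner_diff_left bb)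
  from iota_surj[OF this] obtain z where "q - (q \<bullet> b) *\<^sub>R b = \<iota> z" by blast
  then show ?thesis by (intro that[of z]) (simp add: algebra_simps)
qed

lemma pt_swp: "pt z \<bullet> swp b = X z"
  by (simp add: pt_def inner_add_left X_def bs)

lemma graph: "hypersurface_graph \<iota> b U g w"
proof
  show "open U"
    unfolding U_def by (intro open_Collect_neq cont_X continuous_intros)
  show "(g has_derivative (\<bullet>) (w z)) (at z)" if z: "z \<in> U" for z
  proof -
    have X: "X z \<noteq> 0" using z by (simp add: U_def)
    have dX: "(X has_derivative (\<lambda>v. \<iota> v \<bullet> swp b)) (at z)"
      unfolding X_def using linear_imp_has_derivative[OF lin, of "at z"] by (intro has_derivative_inner_left)
    have "(g has_derivative (\<lambda>v. - ((\<iota> v \<bullet> swp (\<iota> z)) * X z - pairing (\<iota> z) * (\<iota> v \<bullet> swp b)) / (X z * X z))) (at z)"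
      unfolding g_def minus_divide_left[symmetric]
      by (intro has_derivative_minus has_derivative_divide'[OF pairing_has_derivative[OF lin] dX X])
    moreover have "- ((\<iota> v \<bullet> swp (\<iota> z)) * X z - pairing (\<iota> z) * (\<iota> v \<bullet> swp b)) / (X z * X z) = w z \<bullet> v" for v
    proof -
      have "w z \<bullet> v = (- 1 / X z) * (\<iota> v \<bullet> swp (pt z))"
        unfolding w_def using adjoint_works[OF lin, of v "swp (pt z)"] by (simp add: inner_commute)
      also have "swp (pt z) = swp (\<iota> z) + g z *\<^sub>R swp b"
        using swp_simps(1)[where 'a="real^'n"] by (simp add: pt_def linear_add linear_scale)
      also have "\<iota> v \<bullet> (swp (\<iota> z) + g z *\<^sub>R swp b) = \<iota> v \<bullet> swp (\<iota> z) + g z * (\<iota> v \<bullet> swp b)"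
        by (simp add: inner_add_right)
      finally show ?thesis using X by (simp add: g_def field_simps)
    qed
    ultimately show ?thesis by simp
  qed
  have cX: "continuous_on U X" by (rule cont_X)
  have X0: "\<forall>z\<in>U. X z \<noteq> 0" by (simp add: U_def)
  have "continuous_on U g" unfolding g_def pairing_def by (intro continuous_intros cont_iota cX X0)
  then have "continuous_on U pt" unfolding pt_def by (intro continuous_intros cont_iota)
  moreover have "continuous_on UNIV (\<lambda>q. adjoint \<iota> (swp q))"
    using linear_compose[OF swp_simps(1)[where 'a="real^'n"] adjoint_linear[OF lin]]
    by (simp add: linear_continuous_on linear_conv_bounded_linear comp_def)
  ultimately have "continuous_on U (\<lambda>z. adjoint \<iota> (swp (pt z)))"
    using continuous_on_compose2[of UNIV "\<lambda>q. adjoint \<iota> (swp q)" U pt] by simp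
  then show "continuous_on U w" unfolding w_def by (intro continuous_intros cX X0)
  have [measurable]: "(\<lambda>q. adjoint \<iota> (swp q)) \<in> borel_measurable borel"
    using linear_compose[OF swp_simps(1)[where 'a="real^'n"] adjoint_linear[OF lin]]
    by (intro borel_measurable_linear) (simp add: comp_def)
  have [measurable]: "(\<lambda>z. adjoint \<iota> (swp (pt z))) \<in> borel_measurable borel"
    by (rule measurable_compose[OF measurable_pt]) measurable
  show "w \<in> borel_measurable borel" unfolding w_def by measurable
qed (auto simp: linear_add[OF lin] linear_scale[OF lin] iso nb ortho)

sublocale hypersurface_graph \<iota> b c0 U g w by (rule graph)

lemma norm_adj: "(norm (adjoint \<iota> q))\<^sup>2 = (norm q)\<^sup>2 - (q \<bullet> b)\<^sup>2"
proof -
  obtain y where y: "q = \<iota> y + (q \<bullet> b) *\<^sub>R b" by (rule decomp)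
  have "adjoint \<iota> q = y"
    using adjoint_linear[OF lin] by (subst y) (simp add: linear_add linear_scale adj)
  then show ?thesis using norm_iota_b[of y "q \<bullet> b"] y by simp
qed

lemma J_eq: "z \<in> U \<Longrightarrow> J z = norm (pt z) / \<bar>X z\<bar>"
proof -
  assume z: "z \<in> U"
  then have X: "X z \<noteq> 0" by (simp add: U_def)
  have "(norm (w z))\<^sup>2 = (1 / X z)\<^sup>2 * ((norm (pt z))\<^sup>2 - (X z)\<^sup>2)"
    unfolding w_def norm_scaleR power_mult_distrib norm_adj
    by (simp add: swp_simps pt_swp power_divide)
  then have "1 + (norm (w z))\<^sup>2 = (norm (pt z) / \<bar>X z\<bar>)\<^sup>2" using X by (simp add: power_divide field_simps)
  then show ?thesis unfolding J_def by simp
qed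

lemma phi_pt: "\<phi> z = c0 + pt z" by (simp add: \<phi>_def pt_def)

lemma pairing_line: "pairing (\<iota> z + u *\<^sub>R b) = pairing (\<iota> z) + u * X z"
  by (simp add: pairing_add bQ X_def)

lemma pairing_pt: "z \<in> U \<Longrightarrow> pairing (pt z + u *\<^sub>R b) = u * X z"
proof -
  assume z: "z \<in> U"
  have "pt z + u *\<^sub>R b = \<iota> z + (g z + u) *\<^sub>R b" by (simp add: pt_def algebra_simps)
  then have "pairing (pt z + u *\<^sub>R b) = pairing (\<iota> z) + (g z + u) * X z" by (simp only: pairing_line)
  then show ?thesis using z by (simp add: U_def g_def field_simps)
qed

text \<open>\<open>P\<close> tests the orthogonal projection to the hyperplane. This generality
  covers both the coordinate regions and, in charts solved for a coordinate of x, the exceptional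
  set x = 0.\<close>

lemma phi_image_U: "\<phi> ` {z\<in>U. P (\<iota> z)} = {q. pairing (q - c0) = 0 \<and> (q - c0) \<bullet> swp b \<noteq> 0 \<and> P (q - c0 - ((q - c0) \<bullet> b) *\<^sub>R b)}"
proof (intro set_eqI iffI)
  fix q assume "q \<in> \<phi> ` {z\<in>U. P (\<iota> z)}"
  then obtain z where z: "z \<in> U" "P (\<iota> z)" "q - c0 = pt z" by (auto simp: phi_pt)
  have "pt z \<bullet> b = g z" using nb by (simp add: pt_def inner_add_left ortho dot_square_norm)
  then show "q \<in> {q. pairing (q - c0) = 0 \<and> (q - c0) \<bullet> swp b \<noteq> 0 \<and> P (q - c0 - ((q - c0) \<bullet> b) *\<^sub>R b)}"
    using z pairing_pt[OF z(1), of 0] by (simp add: pt_swp U_def) (simp add: pt_def)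
next
  fix q assume q: "q \<in> {q. pairing (q - c0) = 0 \<and> (q - c0) \<bullet> swp b \<noteq> 0 \<and> P (q - c0 - ((q - c0) \<bullet> b) *\<^sub>R b)}"
  obtain z where z: "q - c0 = \<iota> z + ((q - c0) \<bullet> b) *\<^sub>R b" by (rule decomp)
  have "(q - c0) \<bullet> swp b = X z" using arg_cong[OF z, of "\<lambda>v. v \<bullet> swp b"] by (simp add: inner_add_left X_def bs)
  then have X: "X z \<noteq> 0" using q by simp
  have "pairing (\<iota> z) + ((q - c0) \<bullet> b) * X z = 0" using arg_cong[OF z, of pairing] q by (simp add: pairing_line)
  then have "(q - c0) \<bullet> b = g z" using X by (simp add: g_def field_simps)
  then have "q = \<phi> z" using z by (simp add: phi_pt pt_def algebra_simps)
  moreover have "P (\<iota> z)" using q z by (simp add: algebra_simps)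
  ultimately show "q \<in> \<phi> ` {z\<in>U. P (\<iota> z)}" using X by (auto simp: U_def)
qed

end

section \<open>Fubini's theorem in chart coordinates\<close>

context cone_chart begin

lemma linear_Phi: "linear (\<lambda>p. \<iota> (fst p) + snd p *\<^sub>R b)"
  using lin by (auto simp: linear_iff algebra_simps)

lemma distr_Phi:
  assumes dim: "Suc CARD('m) = 2 * CARD('n)"
  shows "distr (lborel \<Otimes>\<^sub>M lborel) borel (\<lambda>p. \<iota> (fst p) + snd p *\<^sub>R b) = lborel"
proof -
  have n: "norm (\<iota> (fst p) + snd p *\<^sub>R b) = norm p" for p
  proof (rule power2_eq_imp_eq)
    show "(norm (\<iota> (fst p) + snd p *\<^sub>R b))\<^sup>2 = (norm p)\<^sup>2" unfolding norm_iota_b by (simp add: norm_prod_def)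
  qed simp_all
  show ?thesis unfolding lborel_prod
    by (rule distr_lborel_linear_isometry[OF linear_Phi n]) (use dim in simp)
qed

lemma measurable_Phi: "(\<lambda>p. \<iota> (fst p) + snd p *\<^sub>R b) \<in> lborel \<Otimes>\<^sub>M lborel \<rightarrow>\<^sub>M borel"
  unfolding lborel_prod using borel_measurable_linear[OF linear_Phi] by simp

lemma nn_integral_chart:
  assumes dim: "Suc CARD('m) = 2 * CARD('n)" and f[measurable]: "f \<in> borel_measurable borel"
  shows "(\<integral>\<^sup>+w. f w \<partial>lborel) = (\<integral>\<^sup>+z. (\<integral>\<^sup>+u. f (\<iota> z + u *\<^sub>R b) \<partial>lborel) \<partial>lborel)"
proof -
  have "(\<integral>\<^sup>+w. f w \<partial>lborel) = (\<integral>\<^sup>+p. f (\<iota> (fst p) + snd p *\<^sub>R b) \<partial>(lborel \<Otimes>\<^sub>M lborel))"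
    by (subst distr_Phi[OF dim, symmetric]) (rule nn_integral_distr[OF measurable_Phi], simp)
  also have "\<dots> = (\<integral>\<^sup>+z. (\<integral>\<^sup>+u. f (\<iota> z + u *\<^sub>R b) \<partial>lborel) \<partial>lborel)"
    using measurable_compose[OF measurable_Phi f] by (subst lborel.nn_integral_fst[symmetric]) auto
  finally show ?thesis .
qed

lemma integral_chart:
  fixes f :: "(real^'n) \<times> (real^'n) \<Rightarrow> 'e::{banach, second_countable_topology}"
  assumes dim: "Suc CARD('m) = 2 * CARD('n)" and f: "integrable lborel f"
  shows "(\<integral>w. f w \<partial>lborel) = (\<integral>z. (\<integral>u. f (\<iota> z + u *\<^sub>R b) \<partial>lborel) \<partial>lborel)"
    and "integrable lborel (\<lambda>z. \<integral>u. f (\<iota> z + u *\<^sub>R b) \<partial>lborel)"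
proof -
  have fm[measurable]: "f \<in> borel_measurable borel" using f by auto
  have int: "integrable (lborel \<Otimes>\<^sub>M lborel) (\<lambda>p. f (\<iota> (fst p) + snd p *\<^sub>R b))"
    using f unfolding distr_Phi[OF dim, symmetric] by (subst (asm) integrable_distr_eq[OF measurable_Phi]) auto
  have "(\<integral>w. f w \<partial>lborel) = (\<integral>p. f (\<iota> (fst p) + snd p *\<^sub>R b) \<partial>(lborel \<Otimes>\<^sub>M lborel))"
    by (subst distr_Phi[OF dim, symmetric]) (rule integral_distr[OF measurable_Phi], simp)
  also have "\<dots> = (\<integral>z. (\<integral>u. f (\<iota> z + u *\<^sub>R b) \<partial>lborel) \<partial>lborel)"
    using lborel_pair.integral_fst'[OF int] by simp
  finally show "(\<integral>w. f w \<partial>lborel) = (\<integral>z. (\<integral>u. f (\<iota> z + u *\<^sub>R b) \<partial>lborel) \<partial>lborel)" .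
  show "integrable lborel (\<lambda>z. \<integral>u. f (\<iota> z + u *\<^sub>R b) \<partial>lborel)"
    using lborel_pair.integrable_fst'[OF int] by simp
qed

end

text \<open>Ties go to the smallest index. The regions then partition the nonzero vectors exactly,
  and it need not be shown that ties are negligible on the hypersurface.\<close>

definition max_coord_region :: "'n::finite \<Rightarrow> (real^'n) set" where
  "max_coord_region i = {x. x $ i \<noteq> 0 \<and> (\<forall>j. \<bar>x $ j\<bar> < \<bar>x $ i\<bar> \<or> \<bar>x $ j\<bar> = \<bar>x $ i\<bar> \<and> to_nat i \<le> to_nat j)}"

lemma max_coord_region_borel[measurable]: "max_coord_region i \<in> sets borel"
  unfolding max_coord_region_def by measurable

lemma max_coord_region_disjoint: "x \<in> max_coord_region i \<Longrightarrow> x \<in> max_coord_region j \<Longrightarrow> i = j"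
proof -
  assume "x \<in> max_coord_region i" "x \<in> max_coord_region j"
  then have "\<bar>x $ j\<bar> < \<bar>x $ i\<bar> \<or> \<bar>x $ j\<bar> = \<bar>x $ i\<bar> \<and> to_nat i \<le> to_nat j"
    "\<bar>x $ i\<bar> < \<bar>x $ j\<bar> \<or> \<bar>x $ i\<bar> = \<bar>x $ j\<bar> \<and> to_nat j \<le> to_nat i" by (simp_all add: max_coord_region_def)
  then have "to_nat i = to_nat j" by linarith
  then show ?thesis by simp
qed

lemma max_coord_region_cover: "x \<noteq> 0 \<Longrightarrow> \<exists>i. x \<in> max_coord_region i"
proof -
  assume x: "x \<noteq> 0"
  define M where "M = Max (range (\<lambda>j. \<bar>x $ j\<bar>))"
  have le: "\<bar>x $ j\<bar> \<le> M" for j unfolding M_def by (intro Max_ge) auto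
  have "M \<in> range (\<lambda>j. \<bar>x $ j\<bar>)" unfolding M_def by (intro Max_in) auto
  then obtain k where k: "\<bar>x $ k\<bar> = M" by auto
  obtain i where i: "\<bar>x $ i\<bar> = M" "\<And>j. \<bar>x $ j\<bar> = M \<Longrightarrow> to_nat i \<le> to_nat j"
    using ex_has_least_nat[of "\<lambda>j. \<bar>x $ j\<bar> = M" k to_nat] k by auto
  obtain l where "x $ l \<noteq> 0" using x by (auto simp: vec_eq_iff)
  then have "0 < M" using le[of l] by linarith
  then have "x \<in> max_coord_region i" using i le unfolding max_coord_region_def by (auto simp: less_le)
  then show ?thesis ..
qed

lemma cone_chart_chart:
  fixes b c0 :: "(real^'n) \<times> (real^'n)"
  assumes "Suc CARD('m) = 2 * CARD('n)" "norm b = 1" "pairing b = 0" "b \<bullet> swp b = 0"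
  shows "cone_chart b (chart b :: real^'m \<Rightarrow> _)"
proof -
  have b: "b \<noteq> 0" using assms(2) by auto
  have d: "DIM((real^'n) \<times> (real^'n)) = Suc CARD('m)" using assms(1) by simp
  show ?thesis
    by standard (auto simp: linear_add[OF chart(1)[OF b d]] linear_scale[OF chart(1)[OF b d]] chart(2,3)[OF b d] assms)
qed

text \<open>For this \<open>b\<close> the slope \<open>X\<close> is the coordinate x_i, and moving
  along \<open>b\<close> leaves x unchanged. Membership in the region therefore depends on the chart
  point \<open>z\<close> alone.\<close>

locale cone_region = cone_chart b c0 \<iota>
  for b c0 :: "(real^'n) \<times> (real^'n)" and \<iota> :: "real^'m \<Rightarrow> (real^'n) \<times> (real^'n)" +
  fixes i :: 'n
  assumes b_eq: "b = (0, axis i 1)" and dim: "Suc CARD('m) = 2 * CARD('n)"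
begin

definition "E = {z. fst (\<iota> z) \<in> max_coord_region i}"

lemma X_eq: "X z = fst (\<iota> z) $ i"
  unfolding X_def by (simp add: b_eq swp_def inner_prod_def inner_axis)

lemma E_U: "E \<subseteq> U" by (auto simp: E_def U_def X_eq max_coord_region_def)

lemma E_borel[measurable]: "E \<in> sets borel"
proof -
  have "continuous_on UNIV (\<lambda>z. fst (\<iota> z))" by (intro continuous_intros cont_iota)
  then have [measurable]: "(\<lambda>z. fst (\<iota> z)) \<in> borel_measurable borel" by (rule borel_measurable_continuous_onI)
  show ?thesis unfolding E_def by measurable
qed

lemma fst_line: "fst (\<iota> z + u *\<^sub>R b) = fst (\<iota> z)" by (simp add: b_eq)

lemma phi_E: "\<phi> ` E = {q. pairing (q - c0) = 0 \<and> fst (q - c0) \<in> max_coord_region i}"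
proof -
  have "E = {z\<in>U. fst (\<iota> z) \<in> max_coord_region i}" using E_U by (auto simp: E_def)
  then have "\<phi> ` E = {q. pairing (q - c0) = 0 \<and> (q - c0) \<bullet> swp b \<noteq> 0 \<and> fst (q - c0 - ((q - c0) \<bullet> b) *\<^sub>R b) \<in> max_coord_region i}"
    using phi_image_U[of "\<lambda>p. fst p \<in> max_coord_region i"] by simp
  moreover have "(q - c0) \<bullet> swp b = fst (q - c0) $ i" for q by (simp add: b_eq swp_def inner_prod_def inner_axis)
  moreover have "fst (q - c0 - t *\<^sub>R b) = fst (q - c0)" for q t by (simp add: b_eq)
  moreover have "x \<in> max_coord_region i \<Longrightarrow> x $ i \<noteq> 0" for x :: "real^'n" by (simp add: max_coord_region_def)
  ultimately show ?thesis by (simp only:) blast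
qed

text \<open>The area element is |pt z| / |X z|, and the weight in the surface integral cancels its
  numerator. What remains, 1/|X z|, is exactly the Jacobian that the volume integral
  produces.\<close>

lemma integral_region:
  fixes F :: "_ \<Rightarrow> real"
  assumes F[measurable]: "F \<in> borel_measurable borel"
  shows "set_lebesgue_integral (hausdorff_measure CARD('m)) (\<phi> ` E) (\<lambda>q. F q / norm (q - c0)) =
      (\<integral>z. indicator E z * (F (\<phi> z) / \<bar>X z\<bar>) \<partial>lborel)"
    and "set_integrable (hausdorff_measure CARD('m)) (\<phi> ` E) (\<lambda>q. F q / norm (q - c0)) \<longleftrightarrow>
      integrable lborel (\<lambda>z. indicator E z * (F (\<phi> z) / \<bar>X z\<bar>))"
proof -
  have eq: "indicator E z * J z * (F (\<phi> z) / norm (\<phi> z - c0)) = indicator E z * (F (\<phi> z) / \<bar>X z\<bar>)" for z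
  proof (cases "z \<in> E")
    case True
    then have z: "z \<in> U" using E_U by auto
    then have "pt z \<noteq> 0" using pt_swp[of z] by (auto simp: U_def)
    then show ?thesis using True by (simp add: J_eq[OF z] phi_pt)
  qed simp
  have m: "(\<lambda>q. F q / norm (q - c0)) \<in> borel_measurable borel" by measurable
  show "set_lebesgue_integral (hausdorff_measure CARD('m)) (\<phi> ` E) (\<lambda>q. F q / norm (q - c0)) =
      (\<integral>z. indicator E z * (F (\<phi> z) / \<bar>X z\<bar>) \<partial>lborel)"
    using integral_graph(1)[OF E_borel E_U m] by (simp only: eq)
  show "set_integrable (hausdorff_measure CARD('m)) (\<phi> ` E) (\<lambda>q. F q / norm (q - c0)) \<longleftrightarrow>
      integrable lborel (\<lambda>z. indicator E z * (F (\<phi> z) / \<bar>X z\<bar>))"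
    using integral_graph(2)[OF E_borel E_U m] by (simp only: eq)
qed

end

text \<open>This part of the cone lies in none of the charts above. In a chart solved for x_j, with
  slope y_j, it sits over a hyperplane of the parameter space, hence over a null set; the pieces y_j
  \<noteq> 0 exhaust it.\<close>

lemma hausdorff_null_first_factor:
  fixes s :: "real^'n"
  assumes d: "CARD('n) \<ge> 2"
  shows "{s} \<times> (UNIV - {s}) \<in> null_sets (hausdorff_measure (2 * CARD('n) - 1))"
proof -
  have k: "2 * CARD('n) - 1 = CARD('n hidx)" by (simp add: card_hidx)
  have dim: "Suc CARD('n hidx) = 2 * CARD('n)" using d by (simp add: card_hidx)
  have N: "{q. fst q = s \<and> (snd q - s) $ j \<noteq> 0} \<in> null_sets (hausdorff_measure CARD('n hidx))" for j
  proof -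
    define b where "b = (axis j 1 :: real^'n, 0 :: real^'n)"
    interpret cone_chart b "(s, s)" "chart b :: real^'n hidx \<Rightarrow> _"
      by (rule cone_chart_chart[OF dim]) (auto simp: b_def swp_def pairing_def norm_prod_def inner_prod_def)
    \<comment> \<open>The dimension assumption enters here: x_j is the dependent variable, so the
      hyperplane containing the parameters must be cut out by some other x_l.\<close>
    have "card (UNIV - {j}) \<noteq> 0" using d by (simp add: card_Diff_singleton)
    then obtain l where l: "l \<noteq> j" by (metis card.empty Diff_eq_empty_iff UNIV_I insertI1 singletonD subsetI)
    define a where "a = (axis l 1 :: real^'n, 0 :: real^'n)"
    have ab: "a \<bullet> b = 0" using l by (simp add: a_def b_def inner_prod_def inner_axis_axis)
    obtain y where y: "a = chart b (y :: real^'n hidx)" using iota_surj[OF ab] by blast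
    have "norm a = 1" by (simp add: a_def norm_prod_def)
    then have y0: "y \<noteq> 0" using iso[of y] y by auto
    define Z where "Z = {z\<in>U. fst (chart b z) = 0 }"
    have cf: "continuous_on UNIV (\<lambda>z. fst (chart b (z::real^'n hidx)))" by (intro continuous_intros cont_iota)
    have [measurable]: "(\<lambda>z. fst (chart b (z::real^'n hidx))) \<in> borel_measurable borel"
      by (rule borel_measurable_continuous_onI[OF cf])
    have ZB: "Z \<in> sets borel" unfolding Z_def U_def by measurable
    have "Z \<subseteq> {z. y \<bullet> z = 0}"
    proof
      fix z assume "z \<in> Z"
      then have "chart b z \<bullet> a = 0" by (simp add: Z_def a_def inner_prod_def)
      then show "z \<in> {z. y \<bullet> z = 0}"
        using linear_isometry_inner[OF lin iso, of z y] y by (simp add: inner_commute)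
    qed
    then have "negligible Z" using negligible_hyperplane[of y 0] y0 negligible_subset by blast
    then have "emeasure lborel Z = 0" using ZB by (simp add: negligible_iff_emeasure0)
    then have "area Z = 0" unfolding area_def
      using ZB by (intro nn_integral_null_set[of _ lborel]) auto
    then have "emeasure (hausdorff_measure CARD('n hidx)) (\<phi> ` Z) = 0"
      using hausdorff_graph[OF ZB] by (auto simp: Z_def)
    moreover have "\<phi> ` Z = {q. fst q = s \<and> (snd q - s) $ j \<noteq> 0}"
    proof -
      have "fst (q - (s, s) - ((q - (s, s)) \<bullet> b) *\<^sub>R b) = 0 \<and> pairing (q - (s,s)) = 0 \<longleftrightarrow> fst q = s" if "(snd q - s) $ j \<noteq> 0" for q
      proof
        assume "fst q = s" then show "fst (q - (s, s) - ((q - (s, s)) \<bullet> b) *\<^sub>R b) = 0 \<and> pairing (q - (s,s)) = 0"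
          by (simp add: b_def inner_prod_def pairing_def)
      next
        assume *: "fst (q - (s, s) - ((q - (s, s)) \<bullet> b) *\<^sub>R b) = 0 \<and> pairing (q - (s,s)) = 0"
        define t where "t = (q - (s, s)) \<bullet> b"
        have f: "fst q - s = t *\<^sub>R axis j 1" using * by (simp add: b_def t_def)
        then have "t * ((snd q - s) $ j) = 0" using * by (simp add: pairing_def inner_axis')
        then show "fst q = s" using that f by simp
      qed
      moreover have "(q - (s,s)) \<bullet> swp b = (snd q - s) $ j" for q by (simp add: b_def swp_def inner_prod_def inner_axis)
      ultimately show ?thesis unfolding Z_def phi_image_U[of "\<lambda>p. fst p = 0"] by auto
    qed
    ultimately show ?thesis using phi_image_borel[OF ZB] by (auto intro: null_setsI)
  qed
  have "(\<Union>j. {q. fst q = s \<and> (snd q - s) $ j \<noteq> 0}) \<in> null_sets (hausdorff_measure CARD('n hidx) :: ((real^'n) \<times> (real^'n)) measure)"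
    by (intro null_sets_UN' N) auto
  moreover have "(\<Union>j. {q. fst q = s \<and> (snd q - s) $ j \<noteq> 0}) = {s} \<times> (UNIV - {s})"
    by (auto simp: vec_eq_iff)
  ultimately show ?thesis unfolding k by simp
qed

text \<open>Off the null set just found, the cone is the disjoint union of the graphs over the
  regions. The integrability assumption allows the integral to be split among them.\<close>

lemma Sigma_star_integral:
  fixes s :: "real^'n" and F :: "(real^'n) \<times> (real^'n) \<Rightarrow> real"
    and \<phi> :: "'n \<Rightarrow> real^'n hidx \<Rightarrow> _"
  assumes d: "CARD('n) \<ge> 2" and F[measurable]: "F \<in> borel_measurable borel"
    and reg: "\<And>i. cone_region (b i) (\<iota> i :: real^'n hidx \<Rightarrow> _) i"
    and \<phi>: "\<And>i. \<phi> i = hypersurface_graph.\<phi> (\<iota> i) (b i) (s, s) (cone_chart.g (b i) (\<iota> i))"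
    and int: "\<And>i. integrable lborel (\<lambda>z. indicator (cone_region.E (\<iota> i) i) z * (F (\<phi> i z) / \<bar>cone_chart.X (b i) (\<iota> i) z\<bar>))"
  shows "set_lebesgue_integral (hausdorff_measure (2 * CARD('n) - 1)) (Sigma_star s) (\<lambda>q. F q / norm (q - (s, s))) =
    (\<Sum>i\<in>UNIV. \<integral>z. indicator (cone_region.E (\<iota> i) i) z * (F (\<phi> i z) / \<bar>cone_chart.X (b i) (\<iota> i) z\<bar>) \<partial>lborel)"
proof -
  let ?H = "hausdorff_measure CARD('n hidx) :: ((real^'n) \<times> (real^'n)) measure"
  let ?f = "\<lambda>q. F q / norm (q - (s, s))"
  have k: "2 * CARD('n) - 1 = CARD('n hidx)" by (simp add: card_hidx)
  interpret R: cone_region "b i" "(s, s)" "\<iota> i" i for i by (rule reg)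
  define S where "S i = \<phi> i ` R.E i" for i
  have S_eq: "S i = {q. pairing (q - (s, s)) = 0 \<and> fst (q - (s, s)) \<in> max_coord_region i}" for i
    unfolding S_def \<phi> by (rule R.phi_E)
  have SB: "S i \<in> sets borel" for i unfolding S_def \<phi> by (intro R.phi_image_borel R.E_borel)
  define N where "N = {s} \<times> (UNIV - {s})"
  have N: "N \<in> null_sets ?H" unfolding N_def using hausdorff_null_first_factor[OF d, of s] unfolding k .
  have ind: "indicator (Sigma_star s) q *\<^sub>R ?f q = (\<Sum>i\<in>UNIV. indicator (S i) q *\<^sub>R ?f q)" if "q \<notin> N" for q
  proof (cases "q \<in> Sigma_star s")
    case True
    then have Qq: "pairing (q - (s, s)) = 0" and "q \<noteq> (s, s)" by (auto simp: Sigma_star_def pairing_def)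
    then have "fst (q - (s, s)) \<noteq> 0" using that by (cases q) (auto simp: N_def)
    then obtain i where i: "fst (q - (s, s)) \<in> max_coord_region i" using max_coord_region_cover by blast
    have "q \<in> S j \<longleftrightarrow> j = i" for j unfolding S_eq using i Qq max_coord_region_disjoint[OF i, of j] by blast
    then have "indicator (S j) q *\<^sub>R ?f q = (if j = i then ?f q else 0)" for j by (simp add: indicator_def)
    then have "(\<Sum>j\<in>UNIV. indicator (S j) q *\<^sub>R ?f q) = ?f q" by (simp only: sum.delta[OF finite_class.finite_UNIV] UNIV_I if_True)
    then show ?thesis using True by simp
  next
    case False
    have "q \<notin> S i" for i
      using False by (cases q) (auto simp: S_eq Sigma_star_def pairing_def max_coord_region_def)
    then show ?thesis using False by simp
  qed
  have "set_lebesgue_integral ?H (Sigma_star s) ?f = (\<integral>q. (\<Sum>i\<in>UNIV. indicator (S i) q *\<^sub>R ?f q) \<partial>?H)"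
    unfolding set_lebesgue_integral_def
  proof (rule integral_cong_AE)
    have "Sigma_star s = {q. pairing (q - (s, s)) = 0} - {(s, s)}" by (auto simp: Sigma_star_def pairing_def)
    moreover have "{q. pairing (q - (s, s)) = 0} - {(s, s)} \<in> sets borel" by measurable
    ultimately have [measurable]: "Sigma_star s \<in> sets borel" by simp
    show "(\<lambda>q. indicator (Sigma_star s) q *\<^sub>R ?f q) \<in> borel_measurable ?H" by measurable
    note [measurable] = SB
    show "(\<lambda>q. \<Sum>i\<in>UNIV. indicator (S i) q *\<^sub>R ?f q) \<in> borel_measurable ?H" by measurable
    show "AE q in ?H. indicator (Sigma_star s) q *\<^sub>R ?f q = (\<Sum>i\<in>UNIV. indicator (S i) q *\<^sub>R ?f q)"
      using AE_not_in[OF N] by eventually_elim (rule ind)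
  qed
  also have "\<dots> = (\<Sum>i\<in>UNIV. \<integral>q. indicator (S i) q *\<^sub>R ?f q \<partial>?H)"
  proof (rule Bochner_Integration.integral_sum)
    fix i show "integrable ?H (\<lambda>q. indicator (S i) q *\<^sub>R ?f q)"
      using R.integral_region(2)[OF F, of i] int[of i] unfolding S_def \<phi> set_integrable_def by simp
  qed
  also have "\<dots> = (\<Sum>i\<in>UNIV. \<integral>z. indicator (R.E i) z * (F (\<phi> i z) / \<bar>R.X i z\<bar>) \<partial>lborel)"
    using R.integral_region(1)[OF F] unfolding S_def \<phi> set_lebesgue_integral_def by simp
  finally show ?thesis unfolding k .
qed

subsection \<open>The oscillatory kernel\<close>

text \<open>The two bounds on \<open>q\<close> are convergence at 0 and at infinity. The result is
  needed for q = \<epsilon>, in the error integral, and for negative q, in the singular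
  weight.\<close>

lemma integrable_powr_over_quadratic:
  fixes q :: real
  assumes q: "-1 < q" "q < 1"
  shows "integrable lborel (\<lambda>t. \<bar>t\<bar> powr q / (1 + t\<^sup>2))"
proof (rule integrableI_nonneg)
  define p1 where "p1 t = (if t \<in> {0..1} then t powr q else 0)" for t :: real
  define p2 where "p2 t = (if t \<in> {1..} then t powr (q - 2) else 0)" for t :: real
  have m[measurable]: "p1 \<in> borel_measurable borel" "p2 \<in> borel_measurable borel"
    unfolding p1_def p2_def by measurable
  have i1: "(\<integral>\<^sup>+t. ennreal (p1 t) \<partial>lborel) < \<infinity>"
  proof -
    have "(p1 has_integral (1 powr (q + 1) / (q + 1))) UNIV"
      unfolding p1_def has_integral_restrict_UNIV using q by (intro has_integral_powr_from_0) auto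
    from nn_integral_has_integral_lborel[OF m(1) _ this] show ?thesis by (simp add: p1_def)
  qed
  have i2: "(\<integral>\<^sup>+t. ennreal (p2 t) \<partial>lborel) < \<infinity>"
  proof -
    have "(p2 has_integral (- (1 powr (q - 2 + 1)) / (q - 2 + 1))) UNIV"
      unfolding p2_def has_integral_restrict_UNIV using q by (intro has_integral_powr_to_inf) auto
    from nn_integral_has_integral_lborel[OF m(2) _ this] show ?thesis by (simp add: p2_def)
  qed
  define p where "p t = ennreal (p1 t) + ennreal (p2 t)" for t
  have [measurable]: "p \<in> borel_measurable borel" unfolding p_def by measurable
  have ip: "(\<integral>\<^sup>+t. p t \<partial>lborel) < \<infinity>" unfolding p_def using i1 i2 by (subst nn_integral_add) auto
  have ip': "(\<integral>\<^sup>+t. p (- t) \<partial>lborel) < \<infinity>"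
    using nn_integral_real_affine[of p "-1" 0] ip by simp
  have pos: "0 < 1 + t\<^sup>2" for t :: real by (rule add_pos_nonneg) auto
  have bd: "ennreal (\<bar>t\<bar> powr q / (1 + t\<^sup>2)) \<le> p \<bar>t\<bar>" for t
  proof (cases "\<bar>t\<bar> \<le> 1")
    case True
    have "\<bar>t\<bar> powr q / (1 + t\<^sup>2) \<le> \<bar>t\<bar> powr q / 1" using pos by (intro divide_left_mono) auto
    then have "ennreal (\<bar>t\<bar> powr q / (1 + t\<^sup>2)) \<le> ennreal (p1 \<bar>t\<bar>)" using True by (intro ennreal_leI) (simp add: p1_def)
    then show ?thesis unfolding p_def by (rule order_trans) simp
  next
    case False
    have "\<bar>t\<bar> powr q / (1 + t\<^sup>2) \<le> \<bar>t\<bar> powr q / t\<^sup>2" using False pos[of t] by (intro divide_left_mono) auto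
    also have "\<dots> = \<bar>t\<bar> powr (q - 2)" using False by (simp add: powr_diff)
    finally have "ennreal (\<bar>t\<bar> powr q / (1 + t\<^sup>2)) \<le> ennreal (p2 \<bar>t\<bar>)" using False by (intro ennreal_leI) (simp add: p2_def)
    then show ?thesis unfolding p_def by (rule order_trans) simp
  qed
  have "(\<integral>\<^sup>+t. ennreal (\<bar>t\<bar> powr q / (1 + t\<^sup>2)) \<partial>lborel) \<le> (\<integral>\<^sup>+t. p t + p (- t) \<partial>lborel)"
  proof (rule nn_integral_mono)
    fix t :: real
    have "p \<bar>t\<bar> \<le> p t + p (- t)" by (cases "0 \<le> t") auto
    with bd[of t] show "ennreal (\<bar>t\<bar> powr q / (1 + t\<^sup>2)) \<le> p t + p (- t)" by (rule order_trans)
  qed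
  also have "\<dots> < \<infinity>" using ip ip' by (subst nn_integral_add) auto
  finally show "(\<integral>\<^sup>+t. ennreal (\<bar>t\<bar> powr q / (1 + t\<^sup>2)) \<partial>lborel) < \<infinity>" .
qed auto

lemma integrable_inverse_quadratic: "integrable lborel (\<lambda>t::real. 1 / (1 + t\<^sup>2))"
proof (rule Bochner_Integration.integrable_cong_AE[THEN iffD1, OF _ _ _ integrable_powr_over_quadratic[of 0]])
  \<comment> \<open>By convention \<open>0 powr 0 = 0\<close>, so the two integrands differ at the
    origin.\<close>
  show "AE t::real in lborel. \<bar>t\<bar> powr 0 / (1 + t\<^sup>2) = 1 / (1 + t\<^sup>2)"
    using AE_lborel_singleton[of "0::real"] by eventually_elim simp
qed auto

text \<open>Cauchy's formula at \<open>\<i>\<close> for \<open>exp (\<i> a z) / (z + \<i>)\<close> on the rectangle with corners \<open>-R\<close> and \<open>R + \<i> R\<close>.\<close>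
lemma integral_cos_over_quadratic:
  fixes a :: real
  assumes a: "0 \<le> a"
  shows "(\<integral>u. cos (a * u) / (1 + u\<^sup>2) \<partial>lborel) = pi * exp (- a)"
    and "integrable lborel (\<lambda>u. cos (a * u) / (1 + u\<^sup>2))"
proof -
  define h where "h z = exp (\<i> * of_real a * z) / (z + \<i>) / (z - \<i>)" for z :: complex
  let ?c = "\<lambda>u. cos (a * u) / (1 + u\<^sup>2)"
  show int: "integrable lborel ?c"
    by (rule Bochner_Integration.integrable_bound[OF integrable_inverse_quadratic])
      (auto simp: abs_divide intro!: divide_right_mono)
  \<comment> \<open>The other three sides of the rectangle have total length 4R. On them |z| \<ge> R
    and Im z \<ge> 0, so the exponential is at most 1 and the integrand at most 1/(R^2 - 1).\<close>
  have est: "\<bar>integral {-R..R} ?c - pi * exp (- a)\<bar> \<le> 4 * R / (R\<^sup>2 - 1)" if R: "1 < R" for R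
  proof -
    define A where "A = complex_of_real (- R)"
    define B where "B = Complex R 0"
    define C where "C = Complex R R"
    define D where "D = Complex (- R) R"
    \<comment> \<open>A convex open set that contains the rectangle and leaves out the pole at
      -i.\<close>
    let ?S = "{z. Im z > -1}"
    have S: "convex ?S" "open ?S" using convex_halfspace_Im_gt[of "-1"] open_halfspace_Im_gt[of "-1"] by auto
    have ni: "z + \<i> \<noteq> 0" if "Im z > -1" for z using that by (auto simp: complex_eq_iff)
    have hol: "(\<lambda>z. exp (\<i> * of_real a * z) / (z + \<i>)) holomorphic_on ?S"
      using ni by (intro holomorphic_intros) auto
    have rp: "rectpath A C = linepath A B +++ linepath B C +++ linepath C D +++ linepath D A"
      by (simp add: rectpath_def A_def B_def C_def D_def Let_def)
    have ibox: "\<i> \<in> box A C" using R by (simp add: A_def C_def in_box_complex_iff)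
    have pim: "path_image (rectpath A C) \<subseteq> ?S - {\<i>}"
    proof -
      have "path_image (rectpath A C) = cbox A C - box A C"
        using R by (intro path_image_rectpath_cbox_minus_box) (auto simp: A_def C_def)
      moreover have "Im z > -1" if "z \<in> cbox A C" for z
      proof -
        have "Im A \<le> Im z" using that unfolding in_cbox_complex_iff by simp
        then show ?thesis by (simp add: A_def)
      qed
      ultimately show ?thesis using ibox by blast
    qed
    have "(h has_contour_integral of_real (2 * pi) * \<i> * winding_number (rectpath A C) \<i> * (exp (\<i> * of_real a * \<i>) / (\<i> + \<i>))) (rectpath A C)"
      unfolding h_def by (rule Cauchy_integral_formula_convex_simple[OF S(1) hol _ valid_path_rectpath pim])
        (auto simp: interior_open[OF S(2)])
    moreover have "of_real (2 * pi) * \<i> * 1 * (exp (\<i> * of_real a * \<i>) / (\<i> + \<i>)) = complex_of_real (pi * exp (- a))"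
    proof -
      have "\<i> * of_real a * \<i> = complex_of_real (- a)" by (simp add: algebra_simps)
      then have "exp (\<i> * of_real a * \<i>) = complex_of_real (exp (- a))" by (simp only: exp_of_real)
      then show ?thesis by (simp add: field_simps)
    qed
    ultimately have ci: "(h has_contour_integral complex_of_real (pi * exp (- a))) (rectpath A C)"
      by (simp add: winding_number_rectpath[OF ibox])
    have conth: "continuous_on T h" if "T \<subseteq> ?S - {\<i>}" for T
      unfolding h_def using that ni by (intro continuous_intros) auto
    have pis: "closed_segment A B \<subseteq> ?S - {\<i>}" "closed_segment B C \<subseteq> ?S - {\<i>}"
       "closed_segment C D \<subseteq> ?S - {\<i>}" "closed_segment D A \<subseteq> ?S - {\<i>}"
      using pim unfolding rp by (auto simp: path_image_join)
    note cint = contour_integrable_continuous_linepath[OF conth[OF pis(1)]] contour_integrable_continuous_linepath[OF conth[OF pis(2)]]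
      contour_integrable_continuous_linepath[OF conth[OF pis(3)]] contour_integrable_continuous_linepath[OF conth[OF pis(4)]]
    have sum: "contour_integral (linepath A B) h + (contour_integral (linepath B C) h +
       (contour_integral (linepath C D) h + contour_integral (linepath D A) h)) = complex_of_real (pi * exp (- a))"
    proof -
      have "contour_integral (rectpath A C) h = contour_integral (linepath A B) h + (contour_integral (linepath B C) h +
       (contour_integral (linepath C D) h + contour_integral (linepath D A) h))"
        unfolding rp by (simp add: contour_integral_join contour_integrable_joinI cint valid_path_join)
      then show ?thesis using contour_integral_unique[OF ci] by simp
    qed
    have hb: "cmod (h z) \<le> 1 / (R\<^sup>2 - 1)" if z: "R \<le> cmod z" "0 \<le> Im z" for z
    proof -
      have "cmod (exp (\<i> * of_real a * z)) \<le> 1" using z(2) a by (simp add: norm_exp_eq_Re)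
      moreover have "R\<^sup>2 - 1 \<le> cmod ((z + \<i>) * (z - \<i>))"
      proof -
        have "(z + \<i>) * (z - \<i>) = z\<^sup>2 - (- 1)" by (simp add: algebra_simps power2_eq_square)
        moreover have "cmod (z\<^sup>2) - cmod (- 1) \<le> cmod (z\<^sup>2 - (-1))" by (rule norm_triangle_ineq2)
        moreover have "R\<^sup>2 \<le> cmod (z\<^sup>2)" using z R by (simp add: norm_power power_mono)
        ultimately show ?thesis by simp
      qed
      moreover have "0 < R\<^sup>2 - 1" using R by (simp add: power2_eq_square) (metis less_1_mult)
      ultimately show ?thesis
        unfolding h_def norm_divide divide_divide_eq_left norm_mult[symmetric] by (intro frac_le) auto
    qed
    have R1: "0 < R\<^sup>2 - 1" using R by (simp add: power2_eq_square) (metis less_1_mult)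
    have seg: "R \<le> cmod z \<and> 0 \<le> Im z" if zs: "z \<in> closed_segment B C \<union> closed_segment C D \<union> closed_segment D A" for z
    proof -
      obtain P P' u where P: "(P, P') \<in> {(B, C), (C, D), (D, A)}" and u: "0 \<le> u" "u \<le> 1"
        and zu: "z = (1 - u) *\<^sub>R P + u *\<^sub>R P'"
        using zs unfolding closed_segment_def by blast
      have "Re z = (1 - u) * Re P + u * Re P'" and iz: "Im z = (1 - u) * Im P + u * Im P'"
        unfolding zu by simp_all
      then have "Re z = R \<or> Im z = R \<or> Re z = - R"
        using P by (auto simp: A_def B_def C_def D_def algebra_simps)
      moreover have "0 \<le> Im z" unfolding iz using P u R by (auto simp: A_def B_def C_def D_def)
      ultimately show ?thesis using abs_Re_le_cmod[of z] abs_Im_le_cmod[of z] R by auto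
    qed
    have b2: "cmod (contour_integral (linepath B C) h) \<le> 1 / (R\<^sup>2 - 1) * cmod (C - B)"
      using R1 by (intro contour_integral_bound_linepath cint hb) (use seg in auto)
    have b3: "cmod (contour_integral (linepath C D) h) \<le> 1 / (R\<^sup>2 - 1) * cmod (D - C)"
      using R1 by (intro contour_integral_bound_linepath cint hb) (use seg in auto)
    have b4: "cmod (contour_integral (linepath D A) h) \<le> 1 / (R\<^sup>2 - 1) * cmod (A - D)"
      using R1 by (intro contour_integral_bound_linepath cint hb) (use seg in auto)
    have lens: "cmod (C - B) = R" "cmod (D - C) = 2 * R" "cmod (A - D) = R"
      using R by (auto simp: A_def B_def C_def D_def cmod_def real_sqrt_mult)
    define I where "I = contour_integral (linepath A B) h"
    have "(h has_contour_integral I) (linepath A B)" unfolding I_def using cint(1) by (rule has_contour_integral_integral)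
    then have "((\<lambda>x. h (complex_of_real x)) has_integral I) {-R..R}"
      using R by (subst (asm) has_contour_integral_linepath_Reals_iff) (auto simp: A_def B_def complex_is_Real_iff)
    then have "((\<lambda>x. Re (h (complex_of_real x))) has_integral Re I) {-R..R}" by (rule has_integral_Re)
    moreover have "Re (h (complex_of_real x)) = ?c x" for x
    proof -
      have "(complex_of_real x + \<i>) * (complex_of_real x - \<i>) = complex_of_real (1 + x\<^sup>2)"
        by (simp add: algebra_simps power2_eq_square)
      then have "h (complex_of_real x) = exp (\<i> * of_real (a * x)) / complex_of_real (1 + x\<^sup>2)"
        unfolding h_def divide_divide_eq_left by (simp add: mult.assoc)
      then show ?thesis by (simp only: Re_divide_of_real) (simp add: Re_exp)
    qed
    ultimately have Ic: "integral {-R..R} ?c = Re I" by (simp add: integral_unique)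
    have "cmod (I - complex_of_real (pi * exp (- a))) \<le>
       cmod (contour_integral (linepath B C) h) + (cmod (contour_integral (linepath C D) h) + cmod (contour_integral (linepath D A) h))"
    proof -
      have "I - complex_of_real (pi * exp (- a)) = - (contour_integral (linepath B C) h + (contour_integral (linepath C D) h + contour_integral (linepath D A) h))"
        unfolding sum[symmetric] I_def by simp
      then show ?thesis by (simp only: norm_minus_cancel) (intro order_trans[OF norm_triangle_ineq] add_left_mono norm_triangle_ineq)
    qed
    also have "\<dots> \<le> 1 / (R\<^sup>2 - 1) * R + (1 / (R\<^sup>2 - 1) * (2 * R) + 1 / (R\<^sup>2 - 1) * R)"
      using b2 b3 b4 unfolding lens by linarith
    also have "\<dots> = 4 * R / (R\<^sup>2 - 1)" by (simp add: add_divide_distrib[symmetric])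
    finally have "cmod (I - complex_of_real (pi * exp (- a))) \<le> 4 * R / (R\<^sup>2 - 1)" .
    moreover have "Re I - pi * exp (- a) = Re (I - complex_of_real (pi * exp (- a)))" by simp
    ultimately show ?thesis unfolding Ic using abs_Re_le_cmod[of "I - complex_of_real (pi * exp (- a))"] by linarith
  qed
  have lim1: "((\<lambda>R. integral {-R..R} ?c) \<longlongrightarrow> pi * exp (- a)) at_top"
  proof (rule LIM_zero_cancel, rule Lim_null_comparison)
    show "\<forall>\<^sub>F R in at_top. norm (integral {-R..R} ?c - pi * exp (- a)) \<le> 8 / R"
      using eventually_ge_at_top[of 2]
    proof eventually_elim
      case (elim R)
      have R2: "2 * 2 \<le> R * R" using elim by (intro mult_mono) auto
      have "4 * R / (R\<^sup>2 - 1) \<le> 8 / R"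
        using elim R2 by (simp add: divide_simps power2_eq_square)
      then show ?case using est[of R] elim by simp
    qed
    show "((\<lambda>R::real. 8 / R) \<longlongrightarrow> 0) at_top"
      by (rule tendsto_divide_0[OF tendsto_const filterlim_at_top_imp_at_infinity[OF filterlim_ident]])
  qed
  have "((\<lambda>R. \<integral>u. indicator {-R..R} u *\<^sub>R ?c u \<partial>lborel) \<longlongrightarrow> (\<integral>u. ?c u \<partial>lborel)) at_top"
  proof (rule integral_dominated_convergence_at_top[where w="\<lambda>u. 1 / (1 + u\<^sup>2)"])
    show "AE u in lborel. ((\<lambda>R. indicator {-R..R} u *\<^sub>R ?c u) \<longlongrightarrow> ?c u) at_top"
    proof (intro AE_I2 tendsto_eventually)
      fix u :: real
      show "\<forall>\<^sub>F R in at_top. indicator {-R..R} u *\<^sub>R ?c u = ?c u"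
        using eventually_ge_at_top[of "\<bar>u\<bar>"] by eventually_elim (auto simp: indicator_def)
    qed
    show "\<forall>\<^sub>F R in at_top. AE u in lborel. norm (indicator {-R..R} u *\<^sub>R ?c u) \<le> 1 / (1 + u\<^sup>2)"
      by (intro always_eventually allI AE_I2) (auto simp: indicator_def abs_divide intro!: divide_right_mono)
  qed (auto intro: integrable_inverse_quadratic)
  moreover have "(\<integral>u. indicator {-R..R} u *\<^sub>R ?c u \<partial>lborel) = integral {-R..R} ?c" for R
    using set_borel_integral_eq_integral(2)[of "{-R..R}" ?c] integrable_mult_indicator[OF _ int, of "{-R..R}"]
    by (simp add: set_integrable_def set_lebesgue_integral_def)
  ultimately have "((\<lambda>R. integral {-R..R} ?c) \<longlongrightarrow> (\<integral>u. ?c u \<partial>lborel)) at_top" by simp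
  from tendsto_unique[OF _ this lim1] show "(\<integral>u. ?c u \<partial>lborel) = pi * exp (- a)" by simp
qed

text \<open>The squared modulus of (1 - exp (-c \<tau>)) / c for c = \<gamma> + i \<omega>/\<nu>:
  the double time integral factors into a complex number and its conjugate.\<close>

definition kern :: "real \<Rightarrow> real \<Rightarrow> real \<Rightarrow> real \<Rightarrow> real" where
  "kern \<gamma> \<tau> \<nu> \<omega> = (1 + exp (- 2 * \<gamma> * \<tau>) - 2 * exp (- \<gamma> * \<tau>) * cos (\<omega> * \<tau> / \<nu>)) / (\<gamma>\<^sup>2 + (\<omega> / \<nu>)\<^sup>2)"

lemma set_integral_exp:
  fixes c k :: complex
  assumes c: "c \<noteq> 0" and \<tau>: "0 < \<tau>"
  shows "set_lebesgue_integral lborel {0..\<tau>} (\<lambda>\<theta>. exp (k + c * of_real \<theta>)) = exp k * (exp (c * of_real \<tau>) - 1) / c"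
proof -
  have "set_lebesgue_integral lborel {0..\<tau>} (\<lambda>\<theta>. exp (k + c * of_real \<theta>)) =
    exp (k + c * of_real \<tau>) / c - exp (k + c * of_real 0) / c"
    unfolding set_lebesgue_integral_def
  proof (rule integral_FTC_Icc)
    fix x :: real
    have "((\<lambda>z. exp (k + c * z) / c) has_field_derivative exp (k + c * of_real x)) (at (of_real x))"
      using c by (auto intro!: derivative_eq_intros)
    then show "((\<lambda>x. exp (k + c * of_real x) / c) has_vector_derivative exp (k + c * of_real x)) (at x within {0..\<tau>})"
      by (rule has_vector_derivative_real_field)
  qed (use \<tau> in \<open>auto intro!: continuous_intros\<close>)
  then show ?thesis by (simp add: exp_add algebra_simps diff_divide_distrib)
qed

lemma kern_integral:
  assumes \<gamma>: "0 < \<gamma>" and \<tau>: "0 < \<tau>" and \<nu>: "0 < \<nu>"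
  shows "set_lebesgue_integral lborel {0..\<tau>} (\<lambda>\<theta>1. set_lebesgue_integral lborel {0..\<tau>} (\<lambda>\<theta>2.
     exp (complex_of_real (- \<gamma> * (2 * \<tau> - \<theta>1 - \<theta>2)) + \<i> * complex_of_real (\<omega> * (\<theta>1 - \<theta>2) / \<nu>)))) =
   complex_of_real (kern \<gamma> \<tau> \<nu> \<omega>)"
proof -
  define c where "c = Complex \<gamma> (\<omega> / \<nu>)"
  have c0: "c \<noteq> 0" "cnj c \<noteq> 0" using \<gamma> by (auto simp: c_def complex_eq_iff)
  have ce: "c = of_real \<gamma> + \<i> * of_real (\<omega> / \<nu>)" "cnj c = of_real \<gamma> - \<i> * of_real (\<omega> / \<nu>)"
    by (simp_all add: c_def complex_eq_iff)
  let ?k = "complex_of_real (- 2 * \<gamma> * \<tau>)"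
  define Y where "Y = exp (c * of_real \<tau>) - 1"
  have Yc: "exp (cnj c * of_real \<tau>) - 1 = cnj Y" by (simp add: Y_def exp_cnj)
  have "exp (complex_of_real (- \<gamma> * (2 * \<tau> - \<theta>1 - \<theta>2)) + \<i> * complex_of_real (\<omega> * (\<theta>1 - \<theta>2) / \<nu>)) =
    exp ((?k + c * of_real \<theta>1) + cnj c * of_real \<theta>2)" for \<theta>1 \<theta>2
    unfolding ce by (intro arg_cong[of _ _ exp]) (simp add: algebra_simps diff_divide_distrib)
  then have "set_lebesgue_integral lborel {0..\<tau>} (\<lambda>\<theta>1. set_lebesgue_integral lborel {0..\<tau>} (\<lambda>\<theta>2.
     exp (complex_of_real (- \<gamma> * (2 * \<tau> - \<theta>1 - \<theta>2)) + \<i> * complex_of_real (\<omega> * (\<theta>1 - \<theta>2) / \<nu>)))) =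
    set_lebesgue_integral lborel {0..\<tau>} (\<lambda>\<theta>1. exp (?k + c * of_real \<theta>1) * (cnj Y / cnj c))"
    by (simp only: set_integral_exp[OF c0(2) \<tau>] Yc) simp
  also have "\<dots> = set_lebesgue_integral lborel {0..\<tau>} (\<lambda>\<theta>1. exp (?k + c * of_real \<theta>1)) * (cnj Y / cnj c)"
    by (rule set_integral_mult_left)
  also have "\<dots> = exp ?k * (Y * cnj Y) / (c * cnj c)"
    unfolding set_integral_exp[OF c0(1) \<tau>] Y_def[symmetric] by simp
  also have "\<dots> = complex_of_real (exp (- 2 * \<gamma> * \<tau>) * (cmod Y)\<^sup>2 / (cmod c)\<^sup>2)"
    unfolding complex_norm_square[symmetric] exp_of_real by simp
  also have "exp (- 2 * \<gamma> * \<tau>) * (cmod Y)\<^sup>2 / (cmod c)\<^sup>2 = kern \<gamma> \<tau> \<nu> \<omega>"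
  proof -
    have "exp (c * of_real \<tau>) = exp (of_real (\<gamma> * \<tau>)) * exp (\<i> * of_real (\<omega> * \<tau> / \<nu>))"
      unfolding ce exp_add[symmetric] by (simp add: algebra_simps)
    then have "Y = Complex (exp (\<gamma> * \<tau>) * cos (\<omega> * \<tau> / \<nu>) - 1) (exp (\<gamma> * \<tau>) * sin (\<omega> * \<tau> / \<nu>))"
      unfolding Y_def by (simp add: complex_eq_iff Re_exp Im_exp exp_of_real)
    then have "(cmod Y)\<^sup>2 = (exp (\<gamma> * \<tau>) * cos (\<omega> * \<tau> / \<nu>) - 1)\<^sup>2 + (exp (\<gamma> * \<tau>) * sin (\<omega> * \<tau> / \<nu>))\<^sup>2"
      by (simp add: cmod_power2)
    also have "\<dots> = (exp (\<gamma> * \<tau>))\<^sup>2 * ((cos (\<omega> * \<tau> / \<nu>))\<^sup>2 + (sin (\<omega> * \<tau> / \<nu>))\<^sup>2) - 2 * exp (\<gamma> * \<tau>) * cos (\<omega> * \<tau> / \<nu>) + 1"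
      by algebra
    also have "\<dots> = (exp (\<gamma> * \<tau>))\<^sup>2 - 2 * exp (\<gamma> * \<tau>) * cos (\<omega> * \<tau> / \<nu>) + 1" by simp
    finally have "(cmod Y)\<^sup>2 = (exp (\<gamma> * \<tau>))\<^sup>2 - 2 * exp (\<gamma> * \<tau>) * cos (\<omega> * \<tau> / \<nu>) + 1" .
    moreover have "exp (- 2 * \<gamma> * \<tau>) = (exp (- \<gamma> * \<tau>))\<^sup>2" by (simp add: exp_double[symmetric])
    moreover have "exp (- \<gamma> * \<tau>) * exp (\<gamma> * \<tau>) = 1" by (simp add: exp_add[symmetric])
    ultimately have "exp (- 2 * \<gamma> * \<tau>) * (cmod Y)\<^sup>2 = 1 + exp (- 2 * \<gamma> * \<tau>) - 2 * exp (- \<gamma> * \<tau>) * cos (\<omega> * \<tau> / \<nu>)"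
      by algebra
    moreover have "(cmod c)\<^sup>2 = \<gamma>\<^sup>2 + (\<omega> / \<nu>)\<^sup>2" by (simp add: c_def cmod_power2)
    ultimately show ?thesis by (simp add: kern_def)
  qed
  finally show ?thesis .
qed

lemma kern_even: "kern \<gamma> \<tau> \<nu> (- \<omega>) = kern \<gamma> \<tau> \<nu> \<omega>"
  by (simp add: kern_def)

lemma kern_measurable[measurable]: "kern \<gamma> \<tau> \<nu> \<in> borel_measurable borel"
  unfolding kern_def by measurable

text \<open>The numerator lies between (1 - e)^2 and (1 + e)^2 with e = exp (-\<gamma> \<tau>) \<le>
  1. Because of \<open>1 \<le> \<gamma>\<close> neither \<gamma> nor \<tau> survives in the bounds,
  which is the source of uniformity in \<tau>.\<close>

lemma kern_bounds:
  assumes \<gamma>: "1 \<le> \<gamma>" and \<tau>: "0 < \<tau>"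
  shows "0 \<le> kern \<gamma> \<tau> \<nu> \<omega>" "kern \<gamma> \<tau> \<nu> \<omega> \<le> 4 / (1 + (\<omega> / \<nu>)\<^sup>2)"
proof -
  define e where "e = exp (- \<gamma> * \<tau>)"
  have e: "0 < e" "e \<le> 1" using \<gamma> \<tau> by (auto simp: e_def)
  have e2: "exp (- 2 * \<gamma> * \<tau>) = e\<^sup>2" by (simp add: e_def exp_double[symmetric])
  have c: "\<bar>e * cos (\<omega> * \<tau> / \<nu>)\<bar> \<le> e" using e by (simp add: abs_mult mult_left_le)
  have num: "0 \<le> 1 + e\<^sup>2 - 2 * e * cos (\<omega> * \<tau> / \<nu>)" "1 + e\<^sup>2 - 2 * e * cos (\<omega> * \<tau> / \<nu>) \<le> 4"
  proof -
    have "0 \<le> (1 - e)\<^sup>2" by simp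
    then have "0 \<le> 1 + e\<^sup>2 - 2 * e" by (simp add: power2_eq_square algebra_simps)
    then show "0 \<le> 1 + e\<^sup>2 - 2 * e * cos (\<omega> * \<tau> / \<nu>)" using c by linarith
    have "e\<^sup>2 \<le> 1" using e by (simp add: power_le_one)
    then show "1 + e\<^sup>2 - 2 * e * cos (\<omega> * \<tau> / \<nu>) \<le> 4" using c e by linarith
  qed
  have den: "1 + (\<omega> / \<nu>)\<^sup>2 \<le> \<gamma>\<^sup>2 + (\<omega> / \<nu>)\<^sup>2" "0 < 1 + (\<omega> / \<nu>)\<^sup>2" using \<gamma> by (auto intro: add_pos_nonneg)
  show "0 \<le> kern \<gamma> \<tau> \<nu> \<omega>" unfolding kern_def e2 e_def[symmetric] using num by simp
  show "kern \<gamma> \<tau> \<nu> \<omega> \<le> 4 / (1 + (\<omega> / \<nu>)\<^sup>2)" unfolding kern_def e2 e_def[symmetric]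
    using num den by (intro frac_le) auto
qed

lemma kern_abs_le:
  assumes "1 \<le> \<gamma>" "0 < \<tau>"
  shows "\<bar>kern \<gamma> \<tau> \<nu> \<omega>\<bar> \<le> 4"
proof -
  have "4 / (1 + (\<omega> / \<nu>)\<^sup>2) \<le> 4 / 1" by (intro divide_left_mono) (auto intro: add_pos_nonneg)
  then show ?thesis using kern_bounds[OF assms, of \<nu> \<omega>] by simp
qed

text \<open>Interpolation between the bounded and the inverse square regime, from r powr (2 -
  \<epsilon>) \<le> 1 + r^2. Giving up \<epsilon> in the power of \<nu> makes the bound less
  singular in t, and eventually in x_i.\<close>

lemma kern_le_powr:
  assumes \<gamma>: "1 \<le> \<gamma>" and \<tau>: "0 < \<tau>" and \<nu>: "0 < \<nu>" and \<epsilon>: "0 \<le> \<epsilon>" "\<epsilon> \<le> 1" and t: "t \<noteq> 0"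
  shows "kern \<gamma> \<tau> \<nu> (2 * t) \<le> 4 * \<nu> powr (2 - \<epsilon>) * \<bar>t\<bar> powr (\<epsilon> - 2)"
proof -
  define r where "r = 2 * \<bar>t\<bar> / \<nu>"
  have r: "0 < r" using t \<nu> by (simp add: r_def)
  have "r powr (2 - \<epsilon>) \<le> 1 + r\<^sup>2"
  proof (cases "r \<le> 1")
    case True
    then have "r powr (2 - \<epsilon>) \<le> 1" using r \<epsilon> by (intro powr_le1) auto
    then show ?thesis by (smt (verit) zero_le_power2)
  next
    case False
    then have "r powr (2 - \<epsilon>) \<le> r powr 2" using \<epsilon> by (intro powr_mono) auto
    then show ?thesis using r by simp
  qed
  moreover have "(\<bar>t\<bar> / \<nu>) powr (2 - \<epsilon>) \<le> r powr (2 - \<epsilon>)"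
    using t \<nu> \<epsilon> by (intro powr_mono2) (auto simp: r_def divide_right_mono)
  ultimately have le: "(\<bar>t\<bar> / \<nu>) powr (2 - \<epsilon>) \<le> 1 + r\<^sup>2" by simp
  have "kern \<gamma> \<tau> \<nu> (2 * t) \<le> 4 / (1 + (2 * t / \<nu>)\<^sup>2)" by (rule kern_bounds[OF \<gamma> \<tau>])
  also have "(2 * t / \<nu>)\<^sup>2 = r\<^sup>2" by (simp add: r_def power_divide power_mult_distrib)
  also have "4 / (1 + r\<^sup>2) \<le> 4 / (\<bar>t\<bar> / \<nu>) powr (2 - \<epsilon>)"
    using le t \<nu> by (intro divide_left_mono) (auto intro!: mult_pos_pos add_pos_nonneg)
  also have "\<dots> = 4 * \<nu> powr (2 - \<epsilon>) * \<bar>t\<bar> powr (\<epsilon> - 2)"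
    using t \<nu> powr_minus_divide[of "\<bar>t\<bar>" "2 - \<epsilon>"] by (simp add: powr_divide)
  finally show ?thesis .
qed

text \<open>The substitution u = 2t / (\<nu> \<gamma>) turns the denominator into \<gamma>^2 (1 +
  u^2) and the phase into \<gamma> \<tau> u. With e = exp (-\<gamma> \<tau>) the cosine integral
  contributes a second factor e, so the numerator 1 + e^2 - 2 e e collapses to 1 - e^2.\<close>

lemma kern_total:
  assumes \<gamma>: "1 \<le> \<gamma>" and \<tau>: "0 < \<tau>" and \<nu>: "0 < \<nu>"
  shows "(\<integral>t. kern \<gamma> \<tau> \<nu> (2 * t) \<partial>lborel) = (1 - exp (- 2 * \<gamma> * \<tau>)) / (2 * \<gamma>) * \<nu> * pi"
    and "integrable lborel (\<lambda>t. kern \<gamma> \<tau> \<nu> (2 * t))"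
proof -
  define A where "A = 1 + exp (- 2 * \<gamma> * \<tau>)"
  define B where "B = 2 * exp (- \<gamma> * \<tau>)"
  define f where "f u = (A * (1 / (1 + u\<^sup>2)) - B * (cos (\<gamma> * \<tau> * u) / (1 + u\<^sup>2))) / \<gamma>\<^sup>2" for u
  define c where "c = 2 / (\<nu> * \<gamma>)"
  have c: "c \<noteq> 0" "c > 0" using \<gamma> \<nu> by (auto simp: c_def)
  have a: "0 \<le> \<gamma> * \<tau>" using \<gamma> \<tau> by simp
  have eq: "kern \<gamma> \<tau> \<nu> (2 * t) = f (0 + c * t)" for t
  proof -
    have "\<gamma> * \<tau> * (c * t) = 2 * t * \<tau> / \<nu>" using \<gamma> \<nu> by (simp add: c_def)
    moreover have "\<gamma>\<^sup>2 + (2 * t / \<nu>)\<^sup>2 = \<gamma>\<^sup>2 * (1 + (c * t)\<^sup>2)" using \<gamma> \<nu> by (simp add: c_def field_simps power2_eq_square)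
    ultimately show ?thesis unfolding kern_def f_def A_def B_def by (simp add: diff_divide_distrib algebra_simps)
  qed
  have intf: "integrable lborel f"
    unfolding f_def by (intro Bochner_Integration.integrable_diff Bochner_Integration.integrable_mult_right
       Bochner_Integration.integrable_divide integrable_inverse_quadratic integral_cos_over_quadratic a)
  have If: "integral\<^sup>L lborel f = (A * pi - B * (pi * exp (- (\<gamma> * \<tau>)))) / \<gamma>\<^sup>2"
  proof -
    have "integral\<^sup>L lborel f = (A * (\<integral>u. 1 / (1 + u\<^sup>2) \<partial>lborel) - B * (\<integral>u. cos (\<gamma> * \<tau> * u) / (1 + u\<^sup>2) \<partial>lborel)) / \<gamma>\<^sup>2"
      unfolding f_def integral_divide_zero integral_mult_right_zero[symmetric]
      by (subst Bochner_Integration.integral_diff)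
        (intro Bochner_Integration.integrable_mult_right integrable_inverse_quadratic integral_cos_over_quadratic a | rule refl)+
    then show ?thesis using integral_cos_over_quadratic(1)[OF a] integral_cos_over_quadratic(1)[of 0] by simp
  qed
  show "integrable lborel (\<lambda>t. kern \<gamma> \<tau> \<nu> (2 * t))"
    unfolding eq by (rule lborel_integrable_real_affine[OF intf c(1)])
  have "integral\<^sup>L lborel f = c * (\<integral>t. kern \<gamma> \<tau> \<nu> (2 * t) \<partial>lborel)"
    unfolding eq using lborel_integral_real_affine[OF c(1), of f 0] c(2) by simp
  moreover have "B * (pi * exp (- (\<gamma> * \<tau>))) = pi * (2 * exp (- 2 * \<gamma> * \<tau>))"
    unfolding B_def by (simp add: exp_add[symmetric])
  ultimately have "c * (\<integral>t. kern \<gamma> \<tau> \<nu> (2 * t) \<partial>lborel) = pi * (1 - exp (- 2 * \<gamma> * \<tau>)) / \<gamma>\<^sup>2"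
    unfolding If A_def by (simp add: algebra_simps)
  then show "(\<integral>t. kern \<gamma> \<tau> \<nu> (2 * t) \<partial>lborel) = (1 - exp (- 2 * \<gamma> * \<tau>)) / (2 * \<gamma>) * \<nu> * pi"
    using \<gamma> \<nu> unfolding c_def by (simp add: field_simps power2_eq_square)
qed

subsection \<open>Decay and integrability\<close>

text \<open>Supplies the function of \<open>s\<close> in the conclusion before any \<open>F\<close>
  is given. The weight, of arbitrary order \<open>M\<close>, is what later makes the integrals over
  x and y converge.\<close>

lemma rapid_decay_envelope:
  fixes C1 :: "'a::euclidean_space \<times> 'a \<times> 'a \<Rightarrow> real"
  assumes C1: "rapid_decay C1"
  shows "\<exists>h. rapid_decay h \<and> (\<forall>s x y. C1 (s, s + x, s + y) * (1 + (norm (x, y))\<^sup>2) ^ M \<le> h s)"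
proof -
  define val where "val s w = C1 (s, s + fst w, s + snd w) * (1 + (norm w)\<^sup>2) ^ M" for s w
  have C1nn: "0 \<le> C1 P" for P using C1 unfolding rapid_decay_def by blast
  have "\<forall>N. \<exists>A. \<forall>P. C1 P * (sqrt (1 + (norm P)\<^sup>2)) ^ N \<le> A" using C1 unfolding rapid_decay_def by blast
  then obtain A where A: "\<And>N P. C1 P * (sqrt (1 + (norm P)\<^sup>2)) ^ N \<le> A N" by metis
  have valnn: "0 \<le> val s w" for s w unfolding val_def using C1nn by (intro mult_nonneg_nonneg) auto
  \<comment> \<open>Decay of \<open>C1\<close> of order \<open>2 * M + N\<close> in all three
    arguments pays both for the weight in \<open>w\<close> and for \<open>N\<close> powers in
    \<open>s\<close>. The factor \<open>4 ^ M\<close> comes from |w|^2 \<le> 4 |P|^2, since each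
    component of \<open>w\<close> is a difference of components of \<open>P\<close>.\<close>
  have dec: "val s w * sqrt (1 + (norm s)\<^sup>2) ^ N \<le> 4 ^ M * A (2 * M + N)" for s w N
  proof -
    define P where "P = (s, s + fst w, s + snd w)"
    have par: "(norm (u - v))\<^sup>2 \<le> 2 * (norm u)\<^sup>2 + 2 * (norm v)\<^sup>2" for u v :: 'a
    proof -
      have "2 * (norm u)\<^sup>2 + 2 * (norm v)\<^sup>2 - (norm (u - v))\<^sup>2 = (norm (u + v))\<^sup>2"
        unfolding power2_norm_eq_inner by (simp add: inner_add_left inner_add_right inner_diff_left inner_diff_right inner_commute)
      then show ?thesis using zero_le_power2[of "norm (u + v)"] by linarith
    qed
    have nP: "(norm P)\<^sup>2 = (norm s)\<^sup>2 + ((norm (s + fst w))\<^sup>2 + (norm (s + snd w))\<^sup>2)"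
      by (simp add: P_def norm_prod_def)
    have "(norm w)\<^sup>2 = (norm (fst w))\<^sup>2 + (norm (snd w))\<^sup>2" by (simp add: norm_prod_def)
    also have "\<dots> \<le> 4 * (norm P)\<^sup>2"
    proof -
      have gen: "a \<le> 2 * p + 2 * t \<Longrightarrow> b \<le> 2 * q + 2 * t \<Longrightarrow> 0 \<le> p \<Longrightarrow> 0 \<le> q \<Longrightarrow> a + b \<le> 4 * (t + (p + q))"
        for a b p q t :: real by argo
      show ?thesis unfolding nP
        by (rule gen) (use par[of "s + fst w" s] par[of "s + snd w" s] in simp_all)
    qed
    finally have "1 + (norm w)\<^sup>2 \<le> 4 * (1 + (norm P)\<^sup>2)" by simp
    then have "(1 + (norm w)\<^sup>2) ^ M \<le> (4 * (1 + (norm P)\<^sup>2)) ^ M" by (intro power_mono) auto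
    also have "\<dots> = 4 ^ M * sqrt (1 + (norm P)\<^sup>2) ^ (2 * M)"
      unfolding power_mult_distrib by (simp add: power_mult)
    finally have 1: "(1 + (norm w)\<^sup>2) ^ M \<le> 4 ^ M * sqrt (1 + (norm P)\<^sup>2) ^ (2 * M)" .
    have "(norm s)\<^sup>2 \<le> (norm P)\<^sup>2" unfolding nP by simp
    then have 2: "sqrt (1 + (norm s)\<^sup>2) ^ N \<le> sqrt (1 + (norm P)\<^sup>2) ^ N" by (intro power_mono) auto
    have "val s w * sqrt (1 + (norm s)\<^sup>2) ^ N \<le> (C1 P * (4 ^ M * sqrt (1 + (norm P)\<^sup>2) ^ (2 * M))) * sqrt (1 + (norm P)\<^sup>2) ^ N"
      unfolding val_def P_def[symmetric] using C1nn[of P] by (intro mult_mono 1 2 mult_left_mono) auto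
    also have "\<dots> = 4 ^ M * (C1 P * sqrt (1 + (norm P)\<^sup>2) ^ (2 * M + N))" by (simp add: power_add)
    also have "\<dots> \<le> 4 ^ M * A (2 * M + N)" by (intro mult_left_mono A) auto
    finally show ?thesis .
  qed
  define B where "B = 4 ^ M * A (2 * M)"
  have valB: "val s w \<le> B" for s w using dec[of s w 0] by (simp add: B_def)
  have B0: "0 \<le> B" using valnn valB order_trans by blast
  \<comment> \<open>The supremum of the 1-Lipschitz functions \<open>T _ p\<close> is a continuous majorant, and \<open>T s p > 0\<close> forces \<open>fst p\<close> to stay within bounded distance of \<open>s\<close>.\<close>
  define T where "T s p = max 0 (val (fst p) (snd p) - norm (s - fst p))" for s and p :: "'a \<times> 'a \<times> 'a"
  define h where "h s = (SUP p. T s p)" for s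
  have bdd: "bdd_above (range (T s))" for s
  proof (rule bdd_aboveI2)
    fix p
    have "val (fst p) (snd p) - norm (s - fst p) \<le> B" using valB[of "fst p" "snd p"] norm_ge_zero[of "s - fst p"] by linarith
    then show "T s p \<le> B" unfolding T_def using B0 by simp
  qed
  have Th: "T s p \<le> h s" for s p unfolding h_def by (rule cSUP_upper[OF UNIV_I bdd])
  have hle: "h s \<le> x" if "\<And>p. T s p \<le> x" for s x unfolding h_def using that by (intro cSUP_least) auto
  have lip: "h s \<le> h t + norm (s - t)" for s t
  proof (rule hle)
    fix p :: "'a \<times> 'a \<times> 'a"
    have "norm (t - fst p) \<le> norm (s - fst p) + norm (s - t)" using norm_triangle_ineq4[of "s - fst p" "s - t"] by simp
    then have "T s p \<le> T t p + norm (s - t)" unfolding T_def by auto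
    then show "T s p \<le> h t + norm (s - t)" using Th[of t p] by simp
  qed
  have "continuous_on UNIV h"
    unfolding continuous_on_iff
  proof (intro ballI allI impI)
    fix s :: 'a and e :: real assume "0 < e"
    have "dist (h t) (h s) \<le> dist t s" for t
      using lip[of s t] lip[of t s] by (simp add: dist_real_def dist_norm norm_minus_commute abs_le_iff)
    then show "\<exists>d>0. \<forall>t\<in>UNIV. dist t s < d \<longrightarrow> dist (h t) (h s) < e"
      using \<open>0 < e\<close> by (intro exI[of _ e]) (auto intro: le_less_trans)
  qed
  moreover have "0 \<le> h s" for s using Th[of s undefined] unfolding T_def by (rule order_trans[rotated]) simp
  moreover have "\<exists>C. \<forall>s. h s * sqrt (1 + (norm s)\<^sup>2) ^ N \<le> C" for N
  proof (intro exI allI)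
    fix s
    let ?j = "\<lambda>s::'a. sqrt (1 + (norm s)\<^sup>2)"
    \<comment> \<open>Over a distance of at most \<open>B\<close> the weight \<open>?j\<close> grows
      by a factor of at most \<open>1 + B\<close>; with this loss the decay of \<open>val\<close> at
      \<open>fst p\<close> passes to \<open>s\<close>.\<close>
    define L where "L = (1 + B) ^ N * (4 ^ M * A (2 * M + N))"
    have j1: "1 \<le> ?j s" for s by simp
    have jl: "?j s \<le> ?j t + norm (s - t)" for s t
    proof -
      have e: "?j s = norm (1::real, s)" for s by (simp add: norm_prod_def)
      have "norm (1::real, s) \<le> norm (1::real, t) + norm (0::real, s - t)" using norm_triangle_ineq[of "(1::real, t)" "(0, s - t)"] by simp
      then show ?thesis unfolding e by (simp add: norm_prod_def)
    qed
    have "0 \<le> 4 ^ M * A (2 * M + N)" using valnn[of 0 0] dec[of 0 0 N] by simp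
    then have L0: "0 \<le> L" unfolding L_def using B0 by (intro mult_nonneg_nonneg[of "(1 + B) ^ N"]) auto
    have "T s p \<le> L / ?j s ^ N" for p
    proof (cases "val (fst p) (snd p) - norm (s - fst p) \<le> 0")
      case True then show ?thesis using L0 by (simp add: T_def)
    next
      case False
      let ?s = "fst p"
      have "norm (s - ?s) \<le> B" using False valB[of ?s "snd p"] by linarith
      then have "?j s \<le> ?j ?s + B" using jl[of s ?s] by linarith
      also have "\<dots> \<le> ?j ?s + B * ?j ?s" using B0 j1[of ?s] mult_left_mono[of 1 "?j ?s" B] by simp
      finally have "?j s \<le> (1 + B) * ?j ?s" by (simp add: algebra_simps)
      then have "?j s ^ N \<le> ((1 + B) * ?j ?s) ^ N" by (intro power_mono) auto
      then have "?j s ^ N \<le> (1 + B) ^ N * ?j ?s ^ N" by (simp only: power_mult_distrib)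
      moreover have "T s p \<le> val ?s (snd p)" using False valnn by (auto simp: T_def)
      ultimately have "T s p * ?j s ^ N \<le> val ?s (snd p) * ((1 + B) ^ N * ?j ?s ^ N)"
        using valnn by (intro mult_mono) auto
      also have "\<dots> = (1 + B) ^ N * (val ?s (snd p) * ?j ?s ^ N)" by simp
      also have "\<dots> \<le> L" unfolding L_def using B0 by (intro mult_left_mono dec) auto
      finally have le: "T s p * ?j s ^ N \<le> L" .
      have "0 < ?j s ^ N" using j1[of s] by (intro zero_less_power) linarith
      then show ?thesis using le by (simp only: pos_le_divide_eq)
    qed
    then have le: "h s \<le> L / ?j s ^ N" by (rule hle)
    have "0 < ?j s ^ N" using j1[of s] by (intro zero_less_power) linarith
    then show "h s * ?j s ^ N \<le> L" using le by (simp only: pos_le_divide_eq)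
  qed
  ultimately have "rapid_decay h" by (simp add: rapid_decay_def)
  moreover have "C1 (s, s + x, s + y) * (1 + (norm (x, y))\<^sup>2) ^ M \<le> h s" for s x y
    using Th[of s "(s, x, y)"] valnn[of s "(x, y)"] by (simp add: T_def val_def)
  ultimately show ?thesis by blast
qed

section \<open>Integrability of the singular weight\<close>

lemma AE_inner_neq_0:
  fixes a :: "'a::euclidean_space"
  assumes "a \<noteq> 0"
  shows "AE v in lborel. a \<bullet> v \<noteq> 0"
proof -
  have "{v. a \<bullet> v = 0} \<in> null_sets lborel"
    using negligible_hyperplane[of a 0] assms by (intro null_setsI) (auto simp: negligible_iff_emeasure0)
  from AE_not_in[OF this] show ?thesis by simp
qed

text \<open>Compares a radial weight with a product weight, which reduces integrability to one
  variable at a time.\<close>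

lemma prod_quadratic_le:
  fixes v :: "'a::euclidean_space"
  shows "(\<Prod>c\<in>Basis. 1 + (v \<bullet> c)\<^sup>2) \<le> (1 + (norm v)\<^sup>2) ^ DIM('a)"
proof -
  have "(\<Prod>c\<in>Basis. 1 + (v \<bullet> c)\<^sup>2) \<le> (\<Prod>c\<in>(Basis::'a set). 1 + (norm v)\<^sup>2)"
  proof (intro prod_mono conjI)
    fix c :: 'a assume c: "c \<in> Basis"
    have "(v \<bullet> c)\<^sup>2 \<le> (norm v)\<^sup>2" using Basis_le_norm[OF c, of v] by (simp add: abs_le_square_iff[symmetric])
    then show "1 + (v \<bullet> c)\<^sup>2 \<le> 1 + (norm v)\<^sup>2" by simp
  qed (auto intro: add_nonneg_nonneg)
  then show ?thesis by simp
qed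

context cone_region begin

text \<open>On \<open>E\<close> the coordinate \<open>X\<close> dominates all coordinates of \<open>x\<close>, so \<open>\<bar>X\<bar> powr (- q)\<close> is at most the product of the \<open>\<bar>x\<^sub>j\<bar> powr (- q / d)\<close>.\<close>

lemma integrable_weight:
  fixes q :: real
  assumes q: "0 \<le> q" "q < CARD('n)"
  shows "integrable lborel (\<lambda>z. indicator E z * (\<bar>X z\<bar> powr (- q) / (1 + (norm z)\<^sup>2) ^ (2 * CARD('n))))"
proof (rule integrableI_nonneg)
  let ?D = "2 * CARD('n)"
  define r where "r = q / CARD('n)"
  \<comment> \<open>\<open>r < 1\<close> is what makes each single factor integrable at 0; it is the
    hypothesis q < d shared equally among the d coordinates of x.\<close>
  have r: "0 \<le> r" "r < 1" using q by (auto simp: r_def)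
  define k where "k z = indicator E z * (\<bar>X z\<bar> powr (- q) / (1 + (norm z)\<^sup>2) ^ ?D)" for z
  have [measurable]: "k \<in> borel_measurable borel" unfolding k_def by measurable
  have knn: "0 \<le> k z" for z unfolding k_def by (auto simp: indicator_def)
  \<comment> \<open>The dummy variable \<open>v \<bullet> b\<close> in [0, 1] turns the integral
    over the chart into one over the full space, where the coordinates of x are independent
    variables and a product bound can be integrated factor by factor.\<close>
  define K where "K v = indicator {0..1} (v \<bullet> b) * k (adjoint \<iota> v)" for v
  have [measurable]: "adjoint \<iota> \<in> borel_measurable borel" by (rule borel_measurable_linear[OF adjoint_linear[OF lin]])
  have Km[measurable]: "K \<in> borel_measurable borel" unfolding K_def by measurable
  have bb: "b \<bullet> b = 1" using nb by (simp add: dot_square_norm)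
  have K_line: "K (\<iota> z + u *\<^sub>R b) = indicator {0..1} u * k z" for z u
    using adjoint_linear[OF lin] by (simp add: K_def inner_add_left ortho bb linear_add linear_scale adj)
  \<comment> \<open>\<open>snd c = 0\<close> singles out the basis vectors of the first factor: each
    coordinate of x carries one share of the singularity, those of y carry none.\<close>
  define f where "f c t = (if snd c = 0 then \<bar>t\<bar> powr (- r) else 1) / (1 + t\<^sup>2)" for c :: "(real^'n) \<times> (real^'n)" and t :: real
  have fm[measurable]: "f c \<in> borel_measurable borel" for c unfolding f_def by measurable
  have fnn: "0 \<le> f c t" for c t unfolding f_def by (auto intro!: divide_nonneg_nonneg add_nonneg_nonneg)
  have fint: "(\<integral>\<^sup>+t. ennreal (f c t) \<partial>lborel) < \<infinity>" for c
  proof -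
    have "integrable lborel (f c)"
      unfolding f_def using integrable_powr_over_quadratic[of "- r"] integrable_inverse_quadratic r by (cases "snd c = 0") auto
    then show ?thesis using fnn by (simp add: integrable_iff_bounded)
  qed
  have ae: "AE v :: (real^'n) \<times> (real^'n) in lborel. \<forall>u\<in>Basis. fst v \<bullet> u \<noteq> 0"
  proof (rule AE_finite_allI[OF finite_Basis])
    fix u :: "real^'n" assume u: "u \<in> Basis"
    have "(u, 0::real^'n) \<noteq> 0" using nonzero_Basis[OF u] by (auto simp: zero_prod_def)
    from AE_inner_neq_0[OF this] show "AE v :: (real^'n) \<times> (real^'n) in lborel. fst v \<bullet> u \<noteq> 0"
      by eventually_elim (auto simp: inner_prod_def inner_commute)
  qed
  have bound: "K v \<le> 2 ^ ?D * (\<Prod>c\<in>Basis. f c (v \<bullet> c))" if v: "\<forall>u\<in>Basis. fst v \<bullet> u \<noteq> 0" for v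
  proof (cases "v \<bullet> b \<in> {0..1} \<and> adjoint \<iota> v \<in> E")
    case False
    then have "K v = 0" by (auto simp: K_def k_def indicator_def)
    then show ?thesis using fnn by (auto intro!: mult_nonneg_nonneg prod_nonneg)
  next
    case True
    define z where "z = adjoint \<iota> v"
    obtain z' where z': "v = \<iota> z' + (v \<bullet> b) *\<^sub>R b" by (rule decomp)
    have "z = z'" unfolding z_def using adjoint_linear[OF lin] by (subst z') (simp add: linear_add linear_scale adj)
    then have vz: "v = \<iota> z + (v \<bullet> b) *\<^sub>R b" using z' by simp
    have zE: "z \<in> E" using True by (simp add: z_def)
    have u: "0 \<le> v \<bullet> b" "v \<bullet> b \<le> 1" using True by auto
    have "(norm v)\<^sup>2 = (norm z)\<^sup>2 + (v \<bullet> b)\<^sup>2" using norm_iota_b[of z "v \<bullet> b"] vz by simp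
    moreover have "(v \<bullet> b)\<^sup>2 \<le> 1" using u by (simp add: power_le_one)
    ultimately have nv: "1 + (norm v)\<^sup>2 \<le> 2 * (1 + (norm z)\<^sup>2)" by (smt (verit) zero_le_power2)
    have X0: "0 < \<bar>X z\<bar>" using zE E_U by (auto simp: U_def)
    have fv: "fst v = fst (\<iota> z)" using vz fst_line by metis
    have uX: "\<bar>fst v \<bullet> u\<bar> \<le> \<bar>X z\<bar>" if "u \<in> Basis" for u
    proof -
      obtain j where "u = axis j 1" using \<open>u \<in> Basis\<close> by (auto simp: Basis_vec_def)
      then have "fst v \<bullet> u = fst (\<iota> z) $ j" by (simp add: fv inner_axis)
      moreover have "\<bar>fst (\<iota> z) $ j\<bar> \<le> \<bar>fst (\<iota> z) $ i\<bar>" using zE unfolding E_def max_coord_region_def by (auto simp: less_imp_le dest: spec[of _ j])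
      ultimately show ?thesis by (simp add: X_eq)
    qed
    have p1: "\<bar>X z\<bar> powr (- q) \<le> (\<Prod>c\<in>Basis. if snd c = 0 then \<bar>v \<bullet> c\<bar> powr (- r) else 1)"
    proof -
      have "\<bar>X z\<bar> powr (- q) = (\<bar>X z\<bar> powr (- r)) ^ CARD('n)"
        using X0 by (simp add: powr_realpow[symmetric] powr_powr r_def)
      also have "\<dots> = (\<Prod>u\<in>(Basis::(real^'n) set). \<bar>X z\<bar> powr (- r))" by simp
      also have "\<dots> \<le> (\<Prod>u\<in>(Basis::(real^'n) set). \<bar>fst v \<bullet> u\<bar> powr (- r))"
        using uX v r by (intro prod_mono) (auto intro!: powr_mono2')
      also have "\<dots> = (\<Prod>c\<in>(\<lambda>u. (u, 0::real^'n)) ` Basis. if snd c = 0 then \<bar>v \<bullet> c\<bar> powr (- r) else 1)"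
        by (subst prod.reindex) (auto simp: inj_on_def inner_prod_def)
      also have "\<dots> = (\<Prod>c\<in>Basis. if snd c = 0 then \<bar>v \<bullet> c\<bar> powr (- r) else 1)"
        by (rule prod.mono_neutral_left) (auto simp: Basis_prod_def)
      finally show ?thesis .
    qed
    have p2: "(\<Prod>c\<in>Basis. 1 + (v \<bullet> c)\<^sup>2) \<le> 2 ^ ?D * (1 + (norm z)\<^sup>2) ^ ?D"
    proof -
      have "(\<Prod>c\<in>Basis. 1 + (v \<bullet> c)\<^sup>2) \<le> (1 + (norm v)\<^sup>2) ^ ?D"
        using prod_quadratic_le[of v] by (simp add: mult_2)
      also have "\<dots> \<le> (2 * (1 + (norm z)\<^sup>2)) ^ ?D" using nv by (intro power_mono) auto
      finally show ?thesis by (simp only: power_mult_distrib)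
    qed
    have pos: "0 < (\<Prod>c\<in>Basis. 1 + (v \<bullet> c)\<^sup>2)" by (intro prod_pos) (auto intro: add_pos_nonneg)
    have pz: "0 < (1 + (norm z)\<^sup>2) ^ ?D" by (intro zero_less_power add_pos_nonneg) auto
    have "K v = \<bar>X z\<bar> powr (- q) / (1 + (norm z)\<^sup>2) ^ ?D"
      using True zE by (simp add: K_def k_def z_def[symmetric] del: power_mult)
    also have "\<dots> = 2 ^ ?D * (\<bar>X z\<bar> powr (- q) / (2 ^ ?D * (1 + (norm z)\<^sup>2) ^ ?D))" by simp
    also have "\<dots> \<le> 2 ^ ?D * ((\<Prod>c\<in>Basis. if snd c = 0 then \<bar>v \<bullet> c\<bar> powr (- r) else 1) / (\<Prod>c\<in>Basis. 1 + (v \<bullet> c)\<^sup>2))"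
      using p1 p2 pos pz by (intro mult_left_mono frac_le) (auto intro!: prod_nonneg)
    also have "\<dots> = 2 ^ ?D * (\<Prod>c\<in>Basis. f c (v \<bullet> c))" unfolding f_def by (simp only: prod_dividef)
    finally show ?thesis .
  qed
  have "(\<integral>\<^sup>+z. ennreal (k z) \<partial>lborel) = (\<integral>\<^sup>+z. (\<integral>\<^sup>+u. ennreal (K (\<iota> z + u *\<^sub>R b)) \<partial>lborel) \<partial>lborel)"
  proof (rule nn_integral_cong)
    fix z
    have "(\<integral>\<^sup>+u. ennreal (K (\<iota> z + u *\<^sub>R b)) \<partial>lborel) = (\<integral>\<^sup>+u. ennreal (k z) * indicator {0..1::real} u \<partial>lborel)"
      unfolding K_line by (intro nn_integral_cong) (auto simp: indicator_def)
    then show "ennreal (k z) = (\<integral>\<^sup>+u. ennreal (K (\<iota> z + u *\<^sub>R b)) \<partial>lborel)" by (simp add: nn_integral_cmult_indicator)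
  qed
  also have "\<dots> = (\<integral>\<^sup>+v. ennreal (K v) \<partial>lborel)" by (rule nn_integral_chart[OF dim, symmetric]) measurable
  also have "\<dots> \<le> (\<integral>\<^sup>+v. ennreal (2 ^ ?D) * (\<Prod>c\<in>Basis. ennreal (f c (v \<bullet> c))) \<partial>lborel)"
  proof (rule nn_integral_mono_AE)
    show "AE v in lborel. ennreal (K v) \<le> ennreal (2 ^ ?D) * (\<Prod>c\<in>Basis. ennreal (f c (v \<bullet> c)))"
      using ae
    proof eventually_elim
      case (elim v)
      have "ennreal (K v) \<le> ennreal (2 ^ ?D * (\<Prod>c\<in>Basis. f c (v \<bullet> c)))" by (intro ennreal_leI bound elim)
      also have "\<dots> = ennreal (2 ^ ?D) * (\<Prod>c\<in>Basis. ennreal (f c (v \<bullet> c)))"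
        using fnn by (simp add: ennreal_mult' prod_ennreal)
      finally show ?case .
    qed
  qed
  also have "\<dots> = ennreal (2 ^ ?D) * (\<Prod>c\<in>Basis. (\<integral>\<^sup>+t. ennreal (f c t) \<partial>lborel))"
    by (subst nn_integral_cmult) (measurable, subst nn_integral_lborel_prod, auto)
  also have "\<dots> < \<infinity>"
  proof -
    have "(\<Prod>c\<in>S. (\<integral>\<^sup>+t. ennreal (f c t) \<partial>lborel)) < top" for S
      using fint by (induction S rule: infinite_finite_induct) (auto simp: ennreal_mult_less_top)
    then show ?thesis by (simp add: ennreal_mult_less_top)
  qed
  finally show "(\<integral>\<^sup>+z. ennreal (indicator E z * (\<bar>X z\<bar> powr (- q) / (1 + (norm z)\<^sup>2) ^ ?D)) \<partial>lborel) < \<infinity>"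
    by (simp add: k_def)
qed (auto simp: indicator_def)

end

subsection \<open>The error term\<close>

text \<open>The derivative of f (v + x) + f (v - x) in x is at most 2|u|B for |x| \<le> |u|. Using
  this one bound on the whole interval loses a factor 2 against the sharp constant.\<close>

lemma second_difference_bound:
  fixes f f' f'' :: "real \<Rightarrow> real"
  assumes f: "\<And>x. (f has_real_derivative f' x) (at x)" and f': "\<And>x. (f' has_real_derivative f'' x) (at x)"
    and B: "\<And>x. \<bar>f'' x\<bar> \<le> B"
  shows "\<bar>f (v + u) + f (v - u) - 2 * f v\<bar> \<le> 2 * u\<^sup>2 * B"
proof -
  have B0: "0 \<le> B" using B[of 0] by linarith
  have lip: "\<bar>f' x - f' y\<bar> \<le> B * \<bar>x - y\<bar>" for x y
    using field_differentiable_bound[of UNIV f' f'' B x y] f' B by simp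
  define p where "p x = f (v + x) + f (v - x)" for x
  have dp: "(p has_real_derivative (f' (v + x) - f' (v - x))) (at x)" for x
    unfolding p_def by (rule derivative_eq_intros DERIV_chain2[OF f] refl | simp)+
  have "\<bar>p u - p 0\<bar> \<le> (2 * \<bar>u\<bar> * B) * \<bar>u - 0\<bar>"
    unfolding real_norm_def[symmetric]
  proof (rule field_differentiable_bound[of "{- \<bar>u\<bar>..\<bar>u\<bar>}"])
    fix x assume x: "x \<in> {- \<bar>u\<bar>..\<bar>u\<bar>}"
    show "(p has_field_derivative (f' (v + x) - f' (v - x))) (at x within {- \<bar>u\<bar>..\<bar>u\<bar>})"
      by (rule has_field_derivative_at_within[OF dp])
    have "B * \<bar>(v + x) - (v - x)\<bar> \<le> B * (2 * \<bar>u\<bar>)" using x B0 by (intro mult_left_mono) auto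
    then show "norm (f' (v + x) - f' (v - x)) \<le> 2 * norm u * B" using lip[of "v + x" "v - x"] by (simp add: mult_ac)
  qed auto
  then show ?thesis by (simp add: p_def power2_eq_square algebra_simps abs_mult_self_eq)
qed

lemma integrable_inverse_quadratic_power:
  "integrable lborel (\<lambda>v::'a::euclidean_space. 1 / (1 + (norm v)\<^sup>2) ^ DIM('a))"
proof (rule integrableI_nonneg)
  have bd: "1 / (1 + (norm v)\<^sup>2) ^ DIM('a) \<le> (\<Prod>c\<in>Basis. 1 / (1 + (v \<bullet> c)\<^sup>2))" for v :: 'a
  proof -
    note prod_quadratic_le[of v]
    moreover have "0 < (\<Prod>c\<in>Basis. 1 + (v \<bullet> c)\<^sup>2)" by (intro prod_pos) (auto intro: add_pos_nonneg)
    ultimately show ?thesis unfolding prod_dividef by (intro frac_le) auto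
  qed
  have fin: "(\<integral>\<^sup>+t. ennreal (1 / (1 + t\<^sup>2)) \<partial>lborel) < \<infinity>"
    using integrable_inverse_quadratic by (auto simp: integrable_iff_bounded abs_divide)
  have "(\<integral>\<^sup>+v. ennreal (1 / (1 + (norm v)\<^sup>2) ^ DIM('a)) \<partial>(lborel :: 'a measure)) \<le>
     (\<integral>\<^sup>+v. (\<Prod>c\<in>Basis. ennreal (1 / (1 + (v \<bullet> c)\<^sup>2))) \<partial>(lborel :: 'a measure))"
  proof (rule nn_integral_mono)
    fix v :: 'a
    show "ennreal (1 / (1 + (norm v)\<^sup>2) ^ DIM('a)) \<le> (\<Prod>c\<in>Basis. ennreal (1 / (1 + (v \<bullet> c)\<^sup>2)))"
      using bd[of v] by (subst prod_ennreal) (auto intro!: ennreal_leI divide_nonneg_nonneg add_nonneg_nonneg)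
  qed
  also have "\<dots> = (\<Prod>c\<in>(Basis::'a set). (\<integral>\<^sup>+t. ennreal (1 / (1 + t\<^sup>2)) \<partial>lborel))"
    by (rule nn_integral_lborel_prod) auto
  also have "\<dots> < \<infinity>" using fin by (simp add: power_less_top_ennreal)
  finally show "(\<integral>\<^sup>+v. ennreal (1 / (1 + (norm v)\<^sup>2) ^ DIM('a)) \<partial>(lborel :: 'a measure)) < \<infinity>" .
qed auto

text \<open>Merges the trivial and the quadratic bound into one multiple of r / (1 + r). The
  constant 6 is fixed by equality at the crossover r = 2.\<close>

lemma min_quadratic_le: "0 \<le> r \<Longrightarrow> a \<le> 4 * m \<Longrightarrow> a \<le> 2 * r * m \<Longrightarrow> 0 \<le> m \<Longrightarrow> a \<le> 6 * m * (r / (1 + r))" for r a m :: real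
proof -
  assume r: "0 \<le> r" and a: "a \<le> 4 * m" "a \<le> 2 * r * m" and m: "0 \<le> m"
  have "a * (1 + r) \<le> 6 * m * r"
  proof (cases "r \<le> 2")
    case True
    have "a * (1 + r) \<le> (2 * r * m) * (1 + r)" using a r by (intro mult_right_mono) auto
    also have "\<dots> \<le> (2 * r * m) * 3" using True r m by (intro mult_left_mono) auto
    finally show ?thesis by (simp add: mult_ac)
  next
    case False
    have "a * (1 + r) \<le> (4 * m) * (1 + r)" using a r by (intro mult_right_mono) auto
    also have "\<dots> = m * (4 * (1 + r))" by simp
    also have "\<dots> \<le> m * (6 * r)" using False m by (intro mult_left_mono) auto
    finally show ?thesis by (simp add: mult_ac)
  qed
  then show ?thesis using r by (simp add: pos_le_divide_eq)
qed

text \<open>As the kernel is even, twice the error is the integral of the symmetric second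
  difference. The substitution v = t / X extracts |X| powr (\<epsilon> - 1) and leaves the integral
  of |v| powr \<epsilon> / (1 + v^2), which converges because \<epsilon> < 1.\<close>

lemma kern_second_difference:
  fixes f :: "real \<Rightarrow> real"
  assumes \<gamma>: "1 \<le> \<gamma>" and \<tau>: "0 < \<tau>" and \<nu>: "0 < \<nu>" and \<epsilon>: "0 \<le> \<epsilon>" "\<epsilon> < 1" and X: "X \<noteq> 0"
    and f[measurable]: "f \<in> borel_measurable borel" and m: "\<And>t. \<bar>f t\<bar> \<le> m"
    and f2: "\<And>u. \<bar>f u + f (- u) - 2 * f 0\<bar> \<le> 2 * u\<^sup>2 * m"
  shows "\<bar>(\<integral>t. f (t / X) * kern \<gamma> \<tau> \<nu> (2 * t) \<partial>lborel) - f 0 * (\<integral>t. kern \<gamma> \<tau> \<nu> (2 * t) \<partial>lborel)\<bar>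
    \<le> 12 * (\<integral>v. \<bar>v\<bar> powr \<epsilon> / (1 + v\<^sup>2) \<partial>lborel) * \<nu> powr (2 - \<epsilon>) * \<bar>X\<bar> powr (\<epsilon> - 1) * m"
proof -
  let ?k = "\<lambda>t. kern \<gamma> \<tau> \<nu> (2 * t)"
  have m0: "0 \<le> m" using m[of 0] by linarith
  have ki: "integrable lborel ?k" by (rule kern_total(2)[OF \<gamma> \<tau> \<nu>])
  have k0: "0 \<le> ?k t" for t by (rule kern_bounds[OF \<gamma> \<tau>])
  have ke: "?k (- t) = ?k t" for t using kern_even[of \<gamma> \<tau> \<nu> "2 * t"] by simp
  have fi: "integrable lborel (\<lambda>t. f (c * t / X) * ?k t)" for c
  proof (rule Bochner_Integration.integrable_bound[OF integrable_mult_right[OF ki, of m]])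
    show "AE t in lborel. norm (f (c * t / X) * ?k t) \<le> norm (m * ?k t)"
      using m m0 k0 by (auto simp: abs_mult intro!: mult_right_mono)
  qed measurable
  have refl: "(\<integral>t. f (- t / X) * ?k t \<partial>lborel) = (\<integral>t. f (t / X) * ?k t \<partial>lborel)"
    using lborel_integral_real_affine[of "-1" "\<lambda>t. f (t / X) * ?k t" 0] ke by simp
  define S where "S t = (f (t / X) + f (- (t / X)) - 2 * f 0) * ?k t" for t
  have Si: "integrable lborel S" and SI: "integral\<^sup>L lborel S = 2 * ((\<integral>t. f (t / X) * ?k t \<partial>lborel) - f 0 * (\<integral>t. ?k t \<partial>lborel))"
  proof -
    have eq: "S = (\<lambda>t. (f (1 * t / X) * ?k t + f (-1 * t / X) * ?k t) - (2 * f 0) * ?k t)"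
      by (auto simp: S_def fun_eq_iff algebra_simps)
    show "integrable lborel S" unfolding eq
      by (intro Bochner_Integration.integrable_add Bochner_Integration.integrable_diff fi integrable_mult_right ki)
    show "integral\<^sup>L lborel S = 2 * ((\<integral>t. f (t / X) * ?k t \<partial>lborel) - f 0 * (\<integral>t. ?k t \<partial>lborel))"
      unfolding eq using fi[of 1] fi[of "-1"] ki refl
      by (subst Bochner_Integration.integral_diff) (auto simp: Bochner_Integration.integral_add)
  qed
  define q where "q v = \<bar>v\<bar> powr \<epsilon> / (1 + v\<^sup>2)" for v :: real
  have qi: "integrable lborel q" unfolding q_def using \<epsilon> by (intro integrable_powr_over_quadratic) auto
  \<comment> \<open>24 = 6 * 4, from \<open>min_quadratic_le\<close> and
    \<open>kern_le_powr\<close>; the symmetrization halves it to the 12 of the statement.\<close>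
  let ?c = "24 * \<nu> powr (2 - \<epsilon>) * \<bar>X\<bar> powr (\<epsilon> - 2) * m"
  have Sb: "\<bar>S t\<bar> \<le> ?c * q (0 + (1 / X) * t)" for t
  proof (cases "t = 0")
    case True then show ?thesis using m0 by (simp add: S_def q_def)
  next
    case False
    define r where "r = (t / X)\<^sup>2"
    have r: "0 \<le> r" by (simp add: r_def)
    have a: "\<bar>f (t / X) + f (- (t / X)) - 2 * f 0\<bar> \<le> 6 * m * (r / (1 + r))"
    proof (rule min_quadratic_le[OF r])
      show "\<bar>f (t / X) + f (- (t / X)) - 2 * f 0\<bar> \<le> 4 * m"
        using m[of "t / X"] m[of "- (t / X)"] m[of 0] by linarith
      show "\<bar>f (t / X) + f (- (t / X)) - 2 * f 0\<bar> \<le> 2 * r * m" using f2[of "t / X"] by (simp add: r_def)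
    qed (rule m0)
    have "\<bar>S t\<bar> = \<bar>f (t / X) + f (- (t / X)) - 2 * f 0\<bar> * ?k t" using k0 by (simp add: S_def abs_mult)
    also have "\<dots> \<le> (6 * m * (r / (1 + r))) * (4 * \<nu> powr (2 - \<epsilon>) * \<bar>t\<bar> powr (\<epsilon> - 2))"
      using a k0 m0 r kern_le_powr[OF \<gamma> \<tau> \<nu> \<epsilon>(1) _ False] \<epsilon> by (intro mult_mono) auto
    also have "\<dots> = ?c * q (0 + (1 / X) * t)"
    proof -
      have "\<bar>t\<bar> powr (\<epsilon> - 2) = \<bar>X\<bar> powr (\<epsilon> - 2) * \<bar>t / X\<bar> powr (\<epsilon> - 2)"
        using X by (simp add: powr_mult[symmetric] abs_divide)
      moreover have "r * \<bar>t / X\<bar> powr (\<epsilon> - 2) = \<bar>t / X\<bar> powr \<epsilon>"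
      proof -
        have "\<bar>t / X\<bar> powr \<epsilon> = \<bar>t / X\<bar> powr (2 + (\<epsilon> - 2))" by simp
        also have "\<dots> = \<bar>t / X\<bar> powr 2 * \<bar>t / X\<bar> powr (\<epsilon> - 2)" by (rule powr_add)
        also have "\<bar>t / X\<bar> powr 2 = r" using X False by (simp add: r_def power_divide)
        finally show ?thesis by simp
      qed
      ultimately have "r * \<bar>t\<bar> powr (\<epsilon> - 2) = \<bar>X\<bar> powr (\<epsilon> - 2) * \<bar>t / X\<bar> powr \<epsilon>" by (metis mult.left_commute)
      then have "(6 * m * (r / (1 + r))) * (4 * \<nu> powr (2 - \<epsilon>) * \<bar>t\<bar> powr (\<epsilon> - 2)) =
         24 * \<nu> powr (2 - \<epsilon>) * m * (\<bar>X\<bar> powr (\<epsilon> - 2) * \<bar>t / X\<bar> powr \<epsilon>) / (1 + r)"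
        by (simp add: mult_ac)
      then show ?thesis by (simp add: q_def r_def)
    qed
    finally show ?thesis .
  qed
  have Qi: "integrable lborel (\<lambda>t. q (0 + (1 / X) * t))" by (rule lborel_integrable_real_affine[OF qi]) (use X in simp)
  have QI: "(\<integral>t. q (0 + (1 / X) * t) \<partial>lborel) = \<bar>X\<bar> * integral\<^sup>L lborel q"
    using lborel_integral_real_affine[of "1 / X" q 0] X by (simp add: field_simps)
  have "\<bar>integral\<^sup>L lborel S\<bar> \<le> (\<integral>t. \<bar>S t\<bar> \<partial>lborel)" using integral_norm_bound[of lborel S] by simp
  also have "\<dots> \<le> (\<integral>t. ?c * q (0 + (1 / X) * t) \<partial>lborel)"
    by (intro integral_mono Sb integrable_abs Si integrable_mult_right Qi)
  also have "\<dots> = ?c * (\<bar>X\<bar> * integral\<^sup>L lborel q)" by (simp only: integral_mult_right_zero QI)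
  also have "\<dots> = 24 * integral\<^sup>L lborel q * \<nu> powr (2 - \<epsilon>) * (\<bar>X\<bar> * \<bar>X\<bar> powr (\<epsilon> - 2)) * m" by (simp only: mult_ac)
  also have "\<bar>X\<bar> * \<bar>X\<bar> powr (\<epsilon> - 2) = \<bar>X\<bar> powr (\<epsilon> - 1)"
    using X powr_add[of "\<bar>X\<bar>" 1 "\<epsilon> - 2"] by simp
  finally show ?thesis unfolding SI q_def by (simp add: abs_mult)
qed

lemma integrable_indicator_kern:
  fixes G :: "(real^'n) \<times> (real^'n) \<Rightarrow> real"
  assumes \<gamma>: "1 \<le> \<gamma>" and \<tau>: "0 < \<tau>" and G: "integrable lborel G"
  shows "integrable lborel (\<lambda>v. indicator (max_coord_region i) (fst v) * (G v * kern \<gamma> \<tau> \<nu> (2 * pairing v)))"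
proof (rule Bochner_Integration.integrable_bound[OF integrable_mult_right[OF G, of 4]])
  have [measurable]: "G \<in> borel_measurable borel" using G by auto
  have [measurable]: "(\<lambda>v::(real^'n)\<times>(real^'n). fst v) \<in> borel_measurable borel"
    by (intro borel_measurable_continuous_onI continuous_intros)
  show "(\<lambda>v. indicator (max_coord_region i) (fst v) * (G v * kern \<gamma> \<tau> \<nu> (2 * pairing v))) \<in> borel_measurable lborel" by measurable
  show "AE v in lborel. norm (indicator (max_coord_region i) (fst v) * (G v * kern \<gamma> \<tau> \<nu> (2 * pairing v))) \<le> norm (4 * G v)"
  proof (rule AE_I2)
    fix v
    have "\<bar>G v\<bar> * \<bar>kern \<gamma> \<tau> \<nu> (2 * pairing v)\<bar> \<le> \<bar>G v\<bar> * 4" by (intro mult_left_mono kern_abs_le[OF \<gamma> \<tau>]) auto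
    then show "norm (indicator (max_coord_region i) (fst v) * (G v * kern \<gamma> \<tau> \<nu> (2 * pairing v))) \<le> norm (4 * G v)"
      by (auto simp: indicator_def abs_mult)
  qed
qed

context cone_region begin

lemma fst_b: "fst b = 0" by (simp add: b_eq)

text \<open>\<open>H0\<close> carries everything that depends on the integrand. The remaining
  constants are integrals over the chart, independent of \<gamma>, \<tau> and \<nu>. The Jacobian
  1/|X| adds one more power of the singularity, whence the condition 2 - \<epsilon> < d.\<close>

lemma region_estimate:
  fixes G :: "(real^'n) \<times> (real^'n) \<Rightarrow> real" and \<gamma> \<tau> \<nu> \<epsilon> H0 :: real
  assumes \<gamma>: "1 \<le> \<gamma>" and \<tau>: "0 < \<tau>" and \<nu>: "0 < \<nu>" and \<epsilon>: "0 \<le> \<epsilon>" "\<epsilon> < 1" "2 - \<epsilon> < real CARD('n)"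
    and Gi: "integrable lborel G"
    and Gb: "\<And>z u. \<bar>G (\<iota> z + u *\<^sub>R b)\<bar> \<le> H0 / (1 + (norm z)\<^sup>2) ^ (2 * CARD('n))"
    and G2: "\<And>z v u. \<bar>G (\<iota> z + (v + u) *\<^sub>R b) + G (\<iota> z + (v - u) *\<^sub>R b) - 2 * G (\<iota> z + v *\<^sub>R b)\<bar>
       \<le> 2 * u\<^sup>2 * (H0 / (1 + (norm z)\<^sup>2) ^ (2 * CARD('n)))"
  shows "integrable lborel (\<lambda>z. indicator E z * (G (pt z) / \<bar>X z\<bar>))" (is ?A)
    and "\<bar>(\<integral>v. indicator (max_coord_region i) (fst v) * (G v * kern \<gamma> \<tau> \<nu> (2 * pairing v)) \<partial>lborel) -
      (\<integral>t. kern \<gamma> \<tau> \<nu> (2 * t) \<partial>lborel) * (\<integral>z. indicator E z * (G (pt z) / \<bar>X z\<bar>) \<partial>lborel)\<bar>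
     \<le> 12 * (\<integral>v. \<bar>v\<bar> powr \<epsilon> / (1 + v\<^sup>2) \<partial>lborel) *
        (\<integral>z. indicator E z * (\<bar>X z\<bar> powr (- (2 - \<epsilon>)) / (1 + (norm z)\<^sup>2) ^ (2 * CARD('n))) \<partial>lborel) * H0 * \<nu> powr (2 - \<epsilon>)" (is ?B)
proof -
  let ?k = "\<lambda>t. kern \<gamma> \<tau> \<nu> (2 * t)" and ?D = "2 * CARD('n)"
  define \<kappa> where "\<kappa> = (\<integral>t. ?k t \<partial>lborel)"
  define c\<epsilon> where "c\<epsilon> = (\<integral>v. \<bar>v\<bar> powr \<epsilon> / (1 + v\<^sup>2) \<partial>lborel)"
  define wt where "wt q z = indicator E z * (\<bar>X z\<bar> powr (- q) / (1 + (norm z)\<^sup>2) ^ ?D)" for q z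
  have wi: "integrable lborel (wt q)" if "0 \<le> q" "q < real CARD('n)" for q :: real
    unfolding wt_def by (rule integrable_weight[OF that])
  have Gm[measurable]: "G \<in> borel_measurable borel" using Gi by auto
  have H0: "0 \<le> H0" using Gb[of 0 0] by simp
  have c2: "1 < CARD('n)" using \<epsilon> by linarith
  have Xn: "z \<in> E \<Longrightarrow> X z \<noteq> 0" for z using E_U by (auto simp: U_def)
  have pm: "G (pt z) = G (\<iota> z + g z *\<^sub>R b)" for z by (simp add: pt_def)
  show A: ?A
  proof (rule Bochner_Integration.integrable_bound[OF integrable_mult_right[OF wi[of 1], of H0]])
    show "AE z in lborel. norm (indicator E z * (G (pt z) / \<bar>X z\<bar>)) \<le> norm (H0 * wt 1 z)"
    proof (rule AE_I2)
      fix z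
      show "norm (indicator E z * (G (pt z) / \<bar>X z\<bar>)) \<le> norm (H0 * wt 1 z)"
      proof (cases "z \<in> E")
        case True
        have "\<bar>G (pt z)\<bar> / \<bar>X z\<bar> \<le> (H0 / (1 + (norm z)\<^sup>2) ^ ?D) / \<bar>X z\<bar>"
          using Gb[of z "g z"] by (intro divide_right_mono) (auto simp: pm)
        also have "\<dots> = H0 * wt 1 z" using True Xn[OF True] by (simp add: wt_def powr_minus_divide)
        finally show ?thesis using True by (simp add: abs_divide)
      qed simp
    qed
  qed (use c2 in auto)
  define L where "L v = indicator (max_coord_region i) (fst v) * (G v * ?k (pairing v))" for v
  have Li: "integrable lborel L" unfolding L_def by (rule integrable_indicator_kern[OF \<gamma> \<tau> Gi])
  define T where "T z = (\<integral>t. G (\<iota> z + (g z + t / X z) *\<^sub>R b) * ?k t \<partial>lborel)" for z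
  have inner: "(\<integral>u. L (\<iota> z + u *\<^sub>R b) \<partial>lborel) = indicator E z * (T z / \<bar>X z\<bar>)" for z
  proof (cases "z \<in> E")
    case True
    then have zU: "z \<in> U" and X: "X z \<noteq> 0" using E_U Xn by auto
    have Leq: "L (\<iota> z + (g z + (1 / X z) * t) *\<^sub>R b) = G (\<iota> z + (g z + t / X z) *\<^sub>R b) * ?k t" for t
    proof -
      have "\<iota> z + (g z + (1 / X z) * t) *\<^sub>R b = pt z + (t / X z) *\<^sub>R b" by (simp add: pt_def algebra_simps)
      then have "pairing (\<iota> z + (g z + (1 / X z) * t) *\<^sub>R b) = t" using pairing_pt[OF zU, of "t / X z"] X by simp
      then show ?thesis using True by (simp add: L_def fst_b E_def)
    qed
    have "(\<integral>u. L (\<iota> z + u *\<^sub>R b) \<partial>lborel) = \<bar>1 / X z\<bar> *\<^sub>R (\<integral>t. L (\<iota> z + (g z + (1 / X z) * t) *\<^sub>R b) \<partial>lborel)"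
      using X by (intro lborel_integral_real_affine) simp
    also have "\<dots> = \<bar>1 / X z\<bar> *\<^sub>R T z" unfolding T_def by (simp only: Leq)
    finally show ?thesis using True by (simp add: abs_divide)
  next
    case False
    then show ?thesis by (simp add: L_def fst_b E_def)
  qed
  have LI: "integral\<^sup>L lborel L = (\<integral>z. indicator E z * (T z / \<bar>X z\<bar>) \<partial>lborel)"
    and Ti: "integrable lborel (\<lambda>z. indicator E z * (T z / \<bar>X z\<bar>))"
    using integral_chart[OF dim Li] by (simp_all add: inner)
  let ?C = "12 * c\<epsilon> * \<nu> powr (2 - \<epsilon>) * H0"
  have err: "\<bar>indicator E z * (T z / \<bar>X z\<bar>) - \<kappa> * (indicator E z * (G (pt z) / \<bar>X z\<bar>))\<bar> \<le> ?C * wt (2 - \<epsilon>) z" for z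
  proof (cases "z \<in> E")
    case True
    define f where "f u = G (\<iota> z + (g z + u) *\<^sub>R b)" for u
    have X: "X z \<noteq> 0" using Xn[OF True] .
    have [measurable]: "f \<in> borel_measurable borel" unfolding f_def by measurable
    have "\<bar>T z - f 0 * \<kappa>\<bar> \<le> 12 * c\<epsilon> * \<nu> powr (2 - \<epsilon>) * \<bar>X z\<bar> powr (\<epsilon> - 1) * (H0 / (1 + (norm z)\<^sup>2) ^ ?D)"
      unfolding T_def \<kappa>_def c\<epsilon>_def f_def[symmetric]
    proof (rule kern_second_difference[OF \<gamma> \<tau> \<nu> \<epsilon>(1,2) X])
      show "\<bar>f t\<bar> \<le> H0 / (1 + (norm z)\<^sup>2) ^ ?D" for t unfolding f_def by (rule Gb)
      show "\<bar>f u + f (- u) - 2 * f 0\<bar> \<le> 2 * u\<^sup>2 * (H0 / (1 + (norm z)\<^sup>2) ^ ?D)" for u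
        unfolding f_def using G2[of z "g z" u] by simp
    qed measurable
    then have "\<bar>T z - f 0 * \<kappa>\<bar> / \<bar>X z\<bar> \<le> (12 * c\<epsilon> * \<nu> powr (2 - \<epsilon>) * \<bar>X z\<bar> powr (\<epsilon> - 1) * (H0 / (1 + (norm z)\<^sup>2) ^ ?D)) / \<bar>X z\<bar>"
      by (rule divide_right_mono) simp
    also have "\<dots> = ?C * ((\<bar>X z\<bar> powr (\<epsilon> - 1) / \<bar>X z\<bar>) / (1 + (norm z)\<^sup>2) ^ ?D)" by (simp add: mult_ac)
    also have "\<bar>X z\<bar> powr (\<epsilon> - 1) / \<bar>X z\<bar> = \<bar>X z\<bar> powr (- (2 - \<epsilon>))"
      using X powr_diff[of "\<bar>X z\<bar>" "\<epsilon> - 1" 1] by simp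
    finally have "\<bar>T z - f 0 * \<kappa>\<bar> / \<bar>X z\<bar> \<le> ?C * wt (2 - \<epsilon>) z" using True by (simp add: wt_def)
    moreover have "T z / \<bar>X z\<bar> - \<kappa> * (G (pt z) / \<bar>X z\<bar>) = (T z - f 0 * \<kappa>) / \<bar>X z\<bar>"
      by (simp add: f_def pm diff_divide_distrib)
    ultimately show ?thesis using True by (simp add: abs_divide)
  qed (simp add: wt_def)
  have "integral\<^sup>L lborel L - \<kappa> * (\<integral>z. indicator E z * (G (pt z) / \<bar>X z\<bar>) \<partial>lborel) =
    (\<integral>z. indicator E z * (T z / \<bar>X z\<bar>) - \<kappa> * (indicator E z * (G (pt z) / \<bar>X z\<bar>)) \<partial>lborel)"
    unfolding LI integral_mult_right_zero[symmetric]
    by (rule Bochner_Integration.integral_diff[symmetric, OF Ti integrable_mult_right[OF A]])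
  also have "\<bar>\<dots>\<bar> \<le> (\<integral>z. ?C * wt (2 - \<epsilon>) z \<partial>lborel)"
  proof (rule order_trans[OF integral_abs_bound])
    show "(\<integral>z. \<bar>indicator E z * (T z / \<bar>X z\<bar>) - \<kappa> * (indicator E z * (G (pt z) / \<bar>X z\<bar>))\<bar> \<partial>lborel) \<le> (\<integral>z. ?C * wt (2 - \<epsilon>) z \<partial>lborel)"
      using \<epsilon> by (intro integral_mono err integrable_abs integrable_mult_right Bochner_Integration.integrable_diff wi Ti A) auto
  qed
  also have "\<dots> = ?C * integral\<^sup>L lborel (wt (2 - \<epsilon>))" by simp
  finally show ?B unfolding L_def \<kappa>_def c\<epsilon>_def wt_def[abs_def] by (simp only: mult_ac)
qed

end

section \<open>Assembly of the regional estimates\<close>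

lemma rapid_decay_cmult:
  assumes A: "0 \<le> A" and h: "rapid_decay h"
  shows "rapid_decay (\<lambda>s. A * h s)"
  unfolding rapid_decay_def
proof (intro conjI allI)
  show "0 \<le> A * h s" for s using A h by (simp add: rapid_decay_def)
  show "continuous_on UNIV (\<lambda>s. A * h s)" using h by (auto simp: rapid_decay_def intro!: continuous_intros)
  fix N
  obtain C where C: "\<And>s. h s * sqrt (1 + (norm s)\<^sup>2) ^ N \<le> C" using h unfolding rapid_decay_def by blast
  have "A * h s * sqrt (1 + (norm s)\<^sup>2) ^ N \<le> A * C" for s
    using mult_left_mono[OF C[of s] A] by (simp add: mult.assoc)
  then show "\<exists>C. \<forall>s. A * h s * sqrt (1 + (norm s)\<^sup>2) ^ N \<le> C" by blast
qed

text \<open>\<open>C2_bounded_by\<close> controls second derivatives along basis vectors only. This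
  suffices, because the charts were chosen to move in a coordinate direction.\<close>

lemma C2_bounded_by_second_difference:
  fixes f :: "'a::euclidean_space \<Rightarrow> real"
  assumes C2: "C2_bounded_by f B" and e: "e \<in> Basis" and m: "\<And>t. B (p + t *\<^sub>R e) \<le> m"
  shows "\<bar>f (p + (v + u) *\<^sub>R e) + f (p + (v - u) *\<^sub>R e) - 2 * f (p + v *\<^sub>R e)\<bar> \<le> 2 * u\<^sup>2 * m"
proof -
  obtain D1 D2 where D1: "\<And>x. (f has_derivative D1 x) (at x)"
    and D2: "\<And>x v. ((\<lambda>y. D1 y v) has_derivative D2 x v) (at x)"
    and B2: "\<And>x b b'. b \<in> Basis \<Longrightarrow> b' \<in> Basis \<Longrightarrow> \<bar>D2 x b b'\<bar> \<le> B x"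
    using C2 unfolding C2_bounded_by_def by blast
  have line: "((\<lambda>t. h (p + t *\<^sub>R e)) has_real_derivative h' (p + t *\<^sub>R e) e) (at t)"
    if h: "\<And>x. (h has_derivative h' x) (at x)" for h h' and t :: real
  proof -
    have "((\<lambda>t. p + t *\<^sub>R e) has_derivative (\<lambda>t. t *\<^sub>R e)) (at t)" by (auto intro!: derivative_eq_intros)
    from has_derivative_compose[OF this h]
    have "((\<lambda>t. h (p + t *\<^sub>R e)) has_derivative (\<lambda>x. h' (p + t *\<^sub>R e) (x *\<^sub>R e))) (at t)" .
    moreover have "h' (p + t *\<^sub>R e) (x *\<^sub>R e) = h' (p + t *\<^sub>R e) e * x" for x
      using has_derivative_linear[OF h, of "p + t *\<^sub>R e"] by (simp add: linear_scale)
    ultimately show ?thesis by (simp add: has_field_derivative_def)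
  qed
  show ?thesis
  proof (rule second_difference_bound[of "\<lambda>t. f (p + t *\<^sub>R e)" "\<lambda>t. D1 (p + t *\<^sub>R e) e" "\<lambda>t. D2 (p + t *\<^sub>R e) e e"])
    show "((\<lambda>t. f (p + t *\<^sub>R e)) has_real_derivative D1 (p + x *\<^sub>R e) e) (at x)" for x by (rule line[OF D1])
    show "((\<lambda>t. D1 (p + t *\<^sub>R e) e) has_real_derivative D2 (p + x *\<^sub>R e) e e) (at x)" for x by (rule line[OF D2])
    show "\<bar>D2 (p + x *\<^sub>R e) e e\<bar> \<le> m" for x using B2[OF e e, of "p + x *\<^sub>R e"] m[of x] by (rule order_trans)
  qed
qed

theorem theorem10p2:
  fixes \<gamma>0 :: "real \<Rightarrow> real" and r :: real and aleph :: real
    and C1 :: "(real^'n) \<times> (real^'n) \<times> (real^'n) \<Rightarrow> real"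
  assumes d2: "CARD('n) \<ge> 2"
    and aleph: "if CARD('n) = 2 then aleph > 0 else aleph = 0"
    and smooth: "smooth_real \<gamma>0"
    and incr: "mono_on {0..} \<gamma>0"
    and ge1: "\<forall>y\<ge>0. \<gamma>0 y \<ge> 1"
    and polygrowth: "\<forall>k. \<exists>C m. \<forall>y\<ge>0. \<bar>(deriv ^^ k) \<gamma>0 y\<bar> \<le> C * (1 + y) ^ m"
    and r0: "r \<ge> 0"
    and lower: "\<exists>c>0. \<forall>y\<ge>0. c * (1 + y) powr r \<le> \<gamma>0 y"
    and upper: "\<exists>C. \<forall>k\<le>3. \<forall>y\<ge>0. \<bar>(deriv ^^ k) \<gamma>0 y\<bar> \<le> C * (1 + y) powr (r - real k)"
    and C1: "rapid_decay C1"
  shows "\<exists>C :: real^'n \<Rightarrow> real. rapid_decay C \<and>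
    (\<forall>F :: real^'n \<Rightarrow> real^'n \<Rightarrow> real^'n \<Rightarrow> real.
       C2_bounded_by (\<lambda>(s, s1, s2). F s s1 s2) C1 \<longrightarrow>
       (\<forall>\<nu> \<tau> s. 0 < \<nu> \<longrightarrow> \<nu> \<le> 1/2 \<longrightarrow> 0 < \<tau> \<longrightarrow> \<tau> \<le> 1 \<longrightarrow>
          (let \<gamma> = \<gamma>0 ((norm s)\<^sup>2);
               I0 = (\<integral>p. (case p of (s1, s2) \<Rightarrow>
                        let s3 = s1 + s2 - s;
                            \<omega> = (norm s1)\<^sup>2 + (norm s2)\<^sup>2 - (norm s3)\<^sup>2 - (norm s)\<^sup>2
                        in complex_of_real (F s s1 s2) *
                           set_lebesgue_integral lborel {0..\<tau>} (\<lambda>\<theta>1.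
                             set_lebesgue_integral lborel {0..\<tau>} (\<lambda>\<theta>2.
                               exp (complex_of_real (- \<gamma> * (2 * \<tau> - \<theta>1 - \<theta>2))
                                    + \<i> * complex_of_real (\<omega> * (\<theta>1 - \<theta>2) / \<nu>)))))
                     \<partial>(lborel :: ((real^'n) \<times> (real^'n)) measure));
               J = set_lebesgue_integral (hausdorff_measure (2 * CARD('n) - 1)) (Sigma_star s)
                     (\<lambda>(s1, s2). F s s1 s2 / norm (s - s1, s - s2))
           in cmod (I0 - complex_of_real ((1 - exp (- 2 * \<gamma> * \<tau>)) / (2 * \<gamma>) * \<nu> * pi * J))
                \<le> C s * \<nu> powr (2 - aleph))))"
proof -
  let ?D = "2 * CARD('n)"
  \<comment> \<open>For d = 2 the condition 2 - \<epsilon> < d demands a positive loss, for d \<ge>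
    3 none. The cap 1/2 keeps \<epsilon> < 1; a loss smaller than \<open>aleph\<close> only improves
    the estimate, since \<nu> \<le> 1.\<close>
  define \<epsilon> where "\<epsilon> = (if CARD('n) = 2 then min aleph (1/2) else 0)"
  have \<epsilon>: "0 \<le> \<epsilon>" "\<epsilon> < 1" "2 - \<epsilon> < real CARD('n)" "\<epsilon> \<le> aleph"
    using aleph d2 by (auto simp: \<epsilon>_def split: if_splits)
  \<comment> \<open>The order 2d is the one used in \<open>integrable_weight\<close>, and it also
    makes the integrand integrable over the full space of dimension 2d.\<close>
  obtain h where h: "rapid_decay h" and env: "\<And>s x y. C1 (s, s + x, s + y) * (1 + (norm (x, y))\<^sup>2) ^ ?D \<le> h s"
    using rapid_decay_envelope[OF C1, of ?D] by blast
  have h0: "0 \<le> h s" for s using h by (simp add: rapid_decay_def)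
  have dim: "Suc CARD('n hidx) = 2 * CARD('n)" using d2 by (simp add: card_hidx)
  define b :: "'n \<Rightarrow> (real^'n) \<times> (real^'n)" where "b i = (0, axis i 1)" for i
  define \<iota> :: "'n \<Rightarrow> real^'n hidx \<Rightarrow> (real^'n) \<times> (real^'n)" where "\<iota> i = chart (b i)" for i
  have reg: "cone_region (b i) (\<iota> i) i" for i
  proof -
    have "cone_chart (b i) (\<iota> i)" unfolding \<iota>_def
      by (rule cone_chart_chart[OF dim]) (auto simp: b_def swp_def pairing_def norm_prod_def inner_prod_def)
    then show ?thesis unfolding cone_region_def cone_region_axioms_def using dim by (simp add: b_def)
  qed
  define c\<epsilon> where "c\<epsilon> = (\<integral>v. \<bar>v\<bar> powr \<epsilon> / (1 + v\<^sup>2) \<partial>lborel)"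
  define W where "W i = (\<integral>z. indicator (cone_region.E (\<iota> i) i) z *
     (\<bar>cone_chart.X (b i) (\<iota> i) z\<bar> powr (- (2 - \<epsilon>)) / (1 + (norm z)\<^sup>2) ^ ?D) \<partial>lborel)" for i
  \<comment> \<open>All charts and integrals entering \<open>A\<close> are fixed before
    \<open>F\<close>, \<nu>, \<tau> and \<open>s\<close>.\<close>
  define A where "A = (\<Sum>i\<in>UNIV. 12 * c\<epsilon> * W i)"
  have c0: "0 \<le> c\<epsilon>" unfolding c\<epsilon>_def by (intro integral_nonneg_AE AE_I2) (auto intro!: divide_nonneg_nonneg add_nonneg_nonneg)
  have W0: "0 \<le> W i" for i unfolding W_def by (intro integral_nonneg_AE AE_I2) (auto simp: indicator_def)
  have A0: "0 \<le> A" unfolding A_def using c0 W0 by (intro sum_nonneg mult_nonneg_nonneg) auto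
  show ?thesis
  proof (intro exI[of _ "\<lambda>s. A * h s"] conjI allI impI)
    show "rapid_decay (\<lambda>s. A * h s)" by (rule rapid_decay_cmult[OF A0 h])
    fix F :: "real^'n \<Rightarrow> real^'n \<Rightarrow> real^'n \<Rightarrow> real" and \<nu> \<tau> :: real and s :: "real^'n"
    assume C2: "C2_bounded_by (\<lambda>(s, s1, s2). F s s1 s2) C1"
      and \<nu>: "0 < \<nu>" "\<nu> \<le> 1/2" and \<tau>: "0 < \<tau>" "\<tau> \<le> 1"
    define \<gamma> where "\<gamma> = \<gamma>0 ((norm s)\<^sup>2)"
    have \<gamma>: "1 \<le> \<gamma>" using ge1 by (simp add: \<gamma>_def)
    have \<gamma>': "0 < \<gamma>" using \<gamma> by simp
    define G where "G v = F s (s + fst v) (s + snd v)" for v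
    define k where "k t = kern \<gamma> \<tau> \<nu> (2 * t)" for t
    define \<kappa> where "\<kappa> = (\<integral>t. k t \<partial>lborel)"
    have \<kappa>: "\<kappa> = (1 - exp (- 2 * \<gamma> * \<tau>)) / (2 * \<gamma>) * \<nu> * pi"
      unfolding \<kappa>_def k_def by (rule kern_total(1)[OF \<gamma> \<tau>(1) \<nu>(1)])
    interpret R: cone_region "b i" "(s, s)" "\<iota> i" i for i by (rule reg)

    have contF: "continuous_on UNIV (\<lambda>(s, s1, s2). F s s1 s2)"
      using C2 unfolding C2_bounded_by_def
      by (meson continuous_at_imp_continuous_on has_derivative_continuous)
    have contFs: "continuous_on UNIV (\<lambda>q. F s (fst q) (snd q))"
    proof -
      have "continuous_on UNIV (\<lambda>q. (\<lambda>(s, s1, s2). F s s1 s2) (s, fst q, snd q))"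
        by (rule continuous_on_compose2[OF contF]) (auto intro!: continuous_intros)
      then show ?thesis by (simp add: case_prod_unfold)
    qed
    have contG: "continuous_on UNIV G"
    proof -
      have "continuous_on UNIV (\<lambda>v. (\<lambda>(s, s1, s2). F s s1 s2) (s, s + fst v, s + snd v))"
        by (rule continuous_on_compose2[OF contF]) (auto intro!: continuous_intros)
      then show ?thesis by (simp add: G_def)
    qed
    have Gm[measurable]: "G \<in> borel_measurable borel" by (rule borel_measurable_continuous_onI[OF contG])
    have FC: "\<bar>F s s1 s2\<bar> \<le> C1 (s, s1, s2)" for s1 s2
      using C2 unfolding C2_bounded_by_def by fastforce
    have C1h: "C1 (s, s + fst v, s + snd v) \<le> h s / (1 + (norm v)\<^sup>2) ^ ?D" for v
    proof -
      have "0 < (1 + (norm v)\<^sup>2) ^ ?D" by (intro zero_less_power add_pos_nonneg) auto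
      then show ?thesis using env[of s "fst v" "snd v"] by (simp add: pos_le_divide_eq)
    qed
    have Gh: "\<bar>G v\<bar> \<le> h s / (1 + (norm v)\<^sup>2) ^ ?D" for v
      unfolding G_def by (rule order_trans[OF FC C1h])
    have Gi: "integrable lborel G"
    proof (rule Bochner_Integration.integrable_bound[OF integrable_mult_right[OF integrable_inverse_quadratic_power, of "h s"]])
      have D: "DIM((real^'n) \<times> (real^'n)) = ?D" by simp
      show "AE v in lborel. norm (G v) \<le> norm (h s * (1 / (1 + (norm v)\<^sup>2) ^ DIM((real^'n) \<times> (real^'n))))"
        unfolding D using Gh h0[of s] by (intro AE_I2) (auto simp: abs_mult)
    qed simp
    \<comment> \<open>The bound has to be uniform along each line: by Pythagoras no point of the
      line has a smaller norm than \<open>z\<close>.\<close>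
    have shift: "h s / (1 + (norm (\<iota> i z + u *\<^sub>R b i))\<^sup>2) ^ ?D \<le> h s / (1 + (norm z)\<^sup>2) ^ ?D" for i z u
    proof (intro divide_left_mono power_mono mult_pos_pos zero_less_power add_pos_nonneg)
      show "1 + (norm z)\<^sup>2 \<le> 1 + (norm (\<iota> i z + u *\<^sub>R b i))\<^sup>2" unfolding R.norm_iota_b by simp
    qed (use h0 in auto)
    have Gb: "\<bar>G (\<iota> i z + u *\<^sub>R b i)\<bar> \<le> h s / (1 + (norm z)\<^sup>2) ^ ?D" for i z u
      by (rule order_trans[OF Gh shift])
    have G2: "\<bar>G (\<iota> i z + (v + u) *\<^sub>R b i) + G (\<iota> i z + (v - u) *\<^sub>R b i) - 2 * G (\<iota> i z + v *\<^sub>R b i)\<bar>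
       \<le> 2 * u\<^sup>2 * (h s / (1 + (norm z)\<^sup>2) ^ ?D)" for i z v u
    proof -
      \<comment> \<open>The hypothesis on \<open>F\<close> concerns triples (s, s1, s2). Moving
        along \<open>b i\<close> with \<open>s\<close> fixed is motion along a basis vector in the
        third slot.\<close>
      define e where "e = (0::real^'n, 0::real^'n, axis i 1 :: real^'n)"
      define p where "p = (s, s + fst (\<iota> i z), s + snd (\<iota> i z))"
      have e: "e \<in> Basis" unfolding e_def Basis_prod_def by (auto simp: axis_in_Basis_iff)
      have pe: "p + t *\<^sub>R e = (s, s + fst (\<iota> i z + t *\<^sub>R b i), s + snd (\<iota> i z + t *\<^sub>R b i))" for t
        by (simp add: p_def e_def b_def)
      have "C1 (p + t *\<^sub>R e) \<le> h s / (1 + (norm z)\<^sup>2) ^ ?D" for t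
        unfolding pe by (rule order_trans[OF C1h shift])
      from C2_bounded_by_second_difference[OF C2 e this, of v u] show ?thesis
        unfolding pe by (simp add: G_def)
    qed
    note est = R.region_estimate[OF \<gamma> \<tau>(1) \<nu>(1) \<epsilon>(1-3) Gi Gb G2, folded k_def \<kappa>_def c\<epsilon>_def W_def]

    define J where "J = (\<Sum>i\<in>UNIV. \<integral>z. indicator (R.E i) z * (G (R.pt i z) / \<bar>R.X i z\<bar>) \<partial>lborel)"
    have J: "set_lebesgue_integral (hausdorff_measure (2 * CARD('n) - 1)) (Sigma_star s)
                     (\<lambda>(s1, s2). F s s1 s2 / norm (s - s1, s - s2)) = J"
    proof -
      define F' where "F' q = F s (fst q) (snd q)" for q
      define \<phi> where "\<phi> i = R.\<phi> i" for i
      have F'\<phi>: "F' (\<phi> i z) = G (R.pt i z)" for i z by (simp add: F'_def \<phi>_def R.phi_pt G_def)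
      have F'm: "F' \<in> borel_measurable borel"
        unfolding F'_def by (rule borel_measurable_continuous_onI[OF contFs])
      have "set_lebesgue_integral (hausdorff_measure (2 * CARD('n) - 1)) (Sigma_star s) (\<lambda>q. F' q / norm (q - (s, s))) = J"
        unfolding J_def F'\<phi>[symmetric]
        by (rule Sigma_star_integral[OF d2 F'm reg]) (simp only: \<phi>_def, simp only: F'\<phi> est(1))
      moreover have "(\<lambda>(s1, s2). F s s1 s2 / norm (s - s1, s - s2)) = (\<lambda>q. F' q / norm (q - (s, s)))"
      proof
        fix q :: "(real^'n) \<times> (real^'n)"
        have "norm (s - fst q, s - snd q) = norm (q - (s, s))"
          by (cases q) (simp add: norm_prod_def norm_minus_commute)
        then show "(case q of (s1, s2) \<Rightarrow> F s s1 s2 / norm (s - s1, s - s2)) = F' q / norm (q - (s, s))"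
          by (simp add: F'_def case_prod_beta)
      qed
      ultimately show ?thesis by simp
    qed

    define I where "I = (\<integral>v. G v * k (pairing v) \<partial>lborel)"
    have I0: "(\<integral>p. (case p of (s1, s2) \<Rightarrow>
                        let s3 = s1 + s2 - s;
                            \<omega> = (norm s1)\<^sup>2 + (norm s2)\<^sup>2 - (norm s3)\<^sup>2 - (norm s)\<^sup>2
                        in complex_of_real (F s s1 s2) *
                           set_lebesgue_integral lborel {0..\<tau>} (\<lambda>\<theta>1.
                             set_lebesgue_integral lborel {0..\<tau>} (\<lambda>\<theta>2.
                               exp (complex_of_real (- \<gamma> * (2 * \<tau> - \<theta>1 - \<theta>2))
                                    + \<i> * complex_of_real (\<omega> * (\<theta>1 - \<theta>2) / \<nu>)))))
                     \<partial>(lborel :: ((real^'n) \<times> (real^'n)) measure)) = complex_of_real I" (is "?I0 = _")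
    proof -
      define L where "L p = F s (fst p) (snd p) * k (pairing (p - (s, s)))" for p
      have \<omega>: "(norm s1)\<^sup>2 + (norm s2)\<^sup>2 - (norm (s1 + s2 - s))\<^sup>2 - (norm s)\<^sup>2 = - (2 * pairing ((s1, s2) - (s, s)))" for s1 s2 :: "real^'n"
        unfolding power2_norm_eq_inner pairing_def
        by (simp add: inner_add_left inner_add_right inner_diff_left inner_diff_right inner_commute algebra_simps)
      have "?I0 = (\<integral>p. complex_of_real (L p) \<partial>lborel)"
        unfolding Let_def kern_integral[OF \<gamma>' \<tau>(1) \<nu>(1)] \<omega> kern_even
        by (intro Bochner_Integration.integral_cong) (auto simp: L_def k_def)
      also have "\<dots> = complex_of_real (\<integral>p. L p \<partial>lborel)" by simp
      also have "(\<integral>p. L p \<partial>lborel) = (\<integral>v. L ((s, s) + v) \<partial>lborel)"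
      proof -
        note [measurable] = borel_measurable_continuous_onI[OF contFs]
        have [measurable]: "k \<in> borel_measurable borel" unfolding k_def by measurable
        have Lm: "L \<in> borel_measurable borel" unfolding L_def by measurable
        show ?thesis
          by (subst lborel_distr_plus[of "(s, s)", symmetric], subst integral_distr) (use Lm in auto)
      qed
      also have "\<dots> = I" unfolding I_def L_def G_def by simp
      finally show ?thesis .
    qed

    have Isum: "I = (\<Sum>i\<in>UNIV. \<integral>v. indicator (max_coord_region i) (fst v) * (G v * k (pairing v)) \<partial>lborel)"
    proof -
      have km[measurable]: "k \<in> borel_measurable borel" unfolding k_def by measurable
      have fstm[measurable]: "(\<lambda>v::(real^'n)\<times>(real^'n). fst v) \<in> borel_measurable borel"
        by (intro borel_measurable_continuous_onI continuous_intros)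
      have ii: "integrable lborel (\<lambda>v. indicator (max_coord_region i) (fst v) * (G v * k (pairing v)))" for i
        unfolding k_def by (rule integrable_indicator_kern[OF \<gamma> \<tau>(1) Gi])
      have ne: "AE v :: (real^'n) \<times> (real^'n) in lborel. fst v \<noteq> 0"
      proof -
        obtain u :: "real^'n" where u: "u \<in> Basis" using nonempty_Basis by blast
        have "(u, 0::real^'n) \<noteq> 0" using nonzero_Basis[OF u] by (auto simp: zero_prod_def)
        from AE_inner_neq_0[OF this] show ?thesis by eventually_elim (auto simp: inner_prod_def)
      qed
      have "I = (\<integral>v. (\<Sum>i\<in>UNIV. indicator (max_coord_region i) (fst v) * (G v * k (pairing v))) \<partial>lborel)"
        unfolding I_def
      proof (rule integral_cong_AE)
        show "AE v in lborel. G v * k (pairing v) = (\<Sum>i\<in>UNIV. indicator (max_coord_region i) (fst v) * (G v * k (pairing v)))"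
          using ne
        proof eventually_elim
          case (elim v)
          then obtain i where i: "fst v \<in> max_coord_region i" using max_coord_region_cover by blast
          have "fst v \<in> max_coord_region j \<longleftrightarrow> j = i" for j using i max_coord_region_disjoint[OF i, of j] by blast
          then have "indicator (max_coord_region j) (fst v) * (G v * k (pairing v)) = (if j = i then G v * k (pairing v) else 0)" for j by (simp add: indicator_def)
          then show ?case by (simp only: sum.delta[OF finite_class.finite_UNIV] UNIV_I if_True)
        qed
      qed measurable
      also have "\<dots> = (\<Sum>i\<in>UNIV. \<integral>v. indicator (max_coord_region i) (fst v) * (G v * k (pairing v)) \<partial>lborel)"
        by (intro Bochner_Integration.integral_sum ii)
      finally show ?thesis .
    qed

    have "\<bar>I - \<kappa> * J\<bar> \<le> (\<Sum>i\<in>UNIV. 12 * c\<epsilon> * W i * h s * \<nu> powr (2 - \<epsilon>))"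
    proof -
      have "I - \<kappa> * J = (\<Sum>i\<in>UNIV. (\<integral>v. indicator (max_coord_region i) (fst v) * (G v * k (pairing v)) \<partial>lborel) -
         \<kappa> * (\<integral>z. indicator (R.E i) z * (G (R.pt i z) / \<bar>R.X i z\<bar>) \<partial>lborel))"
        unfolding Isum J_def by (simp only: sum_distrib_left sum_subtractf)
      also have "\<bar>\<dots>\<bar> \<le> (\<Sum>i\<in>UNIV. \<bar>(\<integral>v. indicator (max_coord_region i) (fst v) * (G v * k (pairing v)) \<partial>lborel) -
         \<kappa> * (\<integral>z. indicator (R.E i) z * (G (R.pt i z) / \<bar>R.X i z\<bar>) \<partial>lborel)\<bar>)" by (rule sum_abs)
      also have "\<dots> \<le> (\<Sum>i\<in>UNIV. 12 * c\<epsilon> * W i * h s * \<nu> powr (2 - \<epsilon>))" by (intro sum_mono est(2))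
      finally show ?thesis .
    qed
    also have "\<dots> = A * h s * \<nu> powr (2 - \<epsilon>)" unfolding A_def by (simp only: sum_distrib_right)
    also have "\<dots> \<le> A * h s * \<nu> powr (2 - aleph)"
      using \<nu> \<epsilon>(4) A0 h0[of s] by (intro mult_left_mono powr_mono') auto
    finally have fin: "\<bar>I - \<kappa> * J\<bar> \<le> A * h s * \<nu> powr (2 - aleph)" .
    have "cmod (complex_of_real I - complex_of_real (\<kappa> * J)) = \<bar>I - \<kappa> * J\<bar>"
      by (simp only: of_real_diff[symmetric] norm_of_real)
    with fin show "let \<gamma> = \<gamma>0 ((norm s)\<^sup>2);
               I0 = (\<integral>p. (case p of (s1, s2) \<Rightarrow>
                        let s3 = s1 + s2 - s;
                            \<omega> = (norm s1)\<^sup>2 + (norm s2)\<^sup>2 - (norm s3)\<^sup>2 - (norm s)\<^sup>2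
                        in complex_of_real (F s s1 s2) *
                           set_lebesgue_integral lborel {0..\<tau>} (\<lambda>\<theta>1.
                             set_lebesgue_integral lborel {0..\<tau>} (\<lambda>\<theta>2.
                               exp (complex_of_real (- \<gamma> * (2 * \<tau> - \<theta>1 - \<theta>2))
                                    + \<i> * complex_of_real (\<omega> * (\<theta>1 - \<theta>2) / \<nu>)))))
                     \<partial>(lborel :: ((real^'n) \<times> (real^'n)) measure));
               J = set_lebesgue_integral (hausdorff_measure (2 * CARD('n) - 1)) (Sigma_star s)
                     (\<lambda>(s1, s2). F s s1 s2 / norm (s - s1, s - s2))
           in cmod (I0 - complex_of_real ((1 - exp (- 2 * \<gamma> * \<tau>)) / (2 * \<gamma>) * \<nu> * pi * J))
                \<le> A * h s * \<nu> powr (2 - aleph)"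
      unfolding Let_def \<gamma>_def[symmetric] J I0[unfolded Let_def] \<kappa>[symmetric] by (simp only:)
  qed
qed

end
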